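(* Suppose Assumptions (A) and (B) (stated in the context) hold. If either $s_2=o(n/(\kappa_n\gamma_n))$ or Assumption (C) (stated in the context) holds, then $\tilde{\boldsymbol\beta}\to\boldsymbol\beta^\star$ in probability. If either $s_2=o(\sqrt n/(\kappa_n\gamma_n))$ holds, or both Assumption (C) and $D_n^2/n=o(1)$ hold, then $\sqrt n(\tilde{\boldsymbol\beta}-\boldsymbol\beta^\star)\to N(0,\sigma^2\boldsymbol\Sigma_X^{-1})$ in distribution.
   Context: Notation: $a_n\ll b_n$ (equivalently $b_n\gg a_n$) means $a_n=o(b_n)$; all limits are as $n\to\infty$. Model: $d\ge 1$ is a fixed integer. For each $n$ the data satisfy $Y_i=\mu_i^\star+\boldsymbol X_i^T\boldsymbol\beta^\star+\epsilon_i$, $1\le i\le n$, where $\boldsymbol\beta^\star\in\mathbb R^d$ and $\boldsymbol\mu^\star=(\mu_1^\star,\dots,\mu_n^\star)^T$ are deterministic ($\boldsymbol\mu^\star$ may vary with $n$). The $\boldsymbol X_i$ are i.i.d. copies of a random vector $\boldsymbol X_0\in\mathbb R^d$ with mean zero and positive definite covariance matrix $\boldsymbol\Sigma_X$; they are independent of the $\epsilon_i$, which are i.i.d. copies of a random variable $\epsilon_0$ with mean zero and variance $\sigma^2>0$. $\boldsymbol X$ is the $n\times d$ matrix with rows $\boldsymbol X_i^T$ and $\boldsymbol Y=(Y_1,\dots,Y_n)^T$. Assumption (A): there are positive sequences $\kappa_n\ll\sqrt n$, $\gamma_n\ll\sqrt n$ with $P(\max_{1\le i\le n}\|\boldsymbol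 X_i\|_2>\kappa_n)\to0$ and $P(\max_{1\le i\le n}|\epsilon_i|>\gamma_n)\to0$. Incidental parameters: with $s=s_1+s_2$ and $s_1+s_2=o(n)$: $|\mu_i^\star|\gg\max\{\kappa_n,\gamma_n\}$ for $1\le i\le s_1$; $0<|\mu_i^\star|\le\gamma_n$ for $s_1+1\le i\le s$; $\mu_i^\star=0$ for $s+1\le i\le n$. Let $\boldsymbol\mu_2^\star=(\mu_{s_1+1}^\star,\dots,\mu_s^\star)^T$, $D_n=\|\boldsymbol\mu_2^\star\|_2$ and $\mu^\star=\min_{1\le i\le s_1}|\mu_i^\star|$. Assumption (B): the regularization parameter $\lambda=\lambda_n>0$ satisfies $\kappa_n\ll\lambda$, $\alpha\gamma_n\le\lambda$ for a constant $\alpha>2$, and $\lambda\ll\min\{\mu^\star,\sqrt n\}$. Assumption (C): there is a constant $\delta>0$ such that $E\|\boldsymbol X_0\|_2^{2+\delta}<\infty$ and $\|\boldsymbol\mu_2^\star\|_2/\|\boldsymbol\mu_2^\star\|_{2+\delta}\to\infty$, where $\|\boldsymbol\mu_2^\star\|_{2+\delta}=(\sum_{i=s_1+1}^{s}|\mu_i^\star|^{2+\delta})^{1/(2+\delta)}$. Two-step estimator: first let $(\hat{\boldsymbol\mu},\hat{\boldsymbol\beta})$ be a minimizer over $\mathbb R^n\times\mathbb R^d$ of $\|\boldsymbol Y-\boldsymbol\mu-\boldsymbol X\boldsymbol\beta\|_2^2+2\lambda\sum_{i=1}^n|\mu_i|$ and put $\hat I_0=\{1\le i\le n:\hat\mu_i=0\}$.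 Then $\tilde{\boldsymbol\beta}=(\boldsymbol X_{\hat I_0}^T\boldsymbol X_{\hat I_0})^{-1}\boldsymbol X_{\hat I_0}^T\boldsymbol Y_{\hat I_0}$, where $\boldsymbol X_{\hat I_0}$ is the matrix with rows $\boldsymbol X_i^T$, $i\in\hat I_0$, and $\boldsymbol Y_{\hat I_0}$ is the vector of the corresponding $Y_i$. *)

theory Defs
  imports "HOL-Probability.Probability" "HOL-Library.Landau_Symbols"
begin

section \<open>Covariance, the multivariate normal law, modes of convergence\<close>

definition covariance_matrix :: "'a measure \<Rightarrow> ('a \<Rightarrow> real ^ 'd) \<Rightarrow> real ^ 'd ^ 'd" where
  "covariance_matrix P Z =
     (\<chi> i j. \<integral>\<omega>. (Z \<omega> $ i - (\<integral>\<omega>'. Z \<omega>' $ i \<partial>P)) * (Z \<omega> $ j - (\<integral>\<omega>'. Z \<omega>' $ j \<partial>P)) \<partial>P)"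

definition positive_definite :: "real ^ 'd ^ 'd \<Rightarrow> bool" where
  "positive_definite A \<longleftrightarrow> transpose A = A \<and> (\<forall>v. v \<noteq> 0 \<longrightarrow> v \<bullet> (A *v v) > 0)"

text \<open>The law \<open>N(m, S)\<close>, given by its Lebesgue density; only meaningful for positive definite \<open>S\<close>.\<close>

definition multivariate_normal :: "real ^ 'd \<Rightarrow> real ^ 'd ^ 'd \<Rightarrow> (real ^ 'd) measure" where
  "multivariate_normal m S =
     density lborel (\<lambda>x. ennreal (exp (- ((x - m) \<bullet> (matrix_inv S *v (x - m))) / 2)
                                   / sqrt ((2 * pi) ^ CARD('d) * det S)))"

text \<open>In both modes of convergence the \<open>n\<close>-th random element may live on its own probability
  space \<open>M n\<close>. Measurability is part of the notions, because integrals and measures of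
  non-measurable objects are \<open>0\<close> by convention.\<close>

definition converges_in_probability ::
    "(nat \<Rightarrow> 'a measure) \<Rightarrow> (nat \<Rightarrow> 'a \<Rightarrow> 'b :: metric_space) \<Rightarrow> 'b \<Rightarrow> bool" where
  "converges_in_probability M Z c \<longleftrightarrow>
     (\<forall>n. Z n \<in> borel_measurable (M n)) \<and>
     (\<forall>e>0. (\<lambda>n. measure (M n) {\<omega> \<in> space (M n). dist (Z n \<omega>) c > e}) \<longlonglongrightarrow> 0)"

definition converges_in_distribution ::
    "(nat \<Rightarrow> 'a measure) \<Rightarrow> (nat \<Rightarrow> 'a \<Rightarrow> 'b :: metric_space) \<Rightarrow> 'b measure \<Rightarrow> bool" where
  "converges_in_distribution M Z N \<longleftrightarrow>
     (\<forall>n. Z n \<in> borel_measurable (M n)) \<and>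
     (\<forall>f :: 'b \<Rightarrow> real. continuous_on UNIV f \<longrightarrow> bounded (range f) \<longrightarrow>
        (\<lambda>n. \<integral>\<omega>. f (Z n \<omega>) \<partial>M n) \<longlonglongrightarrow> (\<integral>x. f x \<partial>N))"

text \<open>Independence of two random elements of different types; \<open>prob_space.indep_var\<close> requires
  both to have the same type.\<close>

definition independent_elements ::
    "'a measure \<Rightarrow> 'b measure \<Rightarrow> ('a \<Rightarrow> 'b) \<Rightarrow> 'c measure \<Rightarrow> ('a \<Rightarrow> 'c) \<Rightarrow> bool" where
  "independent_elements M S U T V \<longleftrightarrow>
     U \<in> measurable M S \<and> V \<in> measurable M T \<and>
     prob_space.indep_set M
       {U -` A \<inter> space M | A. A \<in> sets S} {V -` A \<inter> space M | A. A \<in> sets T}"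

section \<open>The two-step estimator\<close>

text \<open>Vectors in \<open>\<real>\<^sup>n\<close> with varying \<open>n\<close> are functions on \<open>nat\<close> of which only the
  coordinates \<open>1, \<dots>, n\<close> are used.\<close>

definition penalized_loss ::
    "nat \<Rightarrow> real \<Rightarrow> (nat \<Rightarrow> real ^ 'd) \<Rightarrow> (nat \<Rightarrow> real) \<Rightarrow> (nat \<Rightarrow> real) \<Rightarrow> real ^ 'd \<Rightarrow> real" where
  "penalized_loss n lam x y m b =
     (\<Sum>i=1..n. (y i - m i - x i \<bullet> b)\<^sup>2) + 2 * lam * (\<Sum>i=1..n. \<bar>m i\<bar>)"

text \<open>There need not be a unique minimizer, hence a predicate.\<close>

definition is_penalized_minimizer ::
    "nat \<Rightarrow> real \<Rightarrow> (nat \<Rightarrow> real ^ 'd) \<Rightarrow> (nat \<Rightarrow> real) \<Rightarrow> (nat \<Rightarrow> real) \<Rightarrow> real ^ 'd \<Rightarrow> bool" where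
  "is_penalized_minimizer n lam x y m b \<longleftrightarrow>
     is_arg_min (\<lambda>(m', b'). penalized_loss n lam x y m' b') (\<lambda>_. True) (m, b)"

definition zero_set :: "nat \<Rightarrow> (nat \<Rightarrow> real) \<Rightarrow> nat set" where
  "zero_set n m = {i \<in> {1..n}. m i = 0}"

text \<open>\<open>(X\<^sub>I\<^sup>T X\<^sub>I)\<^sup>-\<^sup>1 X\<^sub>I\<^sup>T Y\<^sub>I\<close>, with the matrix products over
  the rows in \<open>I\<close> written out as sums. If the Gram matrix is singular, \<open>matrix_inv\<close> yields some
  unspecified matrix.\<close>

definition gram_matrix :: "(nat \<Rightarrow> real ^ 'd) \<Rightarrow> nat set \<Rightarrow> real ^ 'd ^ 'd" where
  "gram_matrix x I = (\<chi> a b. \<Sum>i\<in>I. x i $ a * x i $ b)"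

definition least_squares ::
    "(nat \<Rightarrow> real ^ 'd) \<Rightarrow> (nat \<Rightarrow> real) \<Rightarrow> nat set \<Rightarrow> real ^ 'd" where
  "least_squares x y I = matrix_inv (gram_matrix x I) *v (\<Sum>i\<in>I. y i *\<^sub>R x i)"

section \<open>Model and assumptions\<close>

text \<open>A triangular array: the \<open>n\<close>-th sample \<open>X n 1, \<dots>, X n n\<close>, \<open>eps n 1, \<dots>, eps n n\<close> is
  defined on \<open>M n\<close>. A single probability space with a single sequence is the special case in which
  \<open>M\<close>, \<open>X\<close> and \<open>eps\<close> do not depend on \<open>n\<close>. The generic \<open>X0\<close> and \<open>eps0\<close> only
  carry the common laws and live on \<open>P\<close>.\<close>

definition incidental_model ::
    "'b measure \<Rightarrow> ('b \<Rightarrow> real ^ 'd) \<Rightarrow> ('b \<Rightarrow> real) \<Rightarrow> real \<Rightarrow> (nat \<Rightarrow> 'a measure) \<Rightarrow>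
     (nat \<Rightarrow> nat \<Rightarrow> 'a \<Rightarrow> real ^ 'd) \<Rightarrow> (nat \<Rightarrow> nat \<Rightarrow> 'a \<Rightarrow> real) \<Rightarrow>
     (nat \<Rightarrow> nat \<Rightarrow> 'a \<Rightarrow> real) \<Rightarrow> (nat \<Rightarrow> nat \<Rightarrow> real) \<Rightarrow> real ^ 'd \<Rightarrow> bool" where
  "incidental_model P X0 eps0 sd M X eps Y mu beta \<longleftrightarrow>
     prob_space P \<and>
     X0 \<in> borel_measurable P \<and> integrable P X0 \<and> (\<integral>\<omega>. X0 \<omega> \<partial>P) = 0 \<and>
     integrable P (\<lambda>\<omega>. (norm (X0 \<omega>))\<^sup>2) \<and> positive_definite (covariance_matrix P X0) \<and>
     eps0 \<in> borel_measurable P \<and> integrable P eps0 \<and> (\<integral>\<omega>. eps0 \<omega> \<partial>P) = 0 \<and>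
     integrable P (\<lambda>\<omega>. (eps0 \<omega>)\<^sup>2) \<and> prob_space.variance P eps0 = sd\<^sup>2 \<and> sd\<^sup>2 > 0 \<and>
     (\<forall>n. prob_space (M n) \<and>
        prob_space.indep_vars (M n) (\<lambda>_. borel) (X n) {1..n} \<and>
        (\<forall>i\<in>{1..n}. distr (M n) borel (X n i) = distr P borel X0) \<and>
        prob_space.indep_vars (M n) (\<lambda>_. borel) (eps n) {1..n} \<and>
        (\<forall>i\<in>{1..n}. distr (M n) borel (eps n i) = distr P borel eps0) \<and>
        independent_elements (M n)
          (PiM {1..n} (\<lambda>_. borel)) (\<lambda>\<omega>. \<lambda>i\<in>{1..n}. X n i \<omega>)
          (PiM {1..n} (\<lambda>_. borel)) (\<lambda>\<omega>. \<lambda>i\<in>{1..n}. eps n i \<omega>) \<and>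
        (\<forall>\<omega>\<in>space (M n). \<forall>i\<in>{1..n}. Y n i \<omega> = mu n i + X n i \<omega> \<bullet> beta + eps n i \<omega>))"

definition assumption_A ::
    "(nat \<Rightarrow> 'a measure) \<Rightarrow> (nat \<Rightarrow> nat \<Rightarrow> 'a \<Rightarrow> real ^ 'd) \<Rightarrow> (nat \<Rightarrow> nat \<Rightarrow> 'a \<Rightarrow> real) \<Rightarrow>
     (nat \<Rightarrow> real) \<Rightarrow> (nat \<Rightarrow> real) \<Rightarrow> bool" where
  "assumption_A M X eps kappa gamma \<longleftrightarrow>
     (\<forall>n. kappa n > 0) \<and> (\<forall>n. gamma n > 0) \<and>
     kappa \<in> o(\<lambda>n. sqrt (real n)) \<and> gamma \<in> o(\<lambda>n. sqrt (real n)) \<and>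
     (\<lambda>n. measure (M n) {\<omega> \<in> space (M n). (MAX i\<in>{1..n}. norm (X n i \<omega>)) > kappa n}) \<longlonglongrightarrow> 0 \<and>
     (\<lambda>n. measure (M n) {\<omega> \<in> space (M n). (MAX i\<in>{1..n}. \<bar>eps n i \<omega>\<bar>) > gamma n}) \<longlonglongrightarrow> 0"

text \<open>The relation \<open>|\<mu>\<^sub>i| \<ggreater> max {\<kappa>\<^sub>n, \<gamma>\<^sub>n}\<close> is read uniformly in
  \<open>1 \<le> i \<le> s1 n\<close>; it is vacuous when \<open>s1 n = 0\<close>.\<close>

definition incidental_parameters ::
    "(nat \<Rightarrow> nat \<Rightarrow> real) \<Rightarrow> (nat \<Rightarrow> nat) \<Rightarrow> (nat \<Rightarrow> nat) \<Rightarrow> (nat \<Rightarrow> real) \<Rightarrow> (nat \<Rightarrow> real) \<Rightarrow> bool" where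
  "incidental_parameters mu s1 s2 kappa gamma \<longleftrightarrow>
     (\<forall>n. s1 n + s2 n \<le> n) \<and>
     (\<lambda>n. real (s1 n + s2 n)) \<in> o(\<lambda>n. real n) \<and>
     (\<forall>c>0. \<forall>\<^sub>F n in sequentially. \<forall>i\<in>{1..s1 n}. max (kappa n) (gamma n) \<le> c * \<bar>mu n i\<bar>) \<and>
     (\<forall>n. \<forall>i\<in>{s1 n + 1..s1 n + s2 n}. 0 < \<bar>mu n i\<bar> \<and> \<bar>mu n i\<bar> \<le> gamma n) \<and>
     (\<forall>n. \<forall>i\<in>{s1 n + s2 n + 1..n}. mu n i = 0)"

text \<open>\<open>Min (insert (sqrt n) \<dots>)\<close> is \<open>min {\<mu>\<^sup>\<star>, sqrt n}\<close> with
  \<open>\<mu>\<^sup>\<star> = min {|\<mu>\<^sub>i| : 1 \<le> i \<le> s1 n}\<close>, where \<open>\<mu>\<^sup>\<star> = \<infinity>\<close> if \<open>s1 n = 0\<close>.\<close>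

definition assumption_B ::
    "(nat \<Rightarrow> nat \<Rightarrow> real) \<Rightarrow> (nat \<Rightarrow> nat) \<Rightarrow> (nat \<Rightarrow> real) \<Rightarrow> (nat \<Rightarrow> real) \<Rightarrow> (nat \<Rightarrow> real) \<Rightarrow> bool" where
  "assumption_B mu s1 kappa gamma lam \<longleftrightarrow>
     (\<forall>n. lam n > 0) \<and> kappa \<in> o(lam) \<and>
     (\<exists>alpha>2. \<forall>n. alpha * gamma n \<le> lam n) \<and>
     lam \<in> o(\<lambda>n. Min (insert (sqrt (real n)) ((\<lambda>i. \<bar>mu n i\<bar>) ` {1..s1 n})))"

definition D_norm :: "(nat \<Rightarrow> nat \<Rightarrow> real) \<Rightarrow> (nat \<Rightarrow> nat) \<Rightarrow> (nat \<Rightarrow> nat) \<Rightarrow> nat \<Rightarrow> real" where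
  "D_norm mu s1 s2 n = L2_set (mu n) {s1 n + 1..s1 n + s2 n}"

definition assumption_C ::
    "'b measure \<Rightarrow> ('b \<Rightarrow> real ^ 'd) \<Rightarrow>
     (nat \<Rightarrow> nat \<Rightarrow> real) \<Rightarrow> (nat \<Rightarrow> nat) \<Rightarrow> (nat \<Rightarrow> nat) \<Rightarrow> bool" where
  "assumption_C P X0 mu s1 s2 \<longleftrightarrow>
     (\<exists>delta>0. integrable P (\<lambda>\<omega>. norm (X0 \<omega>) powr (2 + delta)) \<and>
        filterlim
          (\<lambda>n. D_norm mu s1 s2 n /
             (\<Sum>i=s1 n + 1..s1 n + s2 n. \<bar>mu n i\<bar> powr (2 + delta)) powr (1 / (2 + delta)))
          at_top sequentially)"

end

theory Submission
  imports Defs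
begin

text \<open>Minimizing the penalized loss over \<open>\<mu>\<close> turns it into a sum of Huber losses of the residuals, which
  is convex in \<open>\<beta>\<close>. For \<open>\<beta> = \<beta>\<^sup>\<star> + v\<close> with \<open>|v| = 1\<close> the observations with a large incidental parameter
  lie in the linear part of the Huber loss and all others in its quadratic part, so with
  \<open>\<Phi>\<close> the total loss, \<open>G\<close> the Gram matrix of the observations \<open>i > s1\<close>, and
  \<open>V = (\<Sum>i>s1. (\<mu>\<^sub>i + \<epsilon>\<^sub>i) X\<^sub>i) + \<lambda> (\<Sum>i\<le>s1. sgn \<mu>\<^sub>i X\<^sub>i)\<close>,
  \<open>\<Phi> (\<beta>\<^sup>\<star> + v) - \<Phi> \<beta>\<^sup>\<star> = v \<bullet> G v - 2 V \<bullet> v\<close>. Here \<open>G\<close> grows like \<open>n \<Sigma>\<^sub>X\<close> whereas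
  \<open>V = o(n)\<close> in probability. By convexity the first step estimator stays in the unit ball around
  \<open>\<beta>\<^sup>\<star>\<close>, so that its zero set is \<open>{s1+1..n}\<close>.

  On this event \<open>(G/n) (\<beta>\<^sup>\<sim> - \<beta>\<^sup>\<star>)\<close>, with \<open>\<beta>\<^sup>\<sim>\<close> the two-step estimator, is \<open>1/n\<close> times
  the sum of \<open>(\<mu>\<^sub>i + \<epsilon>\<^sub>i) X\<^sub>i\<close> over \<open>i > s1\<close>. The contribution of the bounded \<open>\<mu>\<^sub>i\<close> is negligible by the second
  moment \<open>D\<^sub>n\<^sup>2 E|X\<^sub>0|\<^sup>2\<close> or by the crude bound \<open>s2 \<kappa>\<^sub>n \<gamma>\<^sub>n\<close>.
  The noise term is treated by characteristic functions, and these determine weak limits of tight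
  sequences because trigonometric polynomials approximate continuous functions on cubes.\<close>

section \<open>Linear images of Lebesgue measure\<close>

text \<open>Moving the coefficient vector by at most 1 moves each residual by at most
  \<open>kappa n\<close>, so \<open>2 * gamma n + kappa n < lam n\<close> keeps the rows
  \<open>i > s1 n\<close> in the quadratic regime; \<open>alpha > 2\<close> together with
  \<open>kappa\<close> = o(\<open>lam\<close>) provides this inequality. The vector \<open>V\<close>
  is controlled through second moments: \<open>gamma n\<close> and \<open>lam n\<close> are o(sqrt
  n), while \<open>s1 n\<close> and \<open>s2 n\<close> are o(n). Since the minimizer need not be
  unique, the zero set is identified by a deterministic statement about one sample and an arbitrary
  minimizer; probability enters only through exceptional events of vanishing probability. The
  samples of different size may live on different spaces, so the limit theorems are for triangular
  arrays and rest on L1 bounds, L2 bounds and characteristic functions, not on almost sure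
  convergence along the samples. The limit law is given by a Lebesgue density; its characteristic
  function is found by writing it as a linear image of a standard Gaussian, which calls for the
  change of variables formula under linear maps.\<close>

lemma lborel_eqI_cbox:
  fixes M :: "(real ^ 'n) measure"
  assumes emeasure_eq: "\<And>a b. cbox a b \<noteq> {} \<Longrightarrow> emeasure M (cbox a b) = emeasure lborel (cbox a b)"
    and sets_eq: "sets M = sets borel"
  shows "lborel = M"
proof (rule measure_eqI_generator_eq)
  let ?E = "range (\<lambda>(a, b). {a..b} :: (real ^ 'n) set)"
  show "Int_stable ?E"
    by (auto simp: Int_stable_def interval_cbox Int_interval simp del: Int_atLeastAtMost)
  show "?E \<subseteq> Pow UNIV" "sets lborel = sigma_sets UNIV ?E" "sets M = sigma_sets UNIV ?E"
    by (simp_all add: borel_eq_atLeastAtMost sets_eq)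
  let ?A = "\<lambda>k::nat. cbox (- (\<chi> i. real k)) (\<chi> i. real k) :: (real ^ 'n) set"
  show "range ?A \<subseteq> ?E"
    by (auto simp: interval_cbox)
  show "(\<Union>k. ?A k) = UNIV"
  proof (intro set_eqI iffI UNIV_I)
    fix x :: "real ^ 'n"
    obtain k :: nat where k: "norm x \<le> real k"
      using real_arch_simple by blast
    have "\<bar>x $ i\<bar> \<le> real k" for i
      using component_le_norm_cart[of x i] k by linarith
    then have "x \<in> ?A k"
      by (auto simp: mem_box_cart abs_le_iff) (smt (verit))
    then show "x \<in> (\<Union>k. ?A k)" by blast
  qed
  show "emeasure lborel (?A k) \<noteq> \<infinity>" for k
    using emeasure_lborel_cbox_finite by (metis less_irrefl)
  show "emeasure lborel X = emeasure M X" if "X \<in> ?E" for X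
  proof -
    from that obtain a b where X: "X = cbox a b" by (auto simp: interval_cbox)
    show ?thesis
      by (cases "cbox a b = {}") (simp_all add: X emeasure_eq)
  qed
qed

section \<open>Shears preserve Lebesgue measure\<close>

abbreviation shear :: "'n::finite \<Rightarrow> 'n \<Rightarrow> real ^ 'n \<Rightarrow> real ^ 'n" where
  "shear m n \<equiv> (\<lambda>x. \<chi> i. if i = m then x $ m + x $ n else x $ i)"

lemma linear_shear: "linear (shear m n)"
  by (rule linearI) (auto simp: vec_eq_iff distrib_left)

text \<open>Translating along the axis \<open>n\<close> by \<open>- (a $ n)\<close> makes the lower
  bound of that coordinate 0, the case that \<open>measurable_shear_interval\<close> and
  \<open>measure_shear_interval\<close> treat; translations do not change volume.\<close>

lemma measure_shear_cbox:
  fixes a b :: "real ^ 'n"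
  assumes mn: "m \<noteq> n" and ne: "cbox a b \<noteq> {}"
  shows "shear m n ` cbox a b \<in> lmeasurable"
    and "measure lebesgue (shear m n ` cbox a b) = measure lebesgue (cbox a b)"
proof -
  define v :: "real ^ 'n" where "v = axis n (- (a $ n))"
  have tr: "cbox (v + a) (v + b) = (+) v ` cbox a b"
    by (rule cbox_translation)
  have "- shear m n v + shear m n (v + x) = shear m n x" for x
    by (simp add: vec_eq_iff)
  then have eq: "shear m n ` cbox a b = (+) (- shear m n v) ` (shear m n ` cbox (v + a) (v + b))"
    unfolding tr image_image by simp
  have ne': "cbox (v + a) (v + b) \<noteq> {}"
    unfolding tr using ne by simp
  have n0: "0 \<le> (v + a) $ n"
    by (simp add: v_def axis_def)
  show "shear m n ` cbox a b \<in> lmeasurable"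
    unfolding eq using measurable_shear_interval[OF mn ne' n0] by (rule measurable_translation)
  have "measure lebesgue (shear m n ` cbox a b) = measure lebesgue (shear m n ` cbox (v + a) (v + b))"
    unfolding eq by (rule measure_translation)
  also have "\<dots> = measure lebesgue (cbox (v + a) (v + b))"
    by (rule measure_shear_interval[OF mn ne' n0])
  also have "\<dots> = measure lebesgue (cbox a b)"
    unfolding tr by (rule measure_translation)
  finally show "measure lebesgue (shear m n ` cbox a b) = measure lebesgue (cbox a b)" .
qed

lemma measurable_linear:
  fixes f :: "'a::euclidean_space \<Rightarrow> 'b::euclidean_space"
  assumes "linear f"
  shows "f \<in> borel_measurable borel"
  by (rule borel_measurable_continuous_onI, rule linear_continuous_on, rule linear_conv_bounded_linear[THEN iffD1], fact)

text \<open>The image under the inverse map \<open>g\<close> is computed first, because preimages of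
  boxes under \<open>g\<close> are sheared boxes, whose volume is known. Pushing that identity
  forward along the shear gives the claim.\<close>

lemma lborel_shear:
  fixes m n :: "'n::finite"
  assumes mn: "m \<noteq> n"
  shows "(lborel :: (real ^ 'n) measure) = distr lborel borel (shear m n)"
proof -
  define g :: "real ^ 'n \<Rightarrow> real ^ 'n" where "g = (\<lambda>x. \<chi> i. if i = m then x $ m - x $ n else x $ i)"
  have ling: "linear g"
    unfolding g_def by (rule linearI) (auto simp: vec_eq_iff algebra_simps)
  note [measurable] = measurable_linear[OF ling] measurable_linear[OF linear_shear[of m n]]
  have gs: "g (shear m n x) = x" "shear m n (g x) = x" for x
    using mn by (auto simp: g_def vec_eq_iff)
  have "lborel = distr lborel borel g"
  proof (rule lborel_eqI_cbox)
    fix a b :: "real ^ 'n" assume ne: "cbox a b \<noteq> {}"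
    have vim: "g -` cbox a b = shear m n ` cbox a b"
    proof (intro set_eqI iffI)
      fix x assume "x \<in> g -` cbox a b"
      then show "x \<in> shear m n ` cbox a b"
        by (intro image_eqI[of _ _ "g x"]) (simp_all only: gs vimage_eq)
    next
      fix x assume "x \<in> shear m n ` cbox a b"
      then show "x \<in> g -` cbox a b"
        by (elim imageE) (simp only: gs vimage_eq)
    qed
    have S: "g -` cbox a b \<in> sets lborel"
      using measurable_sets[OF measurable_linear[OF ling], of "cbox a b"] by simp
    have "emeasure (distr lborel borel g) (cbox a b) = emeasure lborel (g -` cbox a b)"
      by (simp add: emeasure_distr)
    also have "\<dots> = emeasure lebesgue (g -` cbox a b)"
      using S by simp
    also have "\<dots> = ennreal (measure lebesgue (cbox a b))"
      unfolding vim using measure_shear_cbox[OF mn ne] by (simp add: emeasure_eq_measure2)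
    also have "\<dots> = emeasure lborel (cbox a b)"
      using emeasure_lborel_cbox_finite[of a b] by (subst emeasure_eq_ennreal_measure) auto
    finally show "emeasure (distr lborel borel g) (cbox a b) = emeasure lborel (cbox a b)" .
  qed simp
  then have "distr lborel borel (shear m n) = distr (distr lborel borel g) borel (shear m n)"
    by (rule arg_cong[where f = "\<lambda>L. distr L borel (shear m n)"])
  also have "\<dots> = distr lborel borel (\<lambda>x. x)"
    by (simp add: distr_distr comp_def gs del: if_image_distrib cong: if_cong)
  finally show ?thesis
    by (simp add: distr_id2)
qed

lemma eq_density_const_1: "L = N \<Longrightarrow> \<bar>c::real\<bar> = 1 \<Longrightarrow> L = density N (\<lambda>_. ennreal \<bar>c\<bar>)"
  by (simp add: density_1)

lemma Basis_cart: "(Basis :: (real ^ 'n) set) = range (\<lambda>i. axis i 1)"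
  by (auto simp: Basis_vec_def)

text \<open>Every linear map is composed of elementary ones, and the density factor is
  multiplicative because the determinant is. Invertibility is a premise inside the formula, so that
  the induction may pass through singular maps.\<close>

lemma lborel_linear_image:
  fixes f :: "real ^ 'n \<Rightarrow> real ^ 'n"
  assumes "linear f"
  shows "det (matrix f) \<noteq> 0 \<longrightarrow>
    lborel = density (distr lborel borel f) (\<lambda>_. ennreal \<bar>det (matrix f)\<bar>)" (is "?P f")
proof (rule induct_linear_elementary[OF assms])
  fix f g :: "real ^ 'n \<Rightarrow> real ^ 'n"
  assume fg: "linear f" "linear g" and f: "?P f" and g: "?P g"
  have det: "det (matrix (f \<circ> g)) = det (matrix f) * det (matrix g)"
    using fg by (simp add: matrix_compose det_mul)
  note [measurable] = measurable_linear[OF fg(1)] measurable_linear[OF fg(2)]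
  show "?P (f \<circ> g)"
  proof
    assume "det (matrix (f \<circ> g)) \<noteq> 0"
    then have nz: "det (matrix f) \<noteq> 0" "det (matrix g) \<noteq> 0"
      by (auto simp: det)
    show "lborel = density (distr lborel borel (f \<circ> g)) (\<lambda>_. ennreal \<bar>det (matrix (f \<circ> g))\<bar>)" (is "_ = ?R")
    proof (rule measure_eqI)
      fix A :: "(real ^ 'n) set" assume "A \<in> sets lborel"
      then have A: "A \<in> sets borel" by simp
      have fA: "f -` A \<in> sets borel" using A measurable_sets[OF measurable_linear[OF fg(1)] A] by simp
      have gA: "g -` (f -` A) \<in> sets borel" using fA measurable_sets[OF measurable_linear[OF fg(2)] fA] by simp
      have "emeasure lborel A = ennreal \<bar>det (matrix f)\<bar> * emeasure lborel (f -` A)"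
        by (subst f[THEN mp, OF nz(1)]) (use A fA in \<open>simp add: emeasure_density nn_integral_cmult emeasure_distr\<close>)
      also have "emeasure lborel (f -` A) = ennreal \<bar>det (matrix g)\<bar> * emeasure lborel (g -` (f -` A))"
        by (subst g[THEN mp, OF nz(2)]) (use gA fA in \<open>simp add: emeasure_density nn_integral_cmult emeasure_distr\<close>)
      finally show "emeasure lborel A = emeasure ?R A"
        using A gA by (simp add: emeasure_density nn_integral_cmult emeasure_distr det[unfolded comp_def] abs_mult ennreal_mult
            mult.assoc vimage_comp comp_def)
    qed simp
  qed
next
  fix f :: "real ^ 'n \<Rightarrow> real ^ 'n" and i
  assume f: "linear f" and z: "\<And>x. f x $ i = 0"
  \<comment> \<open>A map with a vanishing coordinate has determinant 0, so the implication holds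
    vacuously.\<close>
  have "row i (matrix f) = 0"
    by (simp add: row_def matrix_def vec_eq_iff z)
  then show "?P f"
    using det_zero_row(2)[of i "matrix f"] by auto
next
  fix c :: "'n \<Rightarrow> real"
  have m: "matrix (\<lambda>x::real^'n. \<chi> i. c i * x $ i) = (\<chi> i j. if i = j then c i else 0)"
    by (auto simp: matrix_def vec_eq_iff axis_def)
  have d: "det (matrix (\<lambda>x::real^'n. \<chi> i. c i * x $ i)) = prod c UNIV"
    unfolding m by (subst det_diagonal) auto
  show "?P (\<lambda>x. \<chi> i. c i * x $ i)"
  proof
    assume "det (matrix (\<lambda>x::real^'n. \<chi> i. c i * x $ i)) \<noteq> 0"
    then have nz: "c i \<noteq> 0" for i
      by (simp add: d)
    \<comment> \<open>\<open>lborel_affine_euclidean\<close> indexes its factors by basis vectors,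
      whereas \<open>c\<close> is indexed by coordinates; the description recovers the coordinate
      from the basis vector.\<close>
    define c' where "c' b = c (THE i. b = axis i (1::real))" for b :: "real ^ 'n"
    have c'[simp]: "c' (axis i 1) = c i" for i
      unfolding c'_def by (rule arg_cong[of _ _ c]) (auto simp: axis_eq_axis)
    have inj: "inj (\<lambda>i::'n. axis i (1::real))"
      by (auto simp: inj_def axis_eq_axis)
    have T: "(\<Sum>j\<in>Basis. (c' j * (x \<bullet> j)) *\<^sub>R j) = (\<chi> i. c i * x $ i)" for x :: "real ^ 'n"
      unfolding Basis_cart by (subst sum.reindex[OF inj])
        (simp add: vec_eq_iff inner_axis sum_component, simp add: axis_def if_distrib cong: if_cong)
    have p: "(\<Prod>j\<in>(Basis::(real^'n) set). \<bar>c' j\<bar>) = \<bar>prod c UNIV\<bar>"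
      unfolding Basis_cart by (subst prod.reindex[OF inj]) (simp add: abs_prod)
    show "lborel = density (distr lborel borel (\<lambda>x. \<chi> i. c i * x $ i))
       (\<lambda>_. ennreal \<bar>det (matrix (\<lambda>x::real^'n. \<chi> i. c i * x $ i))\<bar>)"
      unfolding d
    proof (rule lborel_affine_euclidean[of c' "0 :: real ^ 'n", unfolded T p add_0_left])
      show "c' j \<noteq> 0" if "j \<in> Basis" for j
        using that unfolding Basis_cart by (auto simp: nz)
    qed
  qed
next
  fix m n :: 'n assume mn: "m \<noteq> n"
  let ?s = "Transposition.transpose m n"
  let ?f = "\<lambda>x::real^'n. \<chi> i. x $ ?s i"
  have bij: "bij ?s" by simp
  have lin: "linear ?f" by (rule linearI) (auto simp: vec_eq_iff)
  note [measurable] = measurable_linear[OF lin]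
  have m: "matrix ?f = (\<chi> i. (mat 1 :: real ^ 'n ^ 'n) $ ?s i)"
    by (auto simp: matrix_def vec_eq_iff axis_def mat_def)
  have det: "\<bar>det (matrix ?f)\<bar> = 1"
    unfolding m by (subst det_permute_rows) (auto simp: permutes_swap_id sign_def)
  have "lborel = distr lborel borel ?f"
  proof (rule lborel_eqI_cbox)
    fix a b :: "real ^ 'n" assume ne: "cbox a b \<noteq> {}"
    have v: "?f -` cbox a b = cbox (?f a) (?f b)"
    proof (intro set_eqI iffI)
      fix x assume "x \<in> ?f -` cbox a b"
      then have *: "a $ i \<le> x $ ?s i \<and> x $ ?s i \<le> b $ i" for i by (simp add: mem_box_cart)
      show "x \<in> cbox (?f a) (?f b)"
        using *[of "?s i" for i] by (simp add: mem_box_cart)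
    next
      fix x assume "x \<in> cbox (?f a) (?f b)"
      then have *: "a $ ?s i \<le> x $ i \<and> x $ i \<le> b $ ?s i" for i by (simp add: mem_box_cart)
      show "x \<in> ?f -` cbox a b"
        using *[of "?s i" for i] by (simp add: mem_box_cart)
    qed
    have ne': "cbox (?f a) (?f b) \<noteq> {}"
      using ne by (simp add: interval_ne_empty_cart)
    have "measure lborel (cbox (?f a) (?f b)) = measure lborel (cbox a b)"
      using ne ne' prod.reindex_bij_betw[OF bij, of "\<lambda>i. b $ i - a $ i"] by (simp add: content_cbox_cart)
    then show "emeasure (distr lborel borel ?f) (cbox a b) = emeasure lborel (cbox a b)"
      using emeasure_eq_ennreal_measure[OF less_imp_neq[OF emeasure_lborel_cbox_finite[of a b, unfolded infinity_ennreal_def]]]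
        emeasure_eq_ennreal_measure[OF less_imp_neq[OF emeasure_lborel_cbox_finite[of "?f a" "?f b", unfolded infinity_ennreal_def]]]
      by (simp add: emeasure_distr v)
  qed simp
  then show "?P ?f" using det by (intro impI eq_density_const_1)
next
  fix m n :: 'n assume mn: "m \<noteq> n"
  have "det (matrix (shear m n)) = 1"
  proof -
    have "matrix (shear m n) = (\<chi> k. if k = m then row m (mat 1) + 1 *s row n (mat 1) else row k (mat 1 :: real ^ 'n ^ 'n))"
      using mn by (auto simp: matrix_def vec_eq_iff axis_def mat_def row_def)
    then show ?thesis
      using det_row_operation[OF mn, of "mat 1 :: real ^ 'n ^ 'n" 1] by (simp only: det_I)
  qed
  then show "?P (shear m n)"
    by (intro impI eq_density_const_1 lborel_shear[OF mn]) simp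
qed

lemma lborel_matrix_image:
  fixes A :: "real ^ 'n ^ 'n"
  assumes "det A \<noteq> 0"
  shows "lborel = density (distr lborel borel ((*v) A)) (\<lambda>_. ennreal \<bar>det A\<bar>)"
proof -
  have "det (matrix ((*v) A)) \<noteq> 0"
    using assms by simp
  from lborel_linear_image[OF matrix_vector_mul_linear, THEN mp, OF this]
  show ?thesis
    unfolding matrix_of_matrix_vector_mul .
qed

section \<open>The characteristic function of the multivariate normal law\<close>

lemma inner_transpose:
  fixes C :: "real ^ 'n ^ 'm"
  shows "x \<bullet> (transpose C *v y) = (C *v x) \<bullet> y"
  by (metis dot_lmul_matrix inner_commute transpose_matrix_vector)

lemma posdef_symmetric:
  assumes "positive_definite S"
  shows "x \<bullet> (S *v y) = y \<bullet> (S *v x)"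
proof -
  have "x \<bullet> (S *v y) = (transpose S *v x) \<bullet> y"
    by (simp add: dot_lmul_matrix transpose_matrix_vector)
  also have "transpose S = S"
    using assms by (simp add: positive_definite_def)
  finally show ?thesis
    by (simp add: inner_commute)
qed

text \<open>Gram-Schmidt for the inner product given by \<open>S\<close>: fewer than
  \<open>CARD('n)\<close> vectors do not span the space, and a vector outside their span keeps a
  nonzero remainder once its projections are subtracted.\<close>

lemma posdef_orthonormal_family:
  fixes S :: "real ^ 'n ^ 'n"
  assumes S: "positive_definite S"
  shows "\<exists>b :: 'n \<Rightarrow> real ^ 'n. \<forall>i\<in>I. \<forall>j\<in>I. b i \<bullet> (S *v b j) = (if i = j then 1 else 0)"
proof (induction I rule: infinite_finite_induct)
  case (insert k F)
  then obtain b :: "'n \<Rightarrow> real ^ 'n"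
    where b: "\<And>i j. i \<in> F \<Longrightarrow> j \<in> F \<Longrightarrow> b i \<bullet> (S *v b j) = (if i = j then 1 else 0)"
    by blast
  have "dim (b ` F) \<le> card (b ` F)"
    by (rule dim_le_card') (simp add: insert)
  also have "\<dots> \<le> card F"
    by (rule card_image_le) (simp add: insert)
  also have "\<dots> < CARD('n)"
    using insert by (intro psubset_card_mono) auto
  finally have "dim (b ` F) < DIM(real ^ 'n)"
    by simp
  then obtain v where v: "v \<notin> span (b ` F)"
    using dim_eq_full[of "b ` F"] by auto
  define w where "w = v - (\<Sum>i\<in>F. (b i \<bullet> (S *v v)) *\<^sub>R b i)"
  have "w \<noteq> 0"
  proof
    assume "w = 0"
    then have "v = (\<Sum>i\<in>F. (b i \<bullet> (S *v v)) *\<^sub>R b i)"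
      by (simp add: w_def)
    also have "\<dots> \<in> span (b ` F)"
      by (intro span_sum span_scale span_base) auto
    finally show False
      using v by simp
  qed
  then have w_pos: "w \<bullet> (S *v w) > 0"
    using S by (simp add: positive_definite_def)
  have ortho: "b i \<bullet> (S *v w) = 0" if "i \<in> F" for i
  proof -
    have "S *v (\<Sum>j\<in>F. (b j \<bullet> (S *v v)) *\<^sub>R b j) = (\<Sum>j\<in>F. (b j \<bullet> (S *v v)) *\<^sub>R (S *v b j))"
      by (simp add: linear_sum[OF matrix_vector_mul_linear] matrix_vector_mult_scaleR o_def)
    then have "b i \<bullet> (S *v w) = b i \<bullet> (S *v v) - (\<Sum>j\<in>F. (b j \<bullet> (S *v v)) * (b i \<bullet> (S *v b j)))"
      by (simp add: w_def matrix_vector_mult_diff_distrib inner_diff_right inner_sum_right)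
    also have "(\<Sum>j\<in>F. (b j \<bullet> (S *v v)) * (b i \<bullet> (S *v b j)))
        = (\<Sum>j\<in>F. if i = j then b j \<bullet> (S *v v) else 0)"
      by (intro sum.cong) (auto simp: b that)
    also have "\<dots> = b i \<bullet> (S *v v)"
      using insert that by simp
    finally show ?thesis by simp
  qed
  define r where "r = sqrt (w \<bullet> (S *v w))"
  have r: "r > 0" "r * r = w \<bullet> (S *v w)"
    using w_pos by (simp_all add: r_def)
  define b' where "b' = b(k := (1 / r) *\<^sub>R w)"
  have "b' i \<bullet> (S *v b' j) = (if i = j then 1 else 0)" if "i \<in> insert k F" "j \<in> insert k F" for i j
  proof (cases "i = k"; cases "j = k")
    assume "i = k" "j = k"
    then show ?thesis
      using r w_pos by (simp add: b'_def matrix_vector_mult_scaleR)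
  next
    assume "i = k" "j \<noteq> k"
    then show ?thesis
      using that ortho[of j] posdef_symmetric[OF S, of w "b j"] by (simp add: b'_def)
  next
    assume "i \<noteq> k" "j = k"
    then show ?thesis
      using that ortho[of i] by (simp add: b'_def matrix_vector_mult_scaleR)
  next
    assume "i \<noteq> k" "j \<noteq> k"
    then show ?thesis
      using that b[of i j] by (simp add: b'_def)
  qed
  then show ?case by blast
qed auto

text \<open>Takes the place of a Cholesky factor. If the rows of \<open>C\<close> are orthonormal
  for the form of \<open>S\<close>, then \<open>A = S ** transpose C\<close> inverts
  \<open>C\<close>, and in \<open>A ** transpose A = S ** (transpose C ** transpose A)\<close> the
  bracket is the identity.\<close>

lemma posdef_factorization:
  fixes S :: "real ^ 'n ^ 'n"
  assumes S: "positive_definite S"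
  obtains A C :: "real ^ 'n ^ 'n" where "A ** C = mat 1" "C ** A = mat 1" "S = A ** transpose A"
proof -
  obtain b :: "'n \<Rightarrow> real ^ 'n" where b: "\<And>i j. b i \<bullet> (S *v b j) = (if i = j then 1 else 0)"
    using posdef_orthonormal_family[OF S, of UNIV] by auto
  define C :: "real ^ 'n ^ 'n" where "C = (\<chi> i. b i)"
  have CSC: "C ** (S ** transpose C) = mat 1"
  proof -
    have "(C ** (S ** transpose C)) $ i $ j = b i \<bullet> (S *v b j)" for i j
      by (simp add: C_def matrix_matrix_mult_def matrix_vector_mult_def inner_vec_def transpose_def)
    then show ?thesis
      by (simp add: vec_eq_iff b mat_def)
  qed
  define A where "A = S ** transpose C"
  have CA: "C ** A = mat 1"
    using CSC by (simp add: A_def)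
  then have AC: "A ** C = mat 1"
    by (simp add: matrix_left_right_inverse)
  have "transpose C ** transpose A = mat 1"
    using AC by (metis matrix_transpose_mul transpose_mat)
  then have "A ** transpose A = S"
    by (simp add: A_def flip: matrix_mul_assoc)
  then show ?thesis
    by (intro that[OF AC CA]) simp
qed

text \<open>\<open>matrix_inv\<close> chooses among the two-sided inverses, so the choice is
  meaningful as soon as one exists; for square matrices a right inverse is one.\<close>

lemma matrix_inv_right_left:
  fixes A :: "real ^ 'n ^ 'n"
  assumes "A ** B = mat 1"
  shows "A ** matrix_inv A = mat 1" "matrix_inv A ** A = mat 1"
proof -
  have "A ** matrix_inv A = mat 1 \<and> matrix_inv A ** A = mat 1"
    unfolding matrix_inv_def by (rule someI[of _ B]) (use assms matrix_left_right_inverse in blast)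
  then show "A ** matrix_inv A = mat 1" "matrix_inv A ** A = mat 1" by simp_all
qed

lemma matrix_inv_unique:
  fixes A :: "real ^ 'n ^ 'n"
  assumes "A ** B = mat 1" "B ** A = mat 1"
  shows "matrix_inv A = B"
proof -
  have "matrix_inv A = B ** A ** matrix_inv A"
    by (simp add: assms)
  also have "\<dots> = B ** (A ** matrix_inv A)"
    by (rule matrix_mul_assoc[symmetric])
  finally show ?thesis
    by (simp add: matrix_inv_right_left[OF assms(1)])
qed

section \<open>The standard Gaussian and its linear images\<close>

definition std_gaussian :: "(real ^ 'n) measure" where
  "std_gaussian = density lborel (\<lambda>x. ennreal (\<Prod>i\<in>UNIV. std_normal_density (x $ i)))"

lemma prod_Basis_cart: "(\<Prod>b\<in>(Basis :: (real ^ 'n) set). f b) = (\<Prod>i\<in>UNIV. f (axis i 1))"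
  unfolding Basis_cart by (subst prod.reindex) (auto simp: inj_def axis_eq_axis)

lemma prob_space_std_gaussian: "prob_space (std_gaussian :: (real ^ 'n) measure)"
proof
  have "emeasure (std_gaussian :: (real ^ 'n) measure) UNIV =
      (\<integral>\<^sup>+x. (\<Prod>b\<in>Basis. ennreal (std_normal_density (x \<bullet> b))) \<partial>(lborel :: (real ^ 'n) measure))"
    by (simp add: std_gaussian_def emeasure_density prod_Basis_cart inner_axis prod_ennreal)
  also have "\<dots> = (\<Prod>b\<in>(Basis :: (real ^ 'n) set). (\<integral>\<^sup>+x. ennreal (std_normal_density x) \<partial>lborel))"
    by (rule nn_integral_lborel_prod) auto
  also have "(\<integral>\<^sup>+x. ennreal (std_normal_density x) \<partial>lborel) = 1"
    by (subst nn_integral_eq_integral) (auto simp: integrable_normal_density)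
  finally show "emeasure (std_gaussian :: (real ^ 'n) measure) (space std_gaussian) = 1"
    by (simp add: std_gaussian_def)
qed

text \<open>\<open>lborel\<close> is an image of the product of copies of the real line indexed by
  \<open>Basis\<close>, so an integrand that is a product over coordinates factorizes.\<close>

lemma lborel_integral_prod:
  fixes f :: "'a::euclidean_space \<Rightarrow> real \<Rightarrow> complex"
  assumes f: "\<And>b. b \<in> Basis \<Longrightarrow> integrable lborel (f b)"
  shows "(\<integral>x. (\<Prod>b\<in>Basis. f b (x \<bullet> b)) \<partial>lborel) = (\<Prod>b\<in>Basis. \<integral>x. f b x \<partial>lborel)"
proof -
  interpret product_sigma_finite "\<lambda>_::'a. lborel :: real measure" ..
  have [measurable]: "f b \<in> borel_measurable borel" if "b \<in> Basis" for b
    using borel_measurable_integrable[OF f[OF that]] by simp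
  have "(\<integral>x. (\<Prod>b\<in>Basis. f b (x \<bullet> b)) \<partial>(lborel :: 'a measure)) =
      (\<integral>x. (\<Prod>b\<in>Basis. f b ((\<Sum>b\<in>Basis. x b *\<^sub>R b) \<bullet> b)) \<partial>(\<Pi>\<^sub>M b\<in>(Basis::'a set). lborel))"
    by (subst lborel_eq) (simp add: integral_distr)
  also have "\<dots> = (\<integral>x. (\<Prod>b\<in>Basis. f b (x b)) \<partial>(\<Pi>\<^sub>M b\<in>(Basis::'a set). lborel))"
    by (intro Bochner_Integration.integral_cong prod.cong refl) simp
  also have "\<dots> = (\<Prod>b\<in>Basis. \<integral>x. f b x \<partial>lborel)"
    by (rule product_integral_prod) (auto simp: f)
  finally show ?thesis .
qed

text \<open>Both the density and the exponential are products over coordinates, which leaves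
  one-dimensional characteristic functions; their exponents add up to the squared norm.\<close>

lemma char_std_gaussian:
  fixes t :: "real ^ 'n"
  shows "(\<integral>x. iexp (t \<bullet> x) \<partial>std_gaussian) = exp (- (norm t)\<^sup>2 / 2)"
proof -
  define f where "f b x = std_normal_density x *\<^sub>R iexp ((t \<bullet> b) * x)" for b :: "real ^ 'n" and x
  have int: "integrable lborel (f b)" for b
  proof -
    have "integrable lborel std_normal_density"
      by (simp add: integrable_normal_density)
    then show ?thesis
      unfolding f_def by (rule Bochner_Integration.integrable_bound) (auto simp: normal_density_nonneg)
  qed
  have "(\<integral>x. iexp (t \<bullet> x) \<partial>std_gaussian) =
      (\<integral>x. (\<Prod>i\<in>UNIV. std_normal_density (x $ i)) *\<^sub>R iexp (t \<bullet> x) \<partial>lborel)"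
    unfolding std_gaussian_def
    by (rule integral_density) (auto simp: prod_nonneg normal_density_nonneg)
  also have "\<dots> = (\<integral>x. (\<Prod>b\<in>Basis. f b (x \<bullet> b)) \<partial>(lborel :: (real ^ 'n) measure))"
  proof (intro Bochner_Integration.integral_cong refl)
    fix x :: "real ^ 'n"
    have "iexp (t \<bullet> x) = (\<Prod>i\<in>UNIV. iexp (t $ i * x $ i))"
      by (simp add: inner_vec_def sum_distrib_left flip: exp_sum)
    then show "(\<Prod>i\<in>UNIV. std_normal_density (x $ i)) *\<^sub>R iexp (t \<bullet> x) = (\<Prod>b\<in>Basis. f b (x \<bullet> b))"
      by (simp add: prod_Basis_cart f_def inner_axis scaleR_conv_of_real prod.distrib)
  qed
  also have "\<dots> = (\<Prod>b\<in>(Basis :: (real ^ 'n) set). \<integral>x. f b x \<partial>lborel)"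
    by (rule lborel_integral_prod) (rule int)
  also have "\<dots> = (\<Prod>b\<in>(Basis :: (real ^ 'n) set). complex_of_real (exp (- ((t \<bullet> b)\<^sup>2) / 2)))"
  proof (rule prod.cong[OF refl])
    fix b :: "real ^ 'n"
    have "(\<integral>x. f b x \<partial>lborel) = char std_normal_distribution (t \<bullet> b)"
      unfolding char_def f_def by (subst integral_density) (auto simp: normal_density_nonneg)
    then show "(\<integral>x. f b x \<partial>lborel) = complex_of_real (exp (- ((t \<bullet> b)\<^sup>2) / 2))"
      by (simp add: char_std_normal_distribution)
  qed
  also have "\<dots> = complex_of_real (exp (\<Sum>b\<in>(Basis :: (real ^ 'n) set). - ((t \<bullet> b)\<^sup>2) / 2))"
    by (simp add: exp_sum)
  also have "(\<Sum>b\<in>(Basis :: (real ^ 'n) set). - ((t \<bullet> b)\<^sup>2) / 2) = - (norm t)\<^sup>2 / 2"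
    unfolding power2_norm_eq_inner
    by (subst euclidean_inner[of t t]) (simp add: power2_eq_square sum_negf sum_divide_distrib)
  finally show ?thesis .
qed

text \<open>Substitution of \<open>A *v y\<close> in the density. The inverse of \<open>S\<close> is
  \<open>transpose C ** C\<close>, so the quadratic form becomes the squared norm of
  \<open>y\<close>, and the Jacobian \<open>\<bar>det A\<bar>\<close> cancels the root of
  \<open>det S\<close>, which is the square of \<open>det A\<close>.\<close>

lemma multivariate_normal_eq_distr:
  fixes S A C :: "real ^ 'n ^ 'n"
  assumes inv: "A ** C = mat 1" "C ** A = mat 1" and S: "S = A ** transpose A"
  shows "multivariate_normal 0 S = distr std_gaussian borel ((*v) A)"
proof -
  have "det A * det C = 1"
    using inv(1) by (metis det_mul det_I)
  then have det: "det A \<noteq> 0" by auto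
  have [measurable]: "(*v) A \<in> borel_measurable borel"
    by (rule measurable_linear) simp
  have tr: "transpose C ** transpose A = mat 1" "transpose A ** transpose C = mat 1"
    using inv by (metis matrix_transpose_mul transpose_mat)+
  have "matrix_inv S = transpose C ** C"
  proof (rule matrix_inv_unique)
    have "S ** (transpose C ** C) = A ** (transpose A ** transpose C) ** C"
      by (simp add: S matrix_mul_assoc)
    then show "S ** (transpose C ** C) = mat 1"
      by (simp add: tr inv)
    have "(transpose C ** C) ** S = transpose C ** (C ** A) ** transpose A"
      by (simp add: S matrix_mul_assoc)
    then show "(transpose C ** C) ** S = mat 1"
      by (simp add: tr inv)
  qed
  then have quad: "(A *v x) \<bullet> (matrix_inv S *v (A *v x)) = (norm x)\<^sup>2" for x
  proof -
    have "(A *v x) \<bullet> ((transpose C ** C) *v (A *v x)) = (C *v (A *v x)) \<bullet> (C *v (A *v x))"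
      by (simp add: inner_transpose del: transpose_matrix_vector flip: matrix_vector_mul_assoc)
    also have "C *v (A *v x) = x"
      by (simp add: matrix_vector_mul_assoc inv)
    finally show ?thesis
      using \<open>matrix_inv S = _\<close> by (simp add: power2_norm_eq_inner)
  qed
  define h where "h x = exp (- (x \<bullet> (matrix_inv S *v x)) / 2) / sqrt ((2 * pi) ^ CARD('n) * det S)" for x
  have detS: "det S \<noteq> 0"
    using det by (simp add: S det_mul)
  have [measurable]: "h \<in> borel_measurable borel"
    unfolding h_def using detS
    by (intro borel_measurable_continuous_onI continuous_intros linear_continuous_on
        linear_conv_bounded_linear[THEN iffD1] matrix_vector_mul_linear) auto
  have h: "\<bar>det A\<bar> * h (A *v x) = (\<Prod>i\<in>UNIV. std_normal_density (x $ i))" for x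
  proof -
    have "sqrt ((2 * pi) ^ CARD('n) * det S) = sqrt (2 * pi) ^ CARD('n) * \<bar>det A\<bar>"
      by (simp add: S det_mul real_sqrt_mult real_sqrt_power power_mult_distrib)
    then have "\<bar>det A\<bar> * h (A *v x) = exp (- (norm x)\<^sup>2 / 2) / sqrt (2 * pi) ^ CARD('n)"
      using det detS by (simp add: h_def quad)
    also have "\<dots> = (\<Prod>i\<in>UNIV. std_normal_density (x $ i))"
      by (simp add: std_normal_density_def prod_dividef norm_vec_def L2_set_def sum_nonneg exp_sum
          sum_negf sum_divide_distrib flip: exp_sum)
    finally show ?thesis .
  qed
  have "multivariate_normal 0 S = density lborel (\<lambda>x. ennreal (h x))"
    by (simp add: multivariate_normal_def h_def)
  \<comment> \<open>Lebesgue measure is replaced by a multiple of its image under \<open>A\<close>,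
    after which the density can be pulled back through \<open>distr\<close>.\<close>
  also have "\<dots> = density (density (distr lborel borel ((*v) A)) (\<lambda>_. ennreal \<bar>det A\<bar>)) (\<lambda>x. ennreal (h x))"
    by (rule arg_cong[where f = "\<lambda>L. density L (\<lambda>x. ennreal (h x))"]) (rule lborel_matrix_image[OF det])
  also have "\<dots> = density (distr lborel borel ((*v) A)) (\<lambda>x. ennreal (\<bar>det A\<bar> * h x))"
    by (subst density_density_eq) (auto simp: ennreal_mult')
  also have "\<dots> = distr (density lborel (\<lambda>x. ennreal (\<bar>det A\<bar> * h (A *v x)))) borel ((*v) A)"
    by (subst density_distr) auto
  finally show ?thesis
    by (simp add: h std_gaussian_def)
qed

text \<open>For \<open>S = A ** transpose A\<close>, the characteristic function at \<open>t\<close>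
  is that of the standard Gaussian at \<open>transpose A *v t\<close>, a vector whose squared norm
  is the quadratic form of \<open>S\<close> at \<open>t\<close>.\<close>

lemma
  fixes S :: "real ^ 'n ^ 'n"
  assumes S: "positive_definite S"
  shows prob_space_multivariate_normal: "prob_space (multivariate_normal 0 S)"
    and char_multivariate_normal:
      "(\<integral>x. iexp (t \<bullet> x) \<partial>multivariate_normal 0 S) = exp (- (t \<bullet> (S *v t)) / 2)"
proof -
  obtain A C :: "real ^ 'n ^ 'n" where A: "A ** C = mat 1" "C ** A = mat 1" "S = A ** transpose A"
    using posdef_factorization[OF S] .
  interpret prob_space "std_gaussian :: (real ^ 'n) measure"
    by (rule prob_space_std_gaussian)
  have A_meas: "(*v) A \<in> borel_measurable borel"
    by (rule measurable_linear) simp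
  have m: "(*v) A \<in> std_gaussian \<rightarrow>\<^sub>M borel"
    using A_meas by (simp add: std_gaussian_def cong: measurable_cong_sets)
  show "prob_space (multivariate_normal 0 S)"
    unfolding multivariate_normal_eq_distr[OF A] using m by (rule prob_space_distr)
  have "(\<integral>x. iexp (t \<bullet> x) \<partial>multivariate_normal 0 S) = (\<integral>x. iexp (t \<bullet> (A *v x)) \<partial>std_gaussian)"
    unfolding multivariate_normal_eq_distr[OF A] by (rule integral_distr) (use m in auto)
  also have "\<dots> = (\<integral>x. iexp ((transpose A *v t) \<bullet> x) \<partial>std_gaussian)"
    by (simp add: dot_lmul_matrix)
  also have "\<dots> = exp (- (norm (transpose A *v t))\<^sup>2 / 2)"
    by (rule char_std_gaussian)
  also have "(norm (transpose A *v t))\<^sup>2 = t \<bullet> (S *v t)"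
    by (simp add: power2_norm_eq_inner A(3) inner_commute[of t] inner_transpose del: transpose_matrix_vector flip: matrix_vector_mul_assoc)
  finally show "(\<integral>x. iexp (t \<bullet> x) \<partial>multivariate_normal 0 S) = exp (- (t \<bullet> (S *v t)) / 2)" .
qed

section \<open>Weak convergence from characteristic functions\<close>

text \<open>The phase \<open>s\<close> covers sines and, by the product formula for cosines, makes
  the class closed under multiplication. With constants as the case \<open>t = 0\<close>, it is a
  real algebra, as Stone-Weierstrass demands.\<close>

inductive trig_poly :: "('a::real_inner \<Rightarrow> real) \<Rightarrow> bool" where
  cos: "trig_poly (\<lambda>x. c * cos (t \<bullet> x + s))"
| add: "trig_poly p \<Longrightarrow> trig_poly q \<Longrightarrow> trig_poly (\<lambda>x. p x + q x)"

lemma trig_poly_const: "trig_poly (\<lambda>_. c)"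
  using trig_poly.cos[of c 0 0] by simp

lemma trig_poly_sin: "trig_poly (\<lambda>x. sin (t \<bullet> x))"
proof -
  have "(\<lambda>x. 1 * cos (t \<bullet> x + - (pi / 2))) = (\<lambda>x. sin (t \<bullet> x))"
    by (simp add: fun_eq_iff cos_diff)
  then show ?thesis
    using trig_poly.cos[of 1 t "- (pi / 2)"] by simp
qed

lemma trig_poly_mult:
  assumes "trig_poly p" "trig_poly q"
  shows "trig_poly (\<lambda>x. p x * q x)"
  using assms(1)
proof induction
  case (cos c t s)
  show ?case
    using assms(2)
  proof induction
    case (cos c' t' s')
    have "(\<lambda>x. (c * cos (t \<bullet> x + s)) * (c' * cos (t' \<bullet> x + s'))) =
        (\<lambda>x. (c * c' / 2) * cos ((t - t') \<bullet> x + (s - s')) + (c * c' / 2) * cos ((t + t') \<bullet> x + (s + s')))"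
    proof
      fix x
      have *: "cos ((t - t') \<bullet> x + (s - s')) + cos ((t + t') \<bullet> x + (s + s'))
          = 2 * (cos (t \<bullet> x + s) * cos (t' \<bullet> x + s'))"
        using cos_times_cos[of "t \<bullet> x + s" "t' \<bullet> x + s'"] by (simp add: inner_simps algebra_simps)
      show "(c * cos (t \<bullet> x + s)) * (c' * cos (t' \<bullet> x + s')) =
        (c * c' / 2) * cos ((t - t') \<bullet> x + (s - s')) + (c * c' / 2) * cos ((t + t') \<bullet> x + (s + s'))"
        unfolding distrib_left[symmetric] * by simp
    qed
    then show ?case
      by (simp only: trig_poly.intros)
  next
    case (add p q)
    then show ?case
      by (simp add: distrib_left trig_poly.add)
  qed
next
  case (add p q)
  then show ?case
    by (simp add: distrib_right trig_poly.add)
qed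

lemma trig_poly_continuous: "trig_poly p \<Longrightarrow> continuous_on UNIV p"
  by (induction rule: trig_poly.induct) (intro continuous_intros | assumption)+

lemma trig_poly_bounded: "trig_poly p \<Longrightarrow> \<exists>B. \<forall>x. \<bar>p x\<bar> \<le> B"
proof (induction rule: trig_poly.induct)
  case (cos c t s)
  then show ?case
    by (intro exI[of _ "\<bar>c\<bar>"]) (simp add: abs_mult mult_left_le)
next
  case (add p q)
  then obtain B C where "\<And>x. \<bar>p x\<bar> \<le> B" "\<And>x. \<bar>q x\<bar> \<le> C" by blast
  then have "\<bar>p x + q x\<bar> \<le> B + C" for x
    using abs_triangle_ineq[of "p x" "q x"] by (meson add_mono order_trans)
  then show ?case by blast
qed

text \<open>A cosine with phase \<open>s\<close> is the real part of the exponential rotated by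
  \<open>iexp s\<close>, so convergence of characteristic functions carries over to cosines and, by
  additivity, to finite sums.\<close>

lemma trig_poly_integral_tendsto:
  fixes Z :: "nat \<Rightarrow> 'a \<Rightarrow> 'b::euclidean_space"
  assumes M: "\<And>n. prob_space (M n)" and Z[measurable]: "\<And>n. Z n \<in> borel_measurable (M n)"
    and N: "prob_space N" and sets_N [measurable_cong]: "sets N = sets borel"
    and char: "\<And>t. (\<lambda>n. \<integral>z. iexp (t \<bullet> Z n z) \<partial>M n) \<longlonglongrightarrow> (\<integral>x. iexp (t \<bullet> x) \<partial>N)"
    and p: "trig_poly p"
  shows "(\<lambda>n. \<integral>z. p (Z n z) \<partial>M n) \<longlonglongrightarrow> (\<integral>x. p x \<partial>N)"
  using p
proof induction
  case (cos c t s)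
  \<comment> \<open>Stated for an arbitrary probability space and random vector, since it is applied
    both to \<open>Z n\<close> on \<open>M n\<close> and to the identity on
    \<open>N\<close>.\<close>
  have eq: "(\<integral>z. c * cos (t \<bullet> V z + s) \<partial>Q) = c * Re (iexp s * (\<integral>z. iexp (t \<bullet> V z) \<partial>Q))"
    if "prob_space Q" "V \<in> borel_measurable Q" for Q :: "'c measure" and V :: "'c \<Rightarrow> 'b"
  proof -
    interpret prob_space Q by fact
    have int: "integrable Q (\<lambda>z. iexp (t \<bullet> V z))"
      by (rule integrable_iexp) (use that(2) in auto)
    have "(\<integral>z. c * cos (t \<bullet> V z + s) \<partial>Q) = c * (\<integral>z. Re (iexp s * iexp (t \<bullet> V z)) \<partial>Q)"
      by (simp add: Re_exp exp_add[symmetric] ring_distribs[symmetric] add.commute del: of_real_add flip: of_real_add)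
    also have "(\<integral>z. Re (iexp s * iexp (t \<bullet> V z)) \<partial>Q) = Re (\<integral>z. iexp s * iexp (t \<bullet> V z) \<partial>Q)"
      using int by (intro integral_Re) simp
    finally show ?thesis by simp
  qed
  have N_id: "(\<lambda>x. x) \<in> borel_measurable N" by measurable
  show ?case
    unfolding eq[OF M Z] eq[OF N N_id]
    by (intro tendsto_intros char)
next
  case (add p q)
  have int: "integrable Q (\<lambda>z. p (V z))"
    if "trig_poly p" "prob_space Q" "V \<in> borel_measurable Q" for Q :: "'c measure" and V :: "'c \<Rightarrow> 'b" and p :: "'b \<Rightarrow> real"
  proof -
    interpret prob_space Q by fact
    note bounded = trig_poly_bounded[OF that(1)]
    then obtain B where "\<And>x. \<bar>p x\<bar> \<le> B" by blast
    moreover have "(\<lambda>z. p (V z)) \<in> borel_measurable Q"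
      using borel_measurable_continuous_onI[OF trig_poly_continuous[OF that(1)]] that(3) by measurable
    ultimately show ?thesis
      by (intro integrable_const_bound[of _ B]) auto
  qed
  have N_id: "(\<lambda>x. x) \<in> borel_measurable N" by measurable
  have "(\<integral>z. p (Z n z) + q (Z n z) \<partial>M n) = (\<integral>z. p (Z n z) \<partial>M n) + (\<integral>z. q (Z n z) \<partial>M n)" for n
    by (intro Bochner_Integration.integral_add int add.hyps M Z)
  moreover have "(\<integral>x. p x + q x \<partial>N) = (\<integral>x. p x \<partial>N) + (\<integral>x. q x \<partial>N)"
    by (intro Bochner_Integration.integral_add int add.hyps N N_id)
  ultimately show ?case
    using tendsto_add[OF add.IH] by simp
qed

text \<open>The map \<open>w\<close> applies the sine of \<open>pi / (2 * R)\<close> times each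
  coordinate; on the ball of radius \<open>R\<close> it is inverted by arcsine. Approximating the
  transported function \<open>h\<close> on the cube \<open>Q\<close> and pulling back along
  \<open>w\<close> gives a trigonometric polynomial. As \<open>w\<close> maps the whole space into
  \<open>Q\<close>, where \<open>h\<close> is bounded by \<open>B\<close>, the bound
  \<open>B + e\<close> holds everywhere and not only on the ball.\<close>

lemma trig_poly_approximation:
  fixes f :: "real ^ 'n \<Rightarrow> real"
  assumes f: "continuous_on UNIV f" and B: "\<And>x. \<bar>f x\<bar> \<le> B" and R: "R > 0" and e: "e > 0"
  obtains p where "trig_poly p" "\<And>x. norm x \<le> R \<Longrightarrow> \<bar>f x - p x\<bar> < e" "\<And>x. \<bar>p x\<bar> \<le> B + e"
proof -
  define Q :: "(real ^ 'n) set" where "Q = cbox (\<chi> i. -1) (\<chi> i. 1)"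
  define w :: "real ^ 'n \<Rightarrow> real ^ 'n" where "w x = (\<chi> i. sin (axis i (pi / (2 * R)) \<bullet> x))" for x
  define h where "h y = f (\<chi> i. 2 * R / pi * arcsin (y $ i))" for y
  have w_mem: "w x \<in> Q" for x
    by (simp add: Q_def w_def mem_box_cart)
  have "continuous_on Q h"
    unfolding h_def
    by (rule continuous_on_compose2[OF f]) (auto intro!: continuous_intros simp: Q_def mem_box_cart)
  moreover have "compact Q"
    by (simp add: Q_def)
  \<comment> \<open>The algebra consists of the continuous functions on the cube whose pullback
    along \<open>w\<close> is a trigonometric polynomial; it contains the coordinates, which
    separate points.\<close>
  ultimately obtain g where g: "continuous_on Q g \<and> trig_poly (\<lambda>x. g (w x))" "\<forall>y\<in>Q. \<bar>h y - g y\<bar> < e"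
  proof (atomize_elim, intro Stone_Weierstrass_HOL[where P = "\<lambda>g. continuous_on Q g \<and> trig_poly (\<lambda>x. g (w x))"])
    show "\<exists>g. (continuous_on Q g \<and> trig_poly (\<lambda>x. g (w x))) \<and> g x \<noteq> g y" if "x \<in> Q \<and> y \<in> Q \<and> x \<noteq> y" for x y
    proof -
      from that obtain i where "x $ i \<noteq> y $ i" by (auto simp: vec_eq_iff)
      moreover have "continuous_on Q (\<lambda>y. y $ i) \<and> trig_poly (\<lambda>x. w x $ i)"
        by (auto simp: w_def intro!: continuous_intros trig_poly_sin)
      ultimately show ?thesis by blast
    qed
  qed (auto intro!: continuous_intros trig_poly_const trig_poly.add trig_poly_mult e)
  have inv: "h (w x) = f x" if "norm x \<le> R" for x
  proof -
    have "2 * R / pi * arcsin (w x $ i) = x $ i" for i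
    proof -
      have "\<bar>x $ i\<bar> \<le> R"
        using component_le_norm_cart[of x i] that by linarith
      then have "\<bar>x $ i / R\<bar> \<le> 1"
        using R by (simp add: field_simps)
      then have "\<bar>pi / 2 * (x $ i / R)\<bar> \<le> pi / 2"
        unfolding abs_mult by (metis abs_of_pos mult_left_le pi_half_gt_zero less_imp_le)
      then have "arcsin (sin (pi / 2 * (x $ i / R))) = pi / 2 * (x $ i / R)"
        by (intro arcsin_sin) linarith+
      then show ?thesis
        using R by (simp add: w_def inner_axis' field_simps)
    qed
    then show ?thesis
      by (simp add: h_def)
  qed
  have gw: "\<bar>h (w x) - g (w x)\<bar> < e" for x
    using g(2) w_mem by blast
  show thesis
  proof (rule that[of "\<lambda>x. g (w x)"])
    show "trig_poly (\<lambda>x. g (w x))" using g(1) by simp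
    show "\<bar>f x - g (w x)\<bar> < e" if "norm x \<le> R" for x
      using gw[of x] inv[OF that] by simp
    show "\<bar>g (w x)\<bar> \<le> B + e" for x
    proof -
      have "\<bar>h (w x)\<bar> \<le> B" unfolding h_def by (rule B)
      then show ?thesis using gw[of x] by linarith
    qed
  qed
qed

text \<open>The integrands differ by at most \<open>e\<close> where \<open>V\<close> has norm at
  most \<open>K\<close>, and by at most \<open>B + C\<close> on the tail event.\<close>

lemma (in prob_space) expectation_diff_le:
  fixes V :: "'a \<Rightarrow> 'b::{real_normed_vector, second_countable_topology}" and f g :: "'b \<Rightarrow> real"
  assumes V[measurable]: "V \<in> borel_measurable M"
    and fg[measurable]: "f \<in> borel_measurable borel" "g \<in> borel_measurable borel"
    and f: "\<And>x. \<bar>f x\<bar> \<le> B" and g: "\<And>x. \<bar>g x\<bar> \<le> C"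
    and close: "\<And>x. norm x \<le> K \<Longrightarrow> \<bar>f x - g x\<bar> \<le> e"
    and tail: "prob {z \<in> space M. norm (V z) > K} \<le> d" and e: "e \<ge> 0"
  shows "\<bar>expectation (\<lambda>z. f (V z)) - expectation (\<lambda>z. g (V z))\<bar> \<le> e + (B + C) * d"
proof -
  let ?A = "{z \<in> space M. norm (V z) > K}"
  have int: "integrable M (\<lambda>z. f (V z))" "integrable M (\<lambda>z. g (V z))"
    using f g by (auto intro: integrable_const_bound[where B = B] integrable_const_bound[where B = C])
  have intA: "integrable M (indicat_real ?A)"
    by (intro integrable_real_indicator) (auto simp: emeasure_eq_measure)
  have BC: "0 \<le> B + C"
    using f[of 0] g[of 0] by linarith
  have "\<bar>expectation (\<lambda>z. f (V z)) - expectation (\<lambda>z. g (V z))\<bar> = \<bar>expectation (\<lambda>z. f (V z) - g (V z))\<bar>"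
    using int by simp
  also have "\<dots> \<le> expectation (\<lambda>z. \<bar>f (V z) - g (V z)\<bar>)"
    by (rule integral_abs_bound)
  also have "\<dots> \<le> expectation (\<lambda>z. e + (B + C) * indicator ?A z)"
  proof (rule integral_mono)
    fix z assume "z \<in> space M"
    then show "\<bar>f (V z) - g (V z)\<bar> \<le> e + (B + C) * indicator ?A z"
      using close[of "V z"] f[of "V z"] g[of "V z"] e by (auto simp: indicator_def)
  qed (use int intA in auto)
  also have "\<dots> = e + (B + C) * prob ?A"
    by (subst Bochner_Integration.integral_add) (use intA in \<open>auto simp: prob_space\<close>)
  also have "\<dots> \<le> e + (B + C) * d"
    using tail BC by (simp add: mult_left_mono)
  finally show ?thesis .
qed

lemma (in prob_space) tail_prob_small:
  fixes V :: "'a \<Rightarrow> 'b::{real_normed_vector, second_countable_topology}"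
  assumes V[measurable]: "V \<in> borel_measurable M" and e: "e > 0"
  shows "\<exists>K::nat. \<forall>K'\<ge>real K. prob {z \<in> space M. norm (V z) > K'} \<le> e"
proof -
  let ?A = "\<lambda>k::nat. {z \<in> space M. norm (V z) > real k}"
  have "(\<lambda>k. prob (?A k)) \<longlonglongrightarrow> prob (\<Inter>k. ?A k)"
    by (rule finite_Lim_measure_decseq) (auto simp: decseq_def)
  also have "(\<Inter>k. ?A k) = {}"
    by (auto simp: not_less) (metis not_le real_arch_simple)
  finally have "(\<lambda>k. prob (?A k)) \<longlonglongrightarrow> 0" by simp
  then have "\<forall>\<^sub>F k in sequentially. prob (?A k) < e"
    using e by (rule order_tendstoD)
  then obtain K where K: "prob (?A K) < e"
    using eventually_happens'[OF sequentially_bot] by blast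
  have "prob {z \<in> space M. norm (V z) > K'} \<le> prob (?A K)" if "K' \<ge> real K" for K'
    using that by (intro finite_measure_mono) auto
  then show ?thesis
    using K by (intro exI[of _ K]) force
qed

text \<open>A single radius \<open>R\<close> serves the tails of the sequence and of the limit.
  Beyond it the approximating polynomial is no longer close to \<open>f\<close>, but its global
  bound makes the tail contribution proportional to the tail probability.\<close>

lemma converges_in_distribution_of_char:
  fixes Z :: "nat \<Rightarrow> 'a \<Rightarrow> real ^ 'n"
  assumes M: "\<And>n. prob_space (M n)" and Z[measurable]: "\<And>n. Z n \<in> borel_measurable (M n)"
    and N: "prob_space N" and sets_N [measurable_cong]: "sets N = sets borel"
    and char: "\<And>t. (\<lambda>n. \<integral>z. iexp (t \<bullet> Z n z) \<partial>M n) \<longlonglongrightarrow> (\<integral>x. iexp (t \<bullet> x) \<partial>N)"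
    and tight: "\<And>e. e > 0 \<Longrightarrow> \<exists>K. \<forall>\<^sub>F n in sequentially. measure (M n) {z \<in> space (M n). norm (Z n z) > K} \<le> e"
  shows "converges_in_distribution M Z N"
  unfolding converges_in_distribution_def
proof (intro conjI allI impI Z)
  fix f :: "real ^ 'n \<Rightarrow> real"
  assume f: "continuous_on UNIV f" and "bounded (range f)"
  then obtain B where B: "\<And>x. \<bar>f x\<bar> \<le> B" by (auto simp: bounded_iff)
  then have B0: "0 \<le> B" by (metis abs_ge_zero order_trans)
  have N_id: "(\<lambda>x. x) \<in> borel_measurable N" by measurable
  show "(\<lambda>n. \<integral>z. f (Z n z) \<partial>M n) \<longlonglongrightarrow> (\<integral>x. f x \<partial>N)"
  proof (rule tendstoI)
    fix e :: real assume e: "e > 0"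
    \<comment> \<open>With \<open>d \<le> 1\<close> the factor \<open>B + (B + d)\<close> is below
      \<open>2 * B + 2\<close>, so that \<open>d\<close> and the tail term are at most
      \<open>e / 6\<close> each. Two replacements of \<open>f\<close> by the polynomial then cost
      \<open>e / 3\<close> each, and the last third goes to the integrals of the polynomial.\<close>
    define d where "d = min 1 (e / (6 * (2 * B + 2)))"
    have d: "d > 0" "d \<le> 1" "(2 * B + 2) * d \<le> e / 6"
    proof -
      show "d > 0" "d \<le> 1" using e B0 by (simp_all add: d_def)
      have "(2 * B + 2) * d \<le> (2 * B + 2) * (e / (6 * (2 * B + 2)))"
        using B0 by (intro mult_left_mono) (simp_all add: d_def)
      also have "\<dots> = e / 6" using B0 by (simp add: field_simps)
      finally show "(2 * B + 2) * d \<le> e / 6" .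
    qed
    obtain K1 where K1: "\<forall>\<^sub>F n in sequentially. measure (M n) {z \<in> space (M n). norm (Z n z) > K1} \<le> d"
      using tight[OF d(1)] by blast
    obtain K2 :: nat where K2: "\<And>K'. K' \<ge> real K2 \<Longrightarrow> measure N {z \<in> space N. norm z > K'} \<le> d"
      using prob_space.tail_prob_small[OF N N_id d(1)] by blast
    define R where "R = max (max K1 (real K2)) 1"
    have R: "R > 0" "K1 \<le> R" "real K2 \<le> R" by (auto simp: R_def)
    obtain p where p: "trig_poly p" "\<And>x. norm x \<le> R \<Longrightarrow> \<bar>f x - p x\<bar> < d" "\<And>x. \<bar>p x\<bar> \<le> B + d"
      using trig_poly_approximation[OF f B R(1) d(1)] by blast
    have [measurable]: "f \<in> borel_measurable borel" "p \<in> borel_measurable borel"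
      using f trig_poly_continuous[OF p(1)] by (auto intro: borel_measurable_continuous_onI)
    have bound: "d + (B + (B + d)) * d \<le> e / 6 + e / 6"
    proof -
      have "d \<le> (2 * B + 2) * d" using B0 d by (simp add: algebra_simps)
      moreover have "(B + (B + d)) * d \<le> (2 * B + 2) * d"
        using d B0 by (intro mult_right_mono) auto
      ultimately show ?thesis using d(3) by linarith
    qed
    have N_close: "\<bar>(\<integral>x. f x \<partial>N) - (\<integral>x. p x \<partial>N)\<bar> \<le> d + (B + (B + d)) * d"
      by (rule prob_space.expectation_diff_le[OF N N_id _ _ B p(3), where K = R])
        (use p(2) K2[OF R(3)] d in \<open>auto intro: less_imp_le\<close>)
    have "\<forall>\<^sub>F n in sequentially. dist (\<integral>z. p (Z n z) \<partial>M n) (\<integral>x. p x \<partial>N) < e / 3"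
      using tendstoD[OF trig_poly_integral_tendsto[OF M Z N sets_N char p(1)], of "e / 3"] e by simp
    with K1 show "\<forall>\<^sub>F n in sequentially. dist (\<integral>z. f (Z n z) \<partial>M n) (\<integral>x. f x \<partial>N) < e"
    proof eventually_elim
      case (elim n)
      interpret prob_space "M n" by (rule M)
      have "prob {z \<in> space (M n). norm (Z n z) > R} \<le> prob {z \<in> space (M n). norm (Z n z) > K1}"
        using R by (intro finite_measure_mono) auto
      then have "\<bar>(\<integral>z. f (Z n z) \<partial>M n) - (\<integral>z. p (Z n z) \<partial>M n)\<bar> \<le> d + (B + (B + d)) * d"
        using elim p(2) d
        by (intro expectation_diff_le[OF Z _ _ B p(3), where K = R]) (auto intro: less_imp_le)
      then show ?case
        using elim(2) N_close bound e unfolding dist_real_def by linarith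
    qed
  qed
qed

section \<open>The Huber loss and the penalized minimizer\<close>

text \<open>Twice the usual Huber function with threshold \<open>l\<close>, the factor matching an
  unhalved square and the penalty \<open>2 * l * \<bar>m\<bar>\<close>.\<close>

definition huber :: "real \<Rightarrow> real \<Rightarrow> real" where
  "huber l r = (if \<bar>r\<bar> \<le> l then r\<^sup>2 else 2 * l * \<bar>r\<bar> - l\<^sup>2)"

text \<open>For \<open>\<bar>r\<bar> \<le> l\<close> the penalty dominates the cross term
  \<open>2 * r * m\<close>. Otherwise the bound is the nonnegativity of the square of
  \<open>\<bar>r - m\<bar> - l\<close>, combined with the triangle inequality.\<close>

lemma huber_le:
  assumes "0 \<le> l"
  shows "huber l r \<le> (r - m)\<^sup>2 + 2 * l * \<bar>m\<bar>"
proof (cases "\<bar>r\<bar> \<le> l")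
  case True
  have "r * m \<le> \<bar>r\<bar> * \<bar>m\<bar>"
    by (metis abs_ge_self abs_mult)
  also have "\<dots> \<le> l * \<bar>m\<bar>"
    using True by (intro mult_right_mono) auto
  finally have "2 * (r * m) \<le> 2 * (l * \<bar>m\<bar>) + m\<^sup>2"
    using zero_le_power2[of m] by linarith
  then show ?thesis
    using True by (simp add: huber_def power2_diff)
next
  case False
  have "0 \<le> (\<bar>r - m\<bar> - l)\<^sup>2" by simp
  then have "2 * (l * \<bar>r - m\<bar>) - l\<^sup>2 \<le> (r - m)\<^sup>2"
    using power2_diff[of "\<bar>r - m\<bar>" l] by (simp add: mult.commute)
  moreover have "l * \<bar>r\<bar> \<le> l * \<bar>r - m\<bar> + l * \<bar>m\<bar>"
    unfolding distrib_left[symmetric] using assms by (intro mult_left_mono) auto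
  ultimately show ?thesis
    using False by (simp add: huber_def)
qed

text \<open>The witness is the soft threshold of \<open>r\<close>: 0, \<open>r - l\<close> or
  \<open>r + l\<close>.\<close>

lemma huber_attained:
  assumes "0 \<le> l"
  obtains m where "huber l r = (r - m)\<^sup>2 + 2 * l * \<bar>m\<bar>"
proof (cases "\<bar>r\<bar> \<le> l")
  case True
  then show ?thesis
    by (intro that[of 0]) (simp add: huber_def)
next
  case False
  show ?thesis
  proof (cases "r \<ge> 0")
    case True
    with False show ?thesis
      by (intro that[of "r - l"]) (simp add: huber_def algebra_simps power2_eq_square)
  next
    case False': False
    with False show ?thesis
      by (intro that[of "r + l"]) (simp add: huber_def algebra_simps power2_eq_square)
  qed
qed

lemma square_convex:
  fixes t u w :: real
  assumes "0 \<le> t" "t \<le> 1"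
  shows "((1 - t) * u + t * w)\<^sup>2 \<le> (1 - t) * u\<^sup>2 + t * w\<^sup>2"
proof -
  have "(1 - t) * u\<^sup>2 + t * w\<^sup>2 - ((1 - t) * u + t * w)\<^sup>2 = (1 - t) * t * (u - w)\<^sup>2"
    by (simp add: power2_eq_square algebra_simps)
  moreover have "\<dots> \<ge> 0"
    using assms by simp
  ultimately show ?thesis by linarith
qed

text \<open>A partial minimum of a jointly convex function is convex: the minimizers for
  \<open>p\<close> and \<open>q\<close>, averaged with the same weights, compete at the averaged
  argument.\<close>

lemma huber_convex:
  assumes l: "0 \<le> l" and t: "0 \<le> t" "t \<le> 1"
  shows "huber l ((1 - t) * p + t * q) \<le> (1 - t) * huber l p + t * huber l q"
proof -
  obtain a where a: "huber l p = (p - a)\<^sup>2 + 2 * l * \<bar>a\<bar>" using huber_attained[OF l] .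
  obtain b where b: "huber l q = (q - b)\<^sup>2 + 2 * l * \<bar>b\<bar>" using huber_attained[OF l] .
  let ?m = "(1 - t) * a + t * b"
  have "((1 - t) * p + t * q - ?m)\<^sup>2 = ((1 - t) * (p - a) + t * (q - b))\<^sup>2"
    by (simp add: algebra_simps)
  also have "\<dots> \<le> (1 - t) * (p - a)\<^sup>2 + t * (q - b)\<^sup>2"
    using t by (rule square_convex)
  finally have sq: "((1 - t) * p + t * q - ?m)\<^sup>2 \<le> (1 - t) * (p - a)\<^sup>2 + t * (q - b)\<^sup>2" .
  have "\<bar>?m\<bar> \<le> (1 - t) * \<bar>a\<bar> + t * \<bar>b\<bar>"
    using t abs_triangle_ineq[of "(1 - t) * a" "t * b"] by (simp add: abs_mult)
  then have "2 * l * \<bar>?m\<bar> \<le> 2 * l * ((1 - t) * \<bar>a\<bar> + t * \<bar>b\<bar>)"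
    using l by (intro mult_left_mono) auto
  with sq huber_le[OF l, of "(1 - t) * p + t * q" ?m] show ?thesis
    by (simp add: a b algebra_simps)
qed

text \<open>In the quadratic regime a nonzero \<open>m\<close> exceeds the minimal value by at least
  \<open>m\<^sup>2\<close>.\<close>

lemma huber_minimizer_zero:
  assumes "\<bar>r\<bar> < l" and m: "(r - m)\<^sup>2 + 2 * l * \<bar>m\<bar> = huber l r"
  shows "m = 0"
proof (rule ccontr)
  assume "m \<noteq> 0"
  have "r * m \<le> \<bar>r\<bar> * \<bar>m\<bar>"
    by (metis abs_ge_self abs_mult)
  also have "\<dots> \<le> l * \<bar>m\<bar>"
    using assms by (intro mult_right_mono) auto
  finally have "2 * (r * m) < 2 * (l * \<bar>m\<bar>) + m\<^sup>2"
    using zero_less_power2[of m] \<open>m \<noteq> 0\<close> by linarith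
  then show False
    using assms by (simp add: huber_def power2_diff)
qed

text \<open>In the linear regime the choice \<open>m = 0\<close> exceeds the minimal value by the
  square of \<open>\<bar>r\<bar> - l\<close>.\<close>

lemma huber_minimizer_nonzero:
  assumes "l < \<bar>r\<bar>" and m: "(r - m)\<^sup>2 + 2 * l * \<bar>m\<bar> = huber l r"
  shows "m \<noteq> 0"
proof
  assume "m = 0"
  have "0 < (\<bar>r\<bar> - l)\<^sup>2"
    using assms by simp
  then show False
    using assms \<open>m = 0\<close> by (simp add: huber_def power2_diff)
qed

section \<open>Profiling the penalized loss and locating its minimizers\<close>

lemma penalized_loss_ge_huber:
  assumes "0 \<le> l"
  shows "(\<Sum>i=1..n. huber l (y i - x i \<bullet> b)) \<le> penalized_loss n l x y m b"
proof -
  have "penalized_loss n l x y m b = (\<Sum>i=1..n. (y i - x i \<bullet> b - m i)\<^sup>2 + 2 * l * \<bar>m i\<bar>)"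
    by (simp add: penalized_loss_def sum.distrib sum_distrib_left algebra_simps)
  then show ?thesis
    using assms by (simp add: sum_mono huber_le)
qed

text \<open>Any \<open>b'\<close> can be completed by coordinatewise optimal values
  \<open>m'\<close>, so \<open>b\<close> minimizes the profiled sum. Taking \<open>b'\<close> equal
  to \<open>b\<close>, the nonnegative excesses of the coordinates of \<open>m\<close> have a sum
  that is at most 0, hence each of them vanishes.\<close>

lemma penalized_minimizer_profile:
  assumes l: "0 \<le> l" and min: "is_penalized_minimizer n l x y m b"
  shows "(\<Sum>i=1..n. huber l (y i - x i \<bullet> b)) \<le> (\<Sum>i=1..n. huber l (y i - x i \<bullet> b'))"
    and "i \<in> {1..n} \<Longrightarrow> (y i - x i \<bullet> b - m i)\<^sup>2 + 2 * l * \<bar>m i\<bar> = huber l (y i - x i \<bullet> b)"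
proof -
  have le: "penalized_loss n l x y m b \<le> (\<Sum>i=1..n. huber l (y i - x i \<bullet> b'))" for b'
  proof -
    have "\<exists>m'. huber l (y i - x i \<bullet> b') = (y i - x i \<bullet> b' - m')\<^sup>2 + 2 * l * \<bar>m'\<bar>" for i
      using huber_attained[OF l, of "y i - x i \<bullet> b'"] by metis
    then obtain m' where m': "\<And>i. huber l (y i - x i \<bullet> b') = (y i - x i \<bullet> b' - m' i)\<^sup>2 + 2 * l * \<bar>m' i\<bar>"
      by metis
    have "penalized_loss n l x y m b \<le> penalized_loss n l x y m' b'"
      using min unfolding is_penalized_minimizer_def is_arg_min_linorder by auto
    also have "\<dots> = (\<Sum>i=1..n. huber l (y i - x i \<bullet> b'))"
      by (simp add: m' penalized_loss_def sum.distrib sum_distrib_left algebra_simps)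
    finally show ?thesis .
  qed
  show "(\<Sum>i=1..n. huber l (y i - x i \<bullet> b)) \<le> (\<Sum>i=1..n. huber l (y i - x i \<bullet> b'))"
    using penalized_loss_ge_huber[OF l] le by (rule order_trans)
  have "(\<Sum>i=1..n. (y i - x i \<bullet> b - m i)\<^sup>2 + 2 * l * \<bar>m i\<bar> - huber l (y i - x i \<bullet> b)) \<le> 0"
    using le[of b] by (simp add: penalized_loss_def sum.distrib sum_subtractf sum_distrib_left algebra_simps)
  moreover have nonneg: "\<And>i. 0 \<le> (y i - x i \<bullet> b - m i)\<^sup>2 + 2 * l * \<bar>m i\<bar> - huber l (y i - x i \<bullet> b)"
    using huber_le[OF l] by simp
  ultimately have "(\<Sum>i=1..n. (y i - x i \<bullet> b - m i)\<^sup>2 + 2 * l * \<bar>m i\<bar> - huber l (y i - x i \<bullet> b)) = 0"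
    by (intro antisym sum_nonneg) auto
  then show "(y i - x i \<bullet> b - m i)\<^sup>2 + 2 * l * \<bar>m i\<bar> = huber l (y i - x i \<bullet> b)" if "i \<in> {1..n}"
    using nonneg that by (subst (asm) sum_nonneg_eq_0_iff) auto
qed

text \<open>The deterministic core, for one sample and any minimizer. The margins are worst cases
  within the unit ball: the noise contributes at most \<open>g\<close> and the shift of the
  coefficients at most \<open>k\<close>. Thus \<open>l + g + k\<close> keeps a residual beyond
  \<open>l\<close> with the sign of \<open>mu i\<close>, and \<open>2 * g + k\<close> bounds the
  residuals of the other rows.\<close>

lemma penalized_minimizer_zero_set:
  fixes x :: "nat \<Rightarrow> real ^ 'd"
  assumes min: "is_penalized_minimizer n l x y m b" and l: "0 < l"
    and y: "\<And>i. i \<in> {1..n} \<Longrightarrow> y i = mu i + x i \<bullet> beta + e i"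
    and x_le: "\<And>i. i \<in> {1..n} \<Longrightarrow> norm (x i) \<le> k"
    and e_le: "\<And>i. i \<in> {1..n} \<Longrightarrow> \<bar>e i\<bar> \<le> g"
    and s: "s \<le> n"
    and large: "\<And>i. i \<in> {1..s} \<Longrightarrow> l + g + k < \<bar>mu i\<bar>"
    and small: "\<And>i. i \<in> {s+1..n} \<Longrightarrow> \<bar>mu i\<bar> \<le> g"
    and gk: "2 * g + k < l"
    and curvature: "\<And>v. norm v = 1 \<Longrightarrow> 2 * norm ((\<Sum>i=s+1..n. (mu i + e i) *\<^sub>R x i) + l *\<^sub>R (\<Sum>i=1..s. sgn (mu i) *\<^sub>R x i))
        < (\<Sum>i=s+1..n. (x i \<bullet> v)\<^sup>2)"
  shows "zero_set n m = {s+1..n}"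
proof -
  note profile = penalized_minimizer_profile[OF less_imp_le[OF l] min]
  define V where "V = (\<Sum>i=s+1..n. (mu i + e i) *\<^sub>R x i) + l *\<^sub>R (\<Sum>i=1..s. sgn (mu i) *\<^sub>R x i)"
  let ?L = "\<lambda>b. \<Sum>i=1..n. huber l (y i - x i \<bullet> b)"
  have split: "{1..n} = {1..s} \<union> {s+1..n}" "{1..s} \<inter> {s+1..n} = {}"
    using s by auto
  have in_n: "i \<in> {1..n}" if "i \<in> {1..s} \<or> i \<in> {s+1..n}" for i
    using that s by auto
  have xv: "\<bar>x i \<bullet> v\<bar> \<le> k" if "i \<in> {1..n}" "norm v \<le> 1" for i v
  proof -
    have "\<bar>x i \<bullet> v\<bar> \<le> norm (x i) * norm v" by (rule Cauchy_Schwarz_ineq2)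
    also have "\<dots> \<le> norm (x i)" using that by (simp add: mult_left_le)
    also have "\<dots> \<le> k" using x_le that by simp
    finally show ?thesis .
  qed
  have res: "y i - x i \<bullet> (beta + v) = mu i + e i - x i \<bullet> v" if "i \<in> {1..n}" for i v
    using y[OF that] by (simp add: inner_add_right)
  have res_small: "\<bar>mu i + e i - x i \<bullet> v\<bar> < l" if "i \<in> {s+1..n}" "norm v \<le> 1" for i v
    using small[OF that(1)] e_le[of i] xv[of i v] that gk by auto
  have res_large: "l < \<bar>mu i + e i - x i \<bullet> v\<bar>" "sgn (mu i + e i - x i \<bullet> v) = sgn (mu i)"
    if "i \<in> {1..s}" "norm v \<le> 1" for i v
    using large[OF that(1)] e_le[of i] xv[of i v] that s l by (auto simp: sgn_if)
  have grow: "?L beta < ?L (beta + v)" if v: "norm v = 1" for v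
  proof -
    \<comment> \<open>In the linear regime the sign of the residual is that of \<open>mu i\<close>
      throughout the unit ball, so the increment is exactly linear in \<open>v\<close>.\<close>
    have d1: "huber l (y i - x i \<bullet> (beta + v)) - huber l (y i - x i \<bullet> beta) = - 2 * l * ((sgn (mu i) *\<^sub>R x i) \<bullet> v)"
      if i: "i \<in> {1..s}" for i
    proof -
      have i': "i \<in> {1..n}" using i s by auto
      have h: "huber l (mu i + e i - x i \<bullet> w) = 2 * l * (sgn (mu i) * (mu i + e i - x i \<bullet> w)) - l\<^sup>2"
        if w: "norm w \<le> 1" for w
        using res_large(1)[OF i w] res_large(2)[OF i w, symmetric] by (simp add: huber_def abs_sgn mult.commute)
      show ?thesis
        using h[of v] h[of 0] v res[OF i', of v] res[OF i', of 0] by (simp add: algebra_simps)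
    qed
    have d2: "huber l (y i - x i \<bullet> (beta + v)) - huber l (y i - x i \<bullet> beta)
        = (x i \<bullet> v)\<^sup>2 - 2 * (((mu i + e i) *\<^sub>R x i) \<bullet> v)" if i: "i \<in> {s+1..n}" for i
    proof -
      have i': "i \<in> {1..n}" using i s by auto
      have h: "huber l (mu i + e i - x i \<bullet> w) = (mu i + e i - x i \<bullet> w)\<^sup>2" if w: "norm w \<le> 1" for w
        using res_small[OF i w] by (simp add: huber_def)
      show ?thesis
        using h[of v] h[of 0] v res[OF i', of v] res[OF i', of 0]
        by (simp add: algebra_simps power2_eq_square)
    qed
    have "?L (beta + v) - ?L beta = (\<Sum>i=1..n. huber l (y i - x i \<bullet> (beta + v)) - huber l (y i - x i \<bullet> beta))"
      by (simp add: sum_subtractf)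
    also have "\<dots> = (\<Sum>i=1..s. - 2 * l * ((sgn (mu i) *\<^sub>R x i) \<bullet> v))
        + (\<Sum>i=s+1..n. (x i \<bullet> v)\<^sup>2 - 2 * (((mu i + e i) *\<^sub>R x i) \<bullet> v))"
      unfolding split(1) by (subst sum.union_disjoint) (use split(2) d1 d2 in \<open>auto intro!: arg_cong2[where f = "(+)"] sum.cong\<close>)
    also have "\<dots> = (\<Sum>i=s+1..n. (x i \<bullet> v)\<^sup>2) - 2 * (V \<bullet> v)"
      unfolding V_def inner_add_left inner_scaleR_left inner_sum_left
      by (simp add: sum_subtractf sum_negf sum_distrib_left inner_sum_left algebra_simps)
    finally have eq: "?L (beta + v) - ?L beta = (\<Sum>i=s+1..n. (x i \<bullet> v)\<^sup>2) - 2 * (V \<bullet> v)" .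
    have "V \<bullet> v \<le> norm V"
      using norm_cauchy_schwarz[of V v] v by simp
    then show ?thesis
      using curvature[OF v] eq unfolding V_def by linarith
  qed
  have close: "norm (b - beta) \<le> 1"
  proof (rule ccontr)
    assume far: "\<not> norm (b - beta) \<le> 1"
    \<comment> \<open>The point at distance 1 from \<open>beta\<close> on the segment towards
      \<open>b\<close>: by convexity its loss is at most that of \<open>beta\<close>, against the
      strict growth on the sphere.\<close>
    define t where "t = 1 / norm (b - beta)"
    have t: "0 \<le> t" "t \<le> 1" using far by (auto simp: t_def divide_le_eq_1)
    let ?v = "t *\<^sub>R (b - beta)"
    have v: "norm ?v = 1" using far by (auto simp: t_def)
    have "?L (beta + ?v) \<le> (\<Sum>i=1..n. (1 - t) * huber l (y i - x i \<bullet> beta) + t * huber l (y i - x i \<bullet> b))"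
    proof (rule sum_mono)
      fix i
      have "y i - x i \<bullet> (beta + ?v) = (1 - t) * (y i - x i \<bullet> beta) + t * (y i - x i \<bullet> b)"
        by (simp add: inner_simps algebra_simps)
      then show "huber l (y i - x i \<bullet> (beta + ?v)) \<le> (1 - t) * huber l (y i - x i \<bullet> beta) + t * huber l (y i - x i \<bullet> b)"
        using huber_convex[OF less_imp_le[OF l] t] by simp
    qed
    also have "\<dots> = (1 - t) * ?L beta + t * ?L b"
      by (simp add: sum.distrib sum_distrib_left)
    also have "\<dots> \<le> (1 - t) * ?L beta + t * ?L beta"
      using profile(1)[of beta] t by (intro add_left_mono mult_left_mono) auto
    also have "\<dots> = ?L beta"
      by (simp add: algebra_simps)
    finally show False
      using grow[OF v] by simp
  qed
  have res_b: "y i - x i \<bullet> b = mu i + e i - x i \<bullet> (b - beta)" if "i \<in> {1..n}" for i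
    using res[OF that, of "b - beta"] by simp
  have zero: "m i = 0" if i: "i \<in> {s+1..n}" for i
  proof -
    have i': "i \<in> {1..n}" using i by auto
    show ?thesis
      using res_small[OF i close] by (intro huber_minimizer_zero[OF _ profile(2)[OF i']]) (simp add: res_b[OF i'])
  qed
  have nonzero: "m i \<noteq> 0" if i: "i \<in> {1..s}" for i
  proof -
    have i': "i \<in> {1..n}" using i s by auto
    show ?thesis
      using res_large(1)[OF i close] by (intro huber_minimizer_nonzero[OF _ profile(2)[OF i']]) (simp add: res_b[OF i'])
  qed
  show ?thesis
    unfolding zero_set_def using split zero nonzero by blast
qed

section \<open>Algebra and measurability of least squares\<close>

lemma gram_matrix_mult:
  "gram_matrix x I *v v = (\<Sum>i\<in>I. (x i \<bullet> v) *\<^sub>R x i)"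
proof -
  have "(\<Sum>b\<in>UNIV. (\<Sum>i\<in>I. x i $ a * x i $ b) * v $ b) = (\<Sum>i\<in>I. (x i \<bullet> v) * x i $ a)" for a
  proof -
    have "(\<Sum>b\<in>UNIV. (\<Sum>i\<in>I. x i $ a * x i $ b) * v $ b) = (\<Sum>b\<in>UNIV. \<Sum>i\<in>I. x i $ a * x i $ b * v $ b)"
      by (simp add: sum_distrib_right)
    also have "\<dots> = (\<Sum>i\<in>I. \<Sum>b\<in>UNIV. x i $ a * x i $ b * v $ b)"
      by (rule sum.swap)
    also have "\<dots> = (\<Sum>i\<in>I. (x i \<bullet> v) * x i $ a)"
      by (simp add: inner_vec_def sum_distrib_right sum_distrib_left algebra_simps)
    finally show ?thesis .
  qed
  then show ?thesis
    by (simp add: gram_matrix_def matrix_vector_mult_def vec_eq_iff sum_component)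
qed

lemma inner_gram_matrix: "v \<bullet> (gram_matrix x I *v v) = (\<Sum>i\<in>I. (x i \<bullet> v)\<^sup>2)"
  by (simp add: gram_matrix_mult inner_sum_right power2_eq_square inner_commute)

text \<open>The normal equations with the true coefficient vector subtracted. Positive definiteness
  makes \<open>matrix_inv\<close> a genuine inverse; leaving the Gram matrix on the left postpones
  any bound for its inverse.\<close>

lemma gram_matrix_least_squares:
  fixes x :: "nat \<Rightarrow> real ^ 'd"
  assumes pd: "\<And>v. v \<noteq> 0 \<Longrightarrow> 0 < v \<bullet> (gram_matrix x I *v v)"
    and y: "\<And>i. i \<in> I \<Longrightarrow> y i = x i \<bullet> beta + z i"
  shows "gram_matrix x I *v (least_squares x y I - beta) = (\<Sum>i\<in>I. z i *\<^sub>R x i)"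
proof -
  let ?G = "gram_matrix x I"
  have "inj ((*v) ?G)"
  proof (rule injI)
    fix u w assume "?G *v u = ?G *v w"
    then have "?G *v (u - w) = 0" by (simp add: matrix_vector_mult_diff_distrib)
    then show "u = w" using pd[of "u - w"] by fastforce
  qed
  then obtain B where "B ** ?G = mat 1"
    using matrix_left_invertible_injective by blast
  then have inv: "?G ** matrix_inv ?G = mat 1"
    by (intro matrix_inv_right_left) (simp add: matrix_left_right_inverse)
  have "?G *v least_squares x y I = (\<Sum>i\<in>I. y i *\<^sub>R x i)"
    by (simp add: least_squares_def matrix_vector_mul_assoc inv)
  also have "\<dots> = (\<Sum>i\<in>I. (x i \<bullet> beta) *\<^sub>R x i) + (\<Sum>i\<in>I. z i *\<^sub>R x i)"
    by (simp add: y scaleR_add_left sum.distrib)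
  finally show ?thesis
    by (simp add: matrix_vector_mult_diff_distrib gram_matrix_mult)
qed

text \<open>On the open set of invertible matrices Cramer's rule gives a continuous formula, and on
  the singular ones \<open>matrix_inv\<close> is constant.\<close>

lemma borel_measurable_matrix_inv [measurable]:
  "(matrix_inv :: real ^ 'n ^ 'n \<Rightarrow> real ^ 'n ^ 'n) \<in> borel_measurable borel"
proof -
  \<comment> \<open>The default value of a choice from an unsatisfiable predicate. A singular matrix
    makes the predicate of \<open>matrix_inv\<close> equal to this one, so all singular matrices
    share the value.\<close>
  define E :: "real ^ 'n ^ 'n" where "E = (SOME A'. False)"
  define D :: "real ^ 'n ^ 'n \<Rightarrow> real ^ 'n ^ 'n" where
    "D A = (\<chi> k l. det (\<chi> i j. if j = k then axis l 1 $ i else A $ i $ j) / det A)" for A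
  have singular: "matrix_inv A = E" if "det A = 0" for A :: "real ^ 'n ^ 'n"
  proof -
    have "\<not> (A ** A' = mat 1 \<and> A' ** A = mat 1)" for A'
      using that invertible_det_nz[of A] unfolding invertible_def by blast
    then show ?thesis
      unfolding matrix_inv_def E_def by (intro arg_cong[where f = Eps]) auto
  qed
  have regular: "matrix_inv A = D A" if "det A \<noteq> 0" for A :: "real ^ 'n ^ 'n"
  proof -
    have "A ** matrix_inv A = mat 1"
      using that invertible_det_nz[of A] unfolding invertible_def by (blast intro: matrix_inv_right_left)
    then have "A *v (matrix_inv A *v axis l 1) = axis l 1" for l
      by (simp add: matrix_vector_mul_assoc)
    then have "matrix_inv A *v axis l 1 = (\<chi> k. det (\<chi> i j. if j = k then axis l 1 $ i else A $ i $ j) / det A)" for l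
      using cramer[OF that] by blast
    then have "(matrix_inv A *v axis l 1) $ k = D A $ k $ l" for k l
      by (simp add: D_def)
    then show ?thesis
      by (simp add: vec_eq_iff matrix_vector_mult_basis column_def)
  qed
  have det_cont: "continuous_on UNIV (\<lambda>A :: real ^ 'n ^ 'n. det (h A))"
    if "\<And>i j. continuous_on UNIV (\<lambda>A. h A $ i $ j)" for h :: "real ^ 'n ^ 'n \<Rightarrow> real ^ 'n ^ 'n"
    unfolding det_def by (intro continuous_intros that)
  have ent: "continuous_on UNIV (\<lambda>A :: real ^ 'n ^ 'n. A $ i $ j)" for i j
    by (intro continuous_intros)
  have contD: "continuous_on {A. det A \<noteq> 0} D"
    unfolding D_def
  proof (intro continuous_on_vec_lambda continuous_on_divide)
    fix k l
    have "continuous_on UNIV (\<lambda>A :: real ^ 'n ^ 'n. det (\<chi> i j. if j = k then axis l 1 $ i else A $ i $ j))"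
    proof (rule det_cont)
      fix i j
      show "continuous_on UNIV (\<lambda>A :: real ^ 'n ^ 'n. (\<chi> i j. if j = k then axis l 1 $ i else A $ i $ j) $ i $ j)"
        by (cases "j = k") (auto intro!: continuous_intros)
    qed
    then show "continuous_on {A. det A \<noteq> 0} (\<lambda>A :: real ^ 'n ^ 'n. det (\<chi> i j. if j = k then axis l 1 $ i else A $ i $ j))"
      by (rule continuous_on_subset) simp
    show "continuous_on {A :: real ^ 'n ^ 'n. det A \<noteq> 0} det"
      using det_cont[of "\<lambda>A. A", OF ent] by (rule continuous_on_subset) simp
  qed simp
  have op: "open {A :: real ^ 'n ^ 'n. det A \<noteq> 0}"
    using open_Collect_neq[OF det_cont[of "\<lambda>A. A", OF ent] continuous_on_const] .
  then have [measurable]: "{A :: real ^ 'n ^ 'n. det A \<noteq> 0} \<in> sets borel" by simp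
  have "matrix_inv = (\<lambda>A. if A \<in> {A. det A \<noteq> 0} then D A else E)"
    using singular regular by auto
  also have "\<dots> \<in> borel_measurable borel"
    by (rule borel_measurable_continuous_on_if) (use contD in auto)
  finally show ?thesis .
qed

section \<open>Convergence in probability for triangular arrays\<close>

locale prob_array =
  fixes M :: "nat \<Rightarrow> 'a measure"
  assumes prob_M: "\<And>n. prob_space (M n)"
begin

sublocale prob_space "M n" for n by (rule prob_M)

abbreviation vanishes :: "(nat \<Rightarrow> 'a \<Rightarrow> 'b::real_normed_vector) \<Rightarrow> bool" where
  "vanishes Z \<equiv> converges_in_probability M Z 0"

abbreviation tail_prob :: "(nat \<Rightarrow> 'a \<Rightarrow> 'b::real_normed_vector) \<Rightarrow> nat \<Rightarrow> real \<Rightarrow> real" where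
  "tail_prob Z n e \<equiv> prob n {w \<in> space (M n). norm (Z n w) > e}"

lemma vanishes_iff:
  fixes Z :: "nat \<Rightarrow> 'a \<Rightarrow> 'b::real_normed_vector"
  shows "vanishes Z \<longleftrightarrow> (\<forall>n. Z n \<in> borel_measurable (M n)) \<and>
    (\<forall>e>0. (\<lambda>n. tail_prob Z n e) \<longlonglongrightarrow> 0)"
  by (simp add: converges_in_probability_def)

text \<open>The form in which the good event is used: a bound that holds for large \<open>n\<close>
  only, and only off sets of vanishing probability.\<close>

lemma vanishes_dominated:
  fixes Z :: "nat \<Rightarrow> 'a \<Rightarrow> 'b::{real_normed_vector, second_countable_topology}"
    and Y :: "nat \<Rightarrow> 'a \<Rightarrow> 'c::{real_normed_vector, second_countable_topology}"
  assumes Z[measurable]: "\<And>n. Z n \<in> borel_measurable (M n)"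
    and Y: "vanishes Y"
    and B[measurable]: "\<And>n. B n \<in> sets (M n)" and B0: "(\<lambda>n. prob n (B n)) \<longlonglongrightarrow> 0"
    and le: "\<forall>\<^sub>F n in sequentially. \<forall>w\<in>space (M n) - B n. norm (Z n w) \<le> norm (Y n w)"
  shows "vanishes Z"
  unfolding vanishes_iff
proof (intro conjI allI impI Z)
  fix e :: real assume "e > 0"
  have [measurable]: "Y n \<in> borel_measurable (M n)" for n
    using Y by (simp add: vanishes_iff)
  have "(\<lambda>n. tail_prob Y n e + prob n (B n)) \<longlonglongrightarrow> 0 + 0"
    using Y \<open>e > 0\<close> by (intro tendsto_add B0) (simp add: vanishes_iff)
  then have lim: "(\<lambda>n. tail_prob Y n e + prob n (B n)) \<longlonglongrightarrow> 0"
    by simp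
  show "(\<lambda>n. tail_prob Z n e) \<longlonglongrightarrow> 0"
  proof (rule tendsto_sandwich[OF _ _ tendsto_const lim])
    show "\<forall>\<^sub>F n in sequentially. tail_prob Z n e
        \<le> tail_prob Y n e + prob n (B n)"
      using le
    proof eventually_elim
      case (elim n)
      have "tail_prob Z n e \<le> prob n ({w \<in> space (M n). norm (Y n w) > e} \<union> B n)"
        using elim by (intro finite_measure_mono) (auto intro: less_le_trans)
      also have "\<dots> \<le> tail_prob Y n e + prob n (B n)"
        by (intro measure_Un_le) auto
      finally show ?case .
    qed
  qed simp
qed

lemma vanishes_add:
  fixes Z Y :: "nat \<Rightarrow> 'a \<Rightarrow> 'b::{real_normed_vector, second_countable_topology}"
  assumes Z: "vanishes Z" and Y: "vanishes Y"
  shows "vanishes (\<lambda>n w. Z n w + Y n w)"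
  unfolding vanishes_iff
proof (intro conjI allI impI)
  have [measurable]: "Z n \<in> borel_measurable (M n)" "Y n \<in> borel_measurable (M n)" for n
    using Z Y by (simp_all add: vanishes_iff)
  show "(\<lambda>w. Z n w + Y n w) \<in> borel_measurable (M n)" for n by measurable
  fix e :: real assume "e > 0"
  let ?A = "\<lambda>Z n. {w \<in> space (M n). norm (Z n w) > e / 2}"
  have "(\<lambda>n. prob n (?A Z n) + prob n (?A Y n)) \<longlonglongrightarrow> 0 + 0"
    using Z Y half_gt_zero[OF \<open>e > 0\<close>] unfolding vanishes_iff by (intro tendsto_add) blast+
  then have lim: "(\<lambda>n. prob n (?A Z n) + prob n (?A Y n)) \<longlonglongrightarrow> 0" by simp
  show "(\<lambda>n. prob n {w \<in> space (M n). norm (Z n w + Y n w) > e}) \<longlonglongrightarrow> 0"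
  proof (rule tendsto_sandwich[OF _ _ tendsto_const lim])
    have "prob n {w \<in> space (M n). norm (Z n w + Y n w) > e} \<le> prob n (?A Z n) + prob n (?A Y n)" for n
    proof -
      have "norm (a + b) > e \<Longrightarrow> norm a > e / 2 \<or> norm b > e / 2" for a b :: 'b
        using norm_triangle_ineq[of a b] by linarith
      then have "prob n {w \<in> space (M n). norm (Z n w + Y n w) > e} \<le> prob n (?A Z n \<union> ?A Y n)"
        by (intro finite_measure_mono) auto
      also have "\<dots> \<le> prob n (?A Z n) + prob n (?A Y n)"
        by (intro measure_Un_le) auto
      finally show ?thesis .
    qed
    then show "\<forall>\<^sub>F n in sequentially. prob n {w \<in> space (M n). norm (Z n w + Y n w) > e}
        \<le> prob n (?A Z n) + prob n (?A Y n)" by simp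
  qed simp
qed

lemma vanishes_L1:
  fixes Z :: "nat \<Rightarrow> 'a \<Rightarrow> 'b::{banach, second_countable_topology}"
  assumes int: "\<And>n. integrable (M n) (Z n)"
    and lim: "(\<lambda>n. \<integral>w. norm (Z n w) \<partial>M n) \<longlonglongrightarrow> 0"
  shows "vanishes Z"
  unfolding vanishes_iff
proof (intro conjI allI impI)
  show [measurable]: "Z n \<in> borel_measurable (M n)" for n
    using int by (rule borel_measurable_integrable)
  fix e :: real assume e: "e > 0"
  have lim': "(\<lambda>n. (\<integral>w. norm (Z n w) \<partial>M n) / e) \<longlonglongrightarrow> 0"
    using tendsto_divide[OF lim tendsto_const[of e]] e by simp
  show "(\<lambda>n. tail_prob Z n e) \<longlonglongrightarrow> 0"
  proof (rule tendsto_sandwich[OF _ _ tendsto_const lim'])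
    have "tail_prob Z n e \<le> (\<integral>w. norm (Z n w) \<partial>M n) / e" for n
    proof -
      have "tail_prob Z n e \<le> prob n {w \<in> space (M n). norm (Z n w) \<ge> e}"
        by (intro finite_measure_mono) auto
      also have "\<dots> \<le> (\<integral>w. norm (Z n w) \<partial>M n) / e"
        by (rule integral_Markov_inequality_measure[where A = "{}"]) (use int e in auto)
      finally show ?thesis .
    qed
    then show "\<forall>\<^sub>F n in sequentially. tail_prob Z n e \<le> (\<integral>w. norm (Z n w) \<partial>M n) / e"
      by simp
  qed simp
qed

lemma vanishes_L2:
  fixes Z :: "nat \<Rightarrow> 'a \<Rightarrow> 'b::{real_normed_vector, second_countable_topology}"
  assumes Z[measurable]: "\<And>n. Z n \<in> borel_measurable (M n)"
    and int: "\<And>n. integrable (M n) (\<lambda>w. (norm (Z n w))\<^sup>2)"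
    and lim: "(\<lambda>n. \<integral>w. (norm (Z n w))\<^sup>2 \<partial>M n) \<longlonglongrightarrow> 0"
  shows "vanishes Z"
proof -
  have *: "vanishes (\<lambda>n w. (norm (Z n w))\<^sup>2)"
    by (rule vanishes_L1) (use int lim in auto)
  show ?thesis
    unfolding vanishes_iff
  proof (intro conjI allI impI Z)
    fix e :: real assume e: "e > 0"
    have "{w \<in> space (M n). norm (Z n w) > e} = {w \<in> space (M n). norm ((norm (Z n w))\<^sup>2) > e\<^sup>2}" for n
      using e by (auto intro: power_strict_mono dest: power_less_imp_less_base)
    then show "(\<lambda>n. tail_prob Z n e) \<longlonglongrightarrow> 0"
      using * e unfolding vanishes_iff by (simp del: norm_power)
  qed
qed

text \<open>Boundedness in probability. Asking for it only eventually in \<open>n\<close> is no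
  restriction, because every single random vector is tight.\<close>

definition tight_seq :: "(nat \<Rightarrow> 'a \<Rightarrow> 'b::real_normed_vector) \<Rightarrow> bool" where
  "tight_seq Z \<longleftrightarrow> (\<forall>n. Z n \<in> borel_measurable (M n)) \<and>
    (\<forall>e>0. \<exists>K. \<forall>\<^sub>F n in sequentially. tail_prob Z n K \<le> e)"

lemma tight_seq_L2:
  fixes Z :: "nat \<Rightarrow> 'a \<Rightarrow> 'b::{real_normed_vector, second_countable_topology}"
  assumes Z[measurable]: "\<And>n. Z n \<in> borel_measurable (M n)"
    and int: "\<And>n. integrable (M n) (\<lambda>w. (norm (Z n w))\<^sup>2)"
    and le: "\<And>n. (\<integral>w. (norm (Z n w))\<^sup>2 \<partial>M n) \<le> C"
  shows "tight_seq Z"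
  unfolding tight_seq_def
proof (intro conjI allI impI Z)
  fix e :: real assume e: "e > 0"
  \<comment> \<open>Solves \<open>(\<bar>C\<bar> + 1) / K\<^sup>2 = e\<close>, the Markov bound; the
    summand 1 keeps \<open>K\<close> positive when \<open>C\<close> is 0.\<close>
  define K where "K = sqrt ((\<bar>C\<bar> + 1) / e)"
  have K: "K > 0" "K\<^sup>2 = (\<bar>C\<bar> + 1) / e" using e by (simp_all add: K_def)
  have "tail_prob Z n K \<le> e" for n
  proof -
    have "tail_prob Z n K \<le> prob n {w \<in> space (M n). (norm (Z n w))\<^sup>2 \<ge> K\<^sup>2}"
      using K(1) by (intro finite_measure_mono) (auto intro!: power_mono)
    also have "\<dots> \<le> (\<integral>w. (norm (Z n w))\<^sup>2 \<partial>M n) / K\<^sup>2"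
      by (rule integral_Markov_inequality_measure[where A = "{}"]) (use int K(1) in auto)
    also have "\<dots> \<le> (\<bar>C\<bar> + 1) / K\<^sup>2"
      using le[of n] by (intro divide_right_mono) auto
    also have "\<dots> = e"
      using e by (simp add: K(2))
    finally show ?thesis .
  qed
  then show "\<exists>K. \<forall>\<^sub>F n in sequentially. tail_prob Z n K \<le> e"
    by (intro exI[of _ K]) simp
qed

lemma tight_seq_add:
  fixes Z Y :: "nat \<Rightarrow> 'a \<Rightarrow> 'b::{real_normed_vector, second_countable_topology}"
  assumes Z: "tight_seq Z" and Y: "vanishes Y"
  shows "tight_seq (\<lambda>n w. Z n w + Y n w)"
  unfolding tight_seq_def
proof (intro conjI allI impI)
  have [measurable]: "Z n \<in> borel_measurable (M n)" "Y n \<in> borel_measurable (M n)" for n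
    using Z Y by (simp_all add: vanishes_iff tight_seq_def)
  show "(\<lambda>w. Z n w + Y n w) \<in> borel_measurable (M n)" for n by measurable
  fix e :: real assume e: "e > 0"
  then obtain K where K: "\<forall>\<^sub>F n in sequentially. tail_prob Z n K \<le> e / 2"
    using Z unfolding tight_seq_def by (meson half_gt_zero)
  have "(\<lambda>n. tail_prob Y n 1) \<longlonglongrightarrow> 0"
    using Y by (simp add: vanishes_iff)
  then have "\<forall>\<^sub>F n in sequentially. tail_prob Y n 1 < e / 2"
    using e by (intro order_tendstoD) auto
  with K have "\<forall>\<^sub>F n in sequentially. prob n {w \<in> space (M n). norm (Z n w + Y n w) > K + 1} \<le> e"
  proof eventually_elim
    case (elim n)
    let ?A = "{w \<in> space (M n). norm (Z n w) > K}" and ?B = "{w \<in> space (M n). norm (Y n w) > 1}"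
    have "norm (a + b) > K + 1 \<Longrightarrow> norm a > K \<or> norm b > 1" for a b :: 'b
      using norm_triangle_ineq[of a b] by linarith
    then have "prob n {w \<in> space (M n). norm (Z n w + Y n w) > K + 1} \<le> prob n (?A \<union> ?B)"
      by (intro finite_measure_mono) auto
    also have "\<dots> \<le> prob n ?A + prob n ?B"
      by (intro measure_Un_le) auto
    finally show ?case using elim by linarith
  qed
  then show "\<exists>K. \<forall>\<^sub>F n in sequentially. prob n {w \<in> space (M n). norm (Z n w + Y n w) > K} \<le> e" ..
qed

text \<open>A product above \<open>e\<close> forces the tight factor above \<open>K\<close> or the
  vanishing one above \<open>e / L\<close>; \<open>L\<close> replaces \<open>K\<close> to have a
  positive divisor.\<close>

lemma vanishes_mult_tight:
  fixes Z Y :: "nat \<Rightarrow> 'a \<Rightarrow> real"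
  assumes Z: "vanishes Z" and Y: "tight_seq Y"
  shows "vanishes (\<lambda>n w. Z n w * Y n w)"
  unfolding vanishes_iff
proof (intro conjI allI impI)
  have [measurable]: "Z n \<in> borel_measurable (M n)" "Y n \<in> borel_measurable (M n)" for n
    using Z Y by (simp_all add: vanishes_iff tight_seq_def)
  show "(\<lambda>w. Z n w * Y n w) \<in> borel_measurable (M n)" for n by measurable
  fix e :: real assume e: "e > 0"
  show "(\<lambda>n. prob n {w \<in> space (M n). norm (Z n w * Y n w) > e}) \<longlonglongrightarrow> 0"
  proof (rule tendstoI)
    fix d :: real assume d: "d > 0"
    then obtain K where K: "\<forall>\<^sub>F n in sequentially. tail_prob Y n K \<le> d / 2"
      using Y unfolding tight_seq_def by (meson half_gt_zero)
    define L where "L = max K 1"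
    have L: "L > 0" "K \<le> L" by (auto simp: L_def)
    have "(\<lambda>n. tail_prob Z n (e / L)) \<longlonglongrightarrow> 0"
      using Z e L by (simp add: vanishes_iff)
    then have "\<forall>\<^sub>F n in sequentially. tail_prob Z n (e / L) < d / 2"
      using d by (intro order_tendstoD) auto
    with K show "\<forall>\<^sub>F n in sequentially. dist (prob n {w \<in> space (M n). norm (Z n w * Y n w) > e}) 0 < d"
    proof eventually_elim
      case (elim n)
      let ?A = "{w \<in> space (M n). norm (Z n w) > e / L}" and ?B = "{w \<in> space (M n). norm (Y n w) > K}"
      have "\<bar>a * b\<bar> \<le> e" if "\<bar>a\<bar> \<le> e / L" "\<bar>b\<bar> \<le> K" for a b :: real
      proof -
        have "\<bar>a * b\<bar> \<le> e / L * L"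
          unfolding abs_mult using that L e by (intro mult_mono) auto
        then show ?thesis using L by simp
      qed
      then have "prob n {w \<in> space (M n). norm (Z n w * Y n w) > e} \<le> prob n (?A \<union> ?B)"
        by (intro finite_measure_mono) (auto simp: not_less[symmetric])
      also have "\<dots> \<le> prob n ?A + prob n ?B"
        by (intro measure_Un_le) auto
      finally show ?case using elim by (simp add: dist_real_def)
    qed
  qed
qed

lemma vanishes_cmult:
  fixes Z :: "nat \<Rightarrow> 'a \<Rightarrow> real"
  assumes "vanishes Z"
  shows "vanishes (\<lambda>n w. Z n w * c)"
  by (rule vanishes_mult_tight[OF assms])
    (auto simp: tight_seq_def intro!: exI[of _ "\<bar>c\<bar>"])

lemma vanishes_norm:
  fixes Z :: "nat \<Rightarrow> 'a \<Rightarrow> 'b::{real_normed_vector, second_countable_topology}"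
  assumes "vanishes Z"
  shows "vanishes (\<lambda>n w. norm (Z n w))"
proof -
  have [measurable]: "Z n \<in> borel_measurable (M n)" for n
    using assms by (simp add: vanishes_iff)
  show ?thesis
    using assms by (simp add: vanishes_iff)
qed

lemma vanishes_sum:
  fixes Z :: "'i \<Rightarrow> nat \<Rightarrow> 'a \<Rightarrow> 'b::{real_normed_vector, second_countable_topology}"
  assumes "finite I" "\<And>i. i \<in> I \<Longrightarrow> vanishes (Z i)"
  shows "vanishes (\<lambda>n w. \<Sum>i\<in>I. Z i n w)"
  using assms
proof (induction I rule: finite_induct)
  case empty
  then show ?case by (simp add: vanishes_iff)
next
  case (insert i I)
  then show ?case by (simp add: vanishes_add)
qed

text \<open>The complex exponential of a real argument is 1-Lipschitz and of modulus 1. Where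
  \<open>Y\<close> has norm at most \<open>d\<close> the integrands differ by at most
  \<open>e / 2\<close>, and elsewhere by at most 2, on an event of probability below
  \<open>e / 4\<close>.\<close>

lemma char_tendsto_perturbed:
  fixes Z Y :: "nat \<Rightarrow> 'a \<Rightarrow> 'b::euclidean_space"
  assumes Z[measurable]: "\<And>n. Z n \<in> borel_measurable (M n)"
    and Y: "vanishes Y"
    and lim: "(\<lambda>n. \<integral>w. iexp (t \<bullet> Z n w) \<partial>M n) \<longlonglongrightarrow> c"
  shows "(\<lambda>n. \<integral>w. iexp (t \<bullet> (Z n w + Y n w)) \<partial>M n) \<longlonglongrightarrow> c"
proof (rule Lim_transform[OF lim], rule tendstoI)
  have Y_meas[measurable]: "Y n \<in> borel_measurable (M n)" for n
    using Y by (simp add: vanishes_iff)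
  fix e :: real assume e: "e > 0"
  define d where "d = e / (2 * (norm t + 1))"
  have d: "d > 0" using e by (simp add: d_def add_nonneg_pos)
  have td: "norm t * d \<le> e / 2"
  proof -
    have "norm t * d \<le> (norm t + 1) * d" using d by (intro mult_right_mono) auto
    also have "\<dots> = e / 2" proof -
      have "norm t + 1 \<noteq> 0" using norm_ge_zero[of t] by linarith
      then show ?thesis unfolding d_def by (simp add: divide_simps)
    qed
    finally show ?thesis .
  qed
  have "(\<lambda>n. tail_prob Y n d) \<longlonglongrightarrow> 0"
    using Y d by (simp add: vanishes_iff)
  then have "\<forall>\<^sub>F n in sequentially. tail_prob Y n d < e / 4"
    using e by (intro order_tendstoD) auto
  then show "\<forall>\<^sub>F n in sequentially. dist ((\<integral>w. iexp (t \<bullet> (Z n w + Y n w)) \<partial>M n) - (\<integral>w. iexp (t \<bullet> Z n w) \<partial>M n)) 0 < e"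
  proof eventually_elim
    case (elim n)
    let ?A = "{w \<in> space (M n). norm (Y n w) > d}"
    have int: "integrable (M n) (\<lambda>w. iexp (t \<bullet> V w))" if "V \<in> borel_measurable (M n)" for V :: "'a \<Rightarrow> 'b"
      by (rule integrable_iexp) (use that in auto)
    have intA: "integrable (M n) (indicat_real ?A)"
      by (intro integrable_real_indicator) (auto simp: emeasure_eq_measure)
    let ?d = "\<lambda>w. norm (iexp (t \<bullet> (Z n w + Y n w)) - iexp (t \<bullet> Z n w))"
    have pt: "?d w \<le> e / 2 + 2 * indicat_real ?A w"
      if "w \<in> space (M n)" for w
    proof -
      have "iexp (t \<bullet> (Z n w + Y n w)) - iexp (t \<bullet> Z n w) = iexp (t \<bullet> Z n w) * (iexp (t \<bullet> Y n w) - 1)"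
        by (simp add: inner_add_right ring_distribs exp_add)
      then have eq: "?d w = norm (iexp (t \<bullet> Y n w) - 1)"
        by (simp add: norm_mult)
      show ?thesis
      proof (cases "w \<in> ?A")
        case True
        have "norm (iexp (t \<bullet> Y n w) - 1) \<le> 1 + 1"
          by (rule norm_triangle_le_diff) simp
        then show ?thesis using eq True e by simp
      next
        case False
        have "norm (iexp (t \<bullet> Y n w) - 1) \<le> \<bar>t \<bullet> Y n w\<bar>"
          using iexp_approx1[of "t \<bullet> Y n w" 0] by simp
        also have "\<dots> \<le> norm t * norm (Y n w)" by (rule Cauchy_Schwarz_ineq2)
        also have "\<dots> \<le> norm t * d" using False that by (intro mult_left_mono) auto
        finally show ?thesis using td False eq by (simp add: indicator_def)
      qed
    qed
    have "norm ((\<integral>w. iexp (t \<bullet> (Z n w + Y n w)) \<partial>M n) - (\<integral>w. iexp (t \<bullet> Z n w) \<partial>M n))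
        = norm (\<integral>w. iexp (t \<bullet> (Z n w + Y n w)) - iexp (t \<bullet> Z n w) \<partial>M n)"
      by (subst Bochner_Integration.integral_diff) (auto intro!: int)
    also have "\<dots> \<le> (\<integral>w. ?d w \<partial>M n)"
      by (rule integral_norm_bound)
    also have "\<dots> \<le> (\<integral>w. e / 2 + 2 * indicat_real ?A w \<partial>M n)"
      using intA by (intro integral_mono pt integrable_norm Bochner_Integration.integrable_diff int) auto
    also have "\<dots> = e / 2 + 2 * prob n ?A"
      by (subst Bochner_Integration.integral_add) (use intA in \<open>auto simp: prob_space\<close>)
    finally show ?case using elim by simp
  qed
qed

end

section \<open>Sums of independent random vectors\<close>

lemma (in prob_space) independent_elements_prob:
  assumes ind: "independent_elements M S U T V" and A: "A \<in> sets S" and B: "B \<in> sets T"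
  shows "prob ((U -` A \<inter> space M) \<inter> (V -` B \<inter> space M)) = prob (U -` A \<inter> space M) * prob (V -` B \<inter> space M)"
proof (rule indep_setD)
  show "indep_set {U -` A \<inter> space M |A. A \<in> sets S} {V -` B \<inter> space M |B. B \<in> sets T}"
    using ind by (simp add: independent_elements_def)
qed (use A B in auto)

text \<open>The two families are independent as whole vectors. On rectangles, an intersection-stable
  generator of the product sigma algebra, the probabilities first split into the two families and
  then, within each family, over the indices.\<close>

lemma (in prob_space)
  assumes I: "finite I" and X: "indep_vars (\<lambda>_. S) X I" and Y: "indep_vars (\<lambda>_. T) Y I"
    and ind: "independent_elements M (PiM I (\<lambda>_. S)) (\<lambda>w. \<lambda>i\<in>I. X i w) (PiM I (\<lambda>_. T)) (\<lambda>w. \<lambda>i\<in>I. Y i w)"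
  shows indep_vars_Pair: "indep_vars (\<lambda>_. S \<Otimes>\<^sub>M T) (\<lambda>i w. (X i w, Y i w)) I"
    and distr_Pair: "i \<in> I \<Longrightarrow> distr M (S \<Otimes>\<^sub>M T) (\<lambda>w. (X i w, Y i w)) = distr M S (X i) \<Otimes>\<^sub>M distr M T (Y i)"
proof -
  have X_rv: "X i \<in> M \<rightarrow>\<^sub>M S" and Y_rv: "Y i \<in> M \<rightarrow>\<^sub>M T" if "i \<in> I" for i
    using X Y that by (auto simp: indep_vars_def2)
  have vimX: "(\<lambda>w. \<lambda>i\<in>I. X i w) -` {f \<in> space (PiM I (\<lambda>_. S)). f i \<in> A} \<inter> space M = X i -` A \<inter> space M"
    if "i \<in> I" for i A
    using that measurable_space[OF X_rv] by (auto simp: space_PiM)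
  have vimY: "(\<lambda>w. \<lambda>i\<in>I. Y i w) -` {f \<in> space (PiM I (\<lambda>_. T)). f i \<in> A} \<inter> space M = Y i -` A \<inter> space M"
    if "i \<in> I" for i A
    using that measurable_space[OF Y_rv] by (auto simp: space_PiM)
  have pair: "prob ((X i -` A \<inter> space M) \<inter> (Y i -` B \<inter> space M)) = prob (X i -` A \<inter> space M) * prob (Y i -` B \<inter> space M)"
    if i: "i \<in> I" and AB: "A \<in> sets S" "B \<in> sets T" for i A B
  proof -
    have "{f \<in> space (PiM I (\<lambda>_. S)). f i \<in> A} \<in> sets (PiM I (\<lambda>_. S))"
         "{f \<in> space (PiM I (\<lambda>_. T)). f i \<in> B} \<in> sets (PiM I (\<lambda>_. T))"
      using i AB by measurable
    from independent_elements_prob[OF ind this] show ?thesis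
      by (simp only: vimX[OF i] vimY[OF i])
  qed
  show "indep_vars (\<lambda>_. S \<Otimes>\<^sub>M T) (\<lambda>i w. (X i w, Y i w)) I"
  proof (cases "I = {}")
    case True
    then show ?thesis by (simp add: indep_vars_def2 indep_sets_def)
  next
    case False
    let ?E = "{a \<times> b | a b. a \<in> sets S \<and> b \<in> sets T}"
    show ?thesis
    proof (subst indep_vars_finite[OF False I, where E = "\<lambda>_. ?E"])
      show "\<forall>A\<in>I \<rightarrow> ?E. prob (\<Inter>j\<in>I. (\<lambda>w. (X j w, Y j w)) -` A j \<inter> space M)
          = (\<Prod>j\<in>I. prob ((\<lambda>w. (X j w, Y j w)) -` A j \<inter> space M))"
      proof
        fix A assume "A \<in> I \<rightarrow> ?E"
        then have "\<forall>j\<in>I. \<exists>a b. A j = a \<times> b \<and> a \<in> sets S \<and> b \<in> sets T" by blast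
        then obtain a b where ab: "\<And>j. j \<in> I \<Longrightarrow> A j = a j \<times> b j" "\<And>j. j \<in> I \<Longrightarrow> a j \<in> sets S" "\<And>j. j \<in> I \<Longrightarrow> b j \<in> sets T"
          by metis
        \<comment> \<open>A box in the product space pulls back to an intersection over the indices,
          which is what independence of the whole vectors can be applied to.\<close>
        have X_eq: "(\<lambda>w. \<lambda>i\<in>I. X i w) -` (PiE I a) \<inter> space M = (\<Inter>j\<in>I. X j -` a j \<inter> space M)"
          using False by (auto simp: PiE_iff)
        have Y_eq: "(\<lambda>w. \<lambda>i\<in>I. Y i w) -` (PiE I b) \<inter> space M = (\<Inter>j\<in>I. Y j -` b j \<inter> space M)"
          using False by (auto simp: PiE_iff)
        have "(\<Inter>j\<in>I. (\<lambda>w. (X j w, Y j w)) -` A j \<inter> space M) = (\<Inter>j\<in>I. X j -` a j \<inter> space M) \<inter> (\<Inter>j\<in>I. Y j -` b j \<inter> space M)"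
          using False ab(1) by auto
        then have "prob (\<Inter>j\<in>I. (\<lambda>w. (X j w, Y j w)) -` A j \<inter> space M)
            = prob (\<Inter>j\<in>I. X j -` a j \<inter> space M) * prob (\<Inter>j\<in>I. Y j -` b j \<inter> space M)"
          using independent_elements_prob[OF ind sets_PiM_I_finite[OF I] sets_PiM_I_finite[OF I], of a b] ab
          unfolding X_eq Y_eq by simp
        also have "\<dots> = (\<Prod>j\<in>I. prob (X j -` a j \<inter> space M)) * (\<Prod>j\<in>I. prob (Y j -` b j \<inter> space M))"
          using indep_varsD_finite[OF X False I] indep_varsD_finite[OF Y False I] ab by simp
        also have "\<dots> = (\<Prod>j\<in>I. prob ((X j -` a j \<inter> space M) \<inter> (Y j -` b j \<inter> space M)))"
          unfolding prod.distrib[symmetric] by (intro prod.cong refl) (simp add: pair ab)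
        also have "\<dots> = (\<Prod>j\<in>I. prob ((\<lambda>w. (X j w, Y j w)) -` A j \<inter> space M))"
          by (intro prod.cong refl arg_cong[where f = prob]) (auto simp: ab(1))
        finally show "prob (\<Inter>j\<in>I. (\<lambda>w. (X j w, Y j w)) -` A j \<inter> space M)
          = (\<Prod>j\<in>I. prob ((\<lambda>w. (X j w, Y j w)) -` A j \<inter> space M))" .
      qed
      show "sets (S \<Otimes>\<^sub>M T) = sigma_sets (space (S \<Otimes>\<^sub>M T)) ?E"
        by (simp add: sets_pair_measure space_pair_measure)
      show "(\<lambda>w. (X i w, Y i w)) \<in> M \<rightarrow>\<^sub>M S \<Otimes>\<^sub>M T" if "i \<in> I" for i
        using X_rv[OF that] Y_rv[OF that] by measurable
      show "Int_stable ?E"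
        by (rule Int_stable_pair_measure_generator)
      show "space (S \<Otimes>\<^sub>M T) \<in> ?E"
        by (auto simp: space_pair_measure)
      show "?E \<subseteq> Pow (space (S \<Otimes>\<^sub>M T))"
      proof
        fix x assume "x \<in> ?E"
        then obtain a b where "x = a \<times> b" "a \<in> sets S" "b \<in> sets T" by blast
        then show "x \<in> Pow (space (S \<Otimes>\<^sub>M T))"
          using sets.sets_into_space[of a S] sets.sets_into_space[of b T] by (auto simp: space_pair_measure)
      qed
    qed
  qed
  assume i: "i \<in> I"
  note [measurable] = X_rv[OF i] Y_rv[OF i]
  interpret S: prob_space "distr M S (X i)" by (rule prob_space_distr) measurable
  interpret T: prob_space "distr M T (Y i)" by (rule prob_space_distr) measurable
  show "distr M (S \<Otimes>\<^sub>M T) (\<lambda>w. (X i w, Y i w)) = distr M S (X i) \<Otimes>\<^sub>M distr M T (Y i)"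
  proof (rule pair_measure_eqI[symmetric])
    fix A B assume "A \<in> sets (distr M S (X i))" "B \<in> sets (distr M T (Y i))"
    then have AB [measurable]: "A \<in> sets S" "B \<in> sets T" by simp_all
    have "(\<lambda>w. (X i w, Y i w)) -` (A \<times> B) \<inter> space M = (X i -` A \<inter> space M) \<inter> (Y i -` B \<inter> space M)"
      by auto
    then show "emeasure (distr M S (X i)) A * emeasure (distr M T (Y i)) B
        = emeasure (distr M (S \<Otimes>\<^sub>M T) (\<lambda>w. (X i w, Y i w))) (A \<times> B)"
      using pair[OF i AB] by (simp add: emeasure_distr emeasure_eq_measure ennreal_mult[symmetric])
  qed (simp_all add: S.sigma_finite_measure_axioms T.sigma_finite_measure_axioms)
qed

text \<open>Distinct summands are uncorrelated: their inner product is a sum over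
  \<open>Basis\<close> of products of independent centred real variables.\<close>

lemma (in prob_space)
  fixes Z :: "'i \<Rightarrow> 'a \<Rightarrow> 'b::euclidean_space"
  assumes I: "finite I" and Z: "indep_vars (\<lambda>_. borel) Z I"
    and int: "\<And>i. i \<in> I \<Longrightarrow> integrable M (\<lambda>w. (norm (Z i w))\<^sup>2)"
    and mean: "\<And>i. i \<in> I \<Longrightarrow> expectation (Z i) = 0"
  shows integrable_norm_sum_square: "integrable M (\<lambda>w. (norm (\<Sum>i\<in>I. Z i w))\<^sup>2)"
    and expectation_norm_sum_square:
      "expectation (\<lambda>w. (norm (\<Sum>i\<in>I. Z i w))\<^sup>2) = (\<Sum>i\<in>I. expectation (\<lambda>w. (norm (Z i w))\<^sup>2))"
proof -
  have Z_rv [measurable]: "Z i \<in> borel_measurable M" if "i \<in> I" for i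
    using Z that by (auto simp: indep_vars_def2)
  have intZ: "integrable M (Z i)" if i: "i \<in> I" for i
  proof -
    have "integrable M (\<lambda>w. norm (Z i w))"
      using Z_rv[OF i] by (intro square_integrable_imp_integrable[OF _ int[OF i]]) simp
    then show ?thesis using Z_rv[OF i] by (simp add: integrable_norm_iff)
  qed
  have intij: "integrable M (\<lambda>w. Z i w \<bullet> Z j w)" if ij: "i \<in> I" "j \<in> I" for i j
  proof (rule Bochner_Integration.integrable_bound)
    show "integrable M (\<lambda>w. (norm (Z i w))\<^sup>2 + (norm (Z j w))\<^sup>2)"
      using int ij by auto
    show "AE w in M. norm (Z i w \<bullet> Z j w) \<le> norm ((norm (Z i w))\<^sup>2 + (norm (Z j w))\<^sup>2)"
    proof (rule AE_I2)
      fix w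
      have "\<bar>Z i w \<bullet> Z j w\<bar> \<le> norm (Z i w) * norm (Z j w)" by (rule Cauchy_Schwarz_ineq2)
      moreover have "2 * (norm (Z i w) * norm (Z j w)) \<le> (norm (Z i w))\<^sup>2 + (norm (Z j w))\<^sup>2"
        using sum_squares_bound[of "norm (Z i w)" "norm (Z j w)"] by simp
      moreover have "0 \<le> norm (Z i w) * norm (Z j w)" by simp
      ultimately have "\<bar>Z i w \<bullet> Z j w\<bar> \<le> (norm (Z i w))\<^sup>2 + (norm (Z j w))\<^sup>2" by linarith
      then show "norm (Z i w \<bullet> Z j w) \<le> norm ((norm (Z i w))\<^sup>2 + (norm (Z j w))\<^sup>2)" by simp
    qed
  qed (use ij in measurable)
  have ortho: "expectation (\<lambda>w. Z i w \<bullet> Z j w) = 0" if ij: "i \<in> I" "j \<in> I" "i \<noteq> j" for i j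
  proof -
    have ind: "indep_vars (\<lambda>_. borel) (\<lambda>k w. Z k w \<bullet> b) {i, j}" for b
      using indep_vars_compose2[OF indep_vars_subset[OF Z, of "{i, j}"], of "\<lambda>_ x. x \<bullet> b"] ij by auto
    have int_b: "integrable M (\<lambda>w. Z k w \<bullet> b)" if "k \<in> {i, j}" for k b
      using intZ that ij by auto
    have "expectation (\<lambda>w. (Z i w \<bullet> b) * (Z j w \<bullet> b)) = 0 \<and> integrable M (\<lambda>w. (Z i w \<bullet> b) * (Z j w \<bullet> b))" for b
    proof -
      have "expectation (\<lambda>w. Z i w \<bullet> b) = 0"
        using intZ[OF ij(1)] mean[OF ij(1)] by simp
      then show ?thesis
        using indep_vars_lebesgue_integral[OF _ ind int_b, of b] indep_vars_integrable[OF _ ind int_b, of b] ij by simp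
    qed
    then have b: "\<And>b. expectation (\<lambda>w. (Z i w \<bullet> b) * (Z j w \<bullet> b)) = 0"
        "\<And>b. integrable M (\<lambda>w. (Z i w \<bullet> b) * (Z j w \<bullet> b))" by blast+
    have "expectation (\<lambda>w. Z i w \<bullet> Z j w) = expectation (\<lambda>w. \<Sum>b\<in>Basis. (Z i w \<bullet> b) * (Z j w \<bullet> b))"
      by (subst euclidean_inner) simp
    also have "\<dots> = (\<Sum>b\<in>Basis. expectation (\<lambda>w. (Z i w \<bullet> b) * (Z j w \<bullet> b)))"
      by (rule Bochner_Integration.integral_sum) (rule b)
    finally show ?thesis by (simp add: b)
  qed
  have eq: "(norm (\<Sum>i\<in>I. Z i w))\<^sup>2 = (\<Sum>i\<in>I. \<Sum>j\<in>I. Z i w \<bullet> Z j w)" for w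
    by (simp add: power2_norm_eq_inner inner_sum_left inner_sum_right) (rule sum.swap)
  show "integrable M (\<lambda>w. (norm (\<Sum>i\<in>I. Z i w))\<^sup>2)"
    unfolding eq using intij by auto
  have "expectation (\<lambda>w. (norm (\<Sum>i\<in>I. Z i w))\<^sup>2) = (\<Sum>i\<in>I. \<Sum>j\<in>I. expectation (\<lambda>w. Z i w \<bullet> Z j w))"
    unfolding eq by (subst Bochner_Integration.integral_sum; intro sum.cong refl Bochner_Integration.integrable_sum Bochner_Integration.integral_sum intij)
  also have "\<dots> = (\<Sum>i\<in>I. \<Sum>j\<in>I. if i = j then expectation (\<lambda>w. Z i w \<bullet> Z i w) else 0)"
    by (intro sum.cong refl) (auto simp: ortho)
  also have "\<dots> = (\<Sum>i\<in>I. expectation (\<lambda>w. (norm (Z i w))\<^sup>2))"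
    using I by (simp add: power2_norm_eq_inner)
  finally show "expectation (\<lambda>w. (norm (\<Sum>i\<in>I. Z i w))\<^sup>2) = (\<Sum>i\<in>I. expectation (\<lambda>w. (norm (Z i w))\<^sup>2))" .
qed

section \<open>Limit theorems for rows of i.i.d. variables\<close>

lemma (in prob_space) abs_expectation_le_sqrt:
  fixes Y :: "'a \<Rightarrow> real"
  assumes Y: "Y \<in> borel_measurable M" and int: "integrable M (\<lambda>w. (Y w)\<^sup>2)"
  shows "expectation (\<lambda>w. \<bar>Y w\<bar>) \<le> sqrt (expectation (\<lambda>w. (Y w)\<^sup>2))"
proof -
  have int1: "integrable M (\<lambda>w. \<bar>Y w\<bar>)"
    using square_integrable_imp_integrable[OF Y int] by simp
  have "0 \<le> variance (\<lambda>w. \<bar>Y w\<bar>)" by (rule variance_positive)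
  also have "\<dots> = expectation (\<lambda>w. (Y w)\<^sup>2) - (expectation (\<lambda>w. \<bar>Y w\<bar>))\<^sup>2"
    using int by (subst variance_eq[OF int1]) auto
  finally show ?thesis
    by (intro real_le_rsqrt) simp
qed

text \<open>With only a first moment at hand, each summand is truncated at \<open>K\<close> by
  \<open>h\<close>. The discarded parts cost \<open>d\<close> in L1, and the shift of the mean by
  truncation costs \<open>d\<close> again. The centred truncated sum \<open>B\<close> has second
  moment at most \<open>n * (2 * K)\<^sup>2\<close>. The last term pays for dividing by
  \<open>n\<close> instead of \<open>card I\<close>.\<close>

lemma (in prob_space) truncated_mean_bound:
  fixes Z :: "'i \<Rightarrow> 'a \<Rightarrow> real" and Q :: "real measure"
  assumes I: "finite I" "card I \<le> n" and n: "n > 0" and Z: "indep_vars (\<lambda>_. borel) Z I"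
    and distr: "\<And>i. i \<in> I \<Longrightarrow> distr M borel (Z i) = Q"
    and Q: "prob_space Q" "sets Q = sets borel" and int: "integrable Q (\<lambda>x. x)" and K: "K \<ge> 0"
  shows "integrable M (\<lambda>w. (\<Sum>i\<in>I. Z i w) / n - (\<integral>x. x \<partial>Q))"
    and "expectation (\<lambda>w. \<bar>(\<Sum>i\<in>I. Z i w) / n - (\<integral>x. x \<partial>Q)\<bar>)
      \<le> 2 * (\<integral>x. \<bar>x - (if \<bar>x\<bar> \<le> K then x else 0)\<bar> \<partial>Q) + 2 * K / sqrt n + (1 - card I / n) * K"
proof -
  interpret Q: prob_space Q by fact
  let ?m = "\<integral>x. x \<partial>Q"
  let ?d = "\<lambda>w. (\<Sum>i\<in>I. Z i w) / n - ?m"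
  note [measurable_cong] = Q(2)
  define h where "h x = (if \<bar>x\<bar> \<le> K then x else 0)" for x :: real
  have [measurable]: "h \<in> borel_measurable borel" unfolding h_def by measurable
  have hK: "\<bar>h x\<bar> \<le> K" for x using K by (simp add: h_def)
  define d where "d = (\<integral>x. \<bar>x - h x\<bar> \<partial>Q)"
  define c where "c = (\<integral>x. h x \<partial>Q)"
  have int_h: "integrable Q h"
    using hK by (intro Q.integrable_const_bound[of _ K]) auto
  have int_d: "integrable Q (\<lambda>x. x - h x)" using int int_h by auto
  have cK: "\<bar>c\<bar> \<le> K"
  proof -
    have "\<bar>c\<bar> \<le> (\<integral>x. \<bar>h x\<bar> \<partial>Q)" unfolding c_def by (rule integral_abs_bound)
    also have "\<dots> \<le> (\<integral>x. K \<partial>Q)" using int_h hK by (intro integral_mono) auto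
    finally show ?thesis by (simp add: Q.prob_space)
  qed
  have cm: "\<bar>c - ?m\<bar> \<le> d"
  proof -
    have "c - ?m = (\<integral>x. h x - x \<partial>Q)"
      unfolding c_def using int int_h by simp
    also have "\<bar>\<dots>\<bar> \<le> (\<integral>x. \<bar>h x - x\<bar> \<partial>Q)" by (rule integral_abs_bound)
    finally show ?thesis by (simp add: d_def abs_minus_commute)
  qed
  have Z_rv [measurable]: "Z i \<in> borel_measurable M" if "i \<in> I" for i
    using Z that by (auto simp: indep_vars_def2)
  have transfer: "integrable M (\<lambda>w. g (Z i w))" "expectation (\<lambda>w. g (Z i w)) = (\<integral>x. g x \<partial>Q)"
    if i: "i \<in> I" and g: "integrable Q g" for i and g :: "real \<Rightarrow> real"
  proof -
    have [measurable]: "g \<in> borel_measurable borel"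
      using borel_measurable_integrable[OF g] by (simp cong: measurable_cong_sets)
    show "integrable M (\<lambda>w. g (Z i w))"
      using g i unfolding distr[OF i, symmetric] by (subst (asm) integrable_distr_eq) auto
    show "expectation (\<lambda>w. g (Z i w)) = (\<integral>x. g x \<partial>Q)"
      using i unfolding distr[OF i, symmetric] by (subst integral_distr) auto
  qed
  define A where "A w = (\<Sum>i\<in>I. Z i w - h (Z i w))" for w
  define B where "B w = (\<Sum>i\<in>I. h (Z i w) - c)" for w
  have intA: "integrable M A"
    unfolding A_def by (rule Bochner_Integration.integrable_sum) (rule transfer(1)[OF _ int_d])
  have EA: "expectation (\<lambda>w. \<bar>A w\<bar>) \<le> n * d"
  proof -
    have "expectation (\<lambda>w. \<bar>A w\<bar>) \<le> expectation (\<lambda>w. \<Sum>i\<in>I. \<bar>Z i w - h (Z i w)\<bar>)"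
    proof (rule integral_mono)
      show "integrable M (\<lambda>w. \<Sum>i\<in>I. \<bar>Z i w - h (Z i w)\<bar>)"
        by (rule Bochner_Integration.integrable_sum) (rule transfer(1)[OF _ integrable_abs[OF int_d]])
    qed (use integrable_abs[OF intA] in \<open>auto simp: A_def intro: sum_abs\<close>)
    also have "\<dots> = (\<Sum>i\<in>I. expectation (\<lambda>w. \<bar>Z i w - h (Z i w)\<bar>))"
      by (rule Bochner_Integration.integral_sum) (rule transfer(1)[OF _ integrable_abs[OF int_d]])
    also have "\<dots> = card I * d"
      by (simp add: transfer(2)[OF _ integrable_abs[OF int_d]] d_def)
    also have "\<dots> \<le> n * d"
      using I by (intro mult_right_mono) (auto simp: d_def)
    finally show ?thesis .
  qed
  have int_hc: "integrable Q (\<lambda>x. h x - c)" using int_h by auto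
  have hc: "(h x - c)\<^sup>2 \<le> (2 * K)\<^sup>2" for x
  proof -
    have "\<bar>h x - c\<bar> \<le> 2 * K" using hK[of x] cK by linarith
    then show ?thesis by (metis power2_abs power_mono abs_ge_zero)
  qed
  have int_hc2: "integrable Q (\<lambda>x. (h x - c)\<^sup>2)"
    using hc by (intro Q.integrable_const_bound[of _ "(2 * K)\<^sup>2"]) auto
  have indB: "indep_vars (\<lambda>_. borel) (\<lambda>i w. h (Z i w) - c) I"
    using indep_vars_compose2[OF Z, of "\<lambda>_ x. h x - c"] by simp
  have meanB: "expectation (\<lambda>w. h (Z i w) - c) = 0" if "i \<in> I" for i
    using transfer(2)[OF that int_hc] int_h by (simp add: c_def Q.prob_space)
  have sqB: "integrable M (\<lambda>w. (norm (h (Z i w) - c))\<^sup>2)" if "i \<in> I" for i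
    using transfer(1)[OF that int_hc2] by simp
  have intB2: "integrable M (\<lambda>w. (B w)\<^sup>2)"
    using integrable_norm_sum_square[OF I(1) indB sqB meanB] by (simp add: B_def)
  have intB: "integrable M B"
    unfolding B_def by (rule Bochner_Integration.integrable_sum) (rule transfer(1)[OF _ int_hc])
  have EB: "expectation (\<lambda>w. \<bar>B w\<bar>) \<le> sqrt n * (2 * K)"
  proof -
    have "expectation (\<lambda>w. (B w)\<^sup>2) = (\<Sum>i\<in>I. expectation (\<lambda>w. (h (Z i w) - c)\<^sup>2))"
      using expectation_norm_sum_square[OF I(1) indB sqB meanB] by (simp add: B_def)
    also have "\<dots> \<le> (\<Sum>i\<in>I. (2 * K)\<^sup>2)"
    proof (rule sum_mono)
      fix i assume i: "i \<in> I"
      have "expectation (\<lambda>w. (h (Z i w) - c)\<^sup>2) = (\<integral>x. (h x - c)\<^sup>2 \<partial>Q)"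
        by (rule transfer(2)[OF i int_hc2])
      also have "\<dots> \<le> (\<integral>x. (2 * K)\<^sup>2 \<partial>Q)"
        using int_hc2 hc by (intro integral_mono) auto
      finally show "expectation (\<lambda>w. (h (Z i w) - c)\<^sup>2) \<le> (2 * K)\<^sup>2" by (simp add: Q.prob_space)
    qed
    also have "\<dots> \<le> n * (2 * K)\<^sup>2"
      using I(2) by (simp add: mult_right_mono)
    finally have "sqrt (expectation (\<lambda>w. (B w)\<^sup>2)) \<le> sqrt (n * (2 * K)\<^sup>2)" by simp
    moreover have "sqrt (n * (2 * K)\<^sup>2) = sqrt n * (2 * K)" using K by (simp add: real_sqrt_mult)
    ultimately show ?thesis
      using abs_expectation_le_sqrt[OF borel_measurable_integrable[OF intB] intB2] by linarith
  qed
  define r where "r = card I * c / n - ?m"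
  have r: "\<bar>r\<bar> \<le> d + (1 - card I / n) * K"
  proof -
    have "0 \<le> 1 - card I / n" using I n by simp
    moreover have "r = (c - ?m) - (1 - card I / n) * c" by (simp add: r_def algebra_simps)
    ultimately have "\<bar>r\<bar> \<le> \<bar>c - ?m\<bar> + (1 - card I / n) * \<bar>c\<bar>"
      using abs_triangle_ineq4[of "c - ?m" "(1 - card I / n) * c"] by (simp add: abs_mult)
    also have "\<dots> \<le> d + (1 - card I / n) * K"
      using cm cK \<open>0 \<le> 1 - card I / n\<close> by (intro add_mono mult_left_mono)
    finally show ?thesis .
  qed
  have eq: "?d w = A w / n + B w / n + r" for w
    by (simp add: A_def B_def r_def sum_subtractf diff_divide_distrib)
  show "integrable M ?d"
    unfolding eq using intA intB by auto
  have "expectation (\<lambda>w. \<bar>?d w\<bar>)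
      \<le> expectation (\<lambda>w. \<bar>A w\<bar> / n + \<bar>B w\<bar> / n + \<bar>r\<bar>)"
    unfolding eq
  proof (rule integral_mono)
    fix w
    have "\<bar>A w / n + B w / n + r\<bar> \<le> \<bar>A w / n\<bar> + \<bar>B w / n\<bar> + \<bar>r\<bar>" by linarith
    then show "\<bar>A w / n + B w / n + r\<bar> \<le> \<bar>A w\<bar> / n + \<bar>B w\<bar> / n + \<bar>r\<bar>" by simp
  qed (use intA intB in auto)
  also have "\<dots> = expectation (\<lambda>w. \<bar>A w\<bar>) / n + expectation (\<lambda>w. \<bar>B w\<bar>) / n + \<bar>r\<bar>"
    using intA intB by (simp add: prob_space)
  also have "\<dots> \<le> d + 2 * K / sqrt n + (d + (1 - card I / n) * K)"
  proof (intro add_mono r)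
    show "expectation (\<lambda>w. \<bar>A w\<bar>) / n \<le> d" using EA n by (simp add: field_simps)
    have "expectation (\<lambda>w. \<bar>B w\<bar>) / n \<le> sqrt n * (2 * K) / n" using EB by (intro divide_right_mono) auto
    also have "\<dots> = 2 * K / sqrt n" using n by (simp add: field_simps)
    finally show "expectation (\<lambda>w. \<bar>B w\<bar>) / n \<le> 2 * K / sqrt n" .
  qed
  finally show "expectation (\<lambda>w. \<bar>?d w\<bar>)
      \<le> 2 * (\<integral>x. \<bar>x - (if \<bar>x\<bar> \<le> K then x else 0)\<bar> \<partial>Q) + 2 * K / sqrt n + (1 - card I / n) * K"
    by (simp add: d_def h_def)
qed

context prob_array
begin

text \<open>Convergence holds even in L1. The truncation level \<open>k\<close> is fixed first, by
  dominated convergence under \<open>Q\<close>, and only then is \<open>n\<close> taken large. The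
  subsets \<open>I n\<close> allow for rows that are left out, as long as their proportion tends to
  0.\<close>

lemma weak_law_of_large_numbers:
  fixes Z :: "nat \<Rightarrow> nat \<Rightarrow> 'a \<Rightarrow> real" and Q :: "real measure"
  assumes I: "\<And>n. I n \<subseteq> {1..n}" and card: "(\<lambda>n. real (card (I n)) / real n) \<longlonglongrightarrow> 1"
    and Z: "\<And>n. indep_vars n (\<lambda>_. borel) (Z n) (I n)"
    and distr: "\<And>n i. i \<in> I n \<Longrightarrow> distr (M n) borel (Z n i) = Q"
    and Q: "prob_space Q" "sets Q = sets borel" and int: "integrable Q (\<lambda>x. x)"
  shows "vanishes (\<lambda>n w. (\<Sum>i\<in>I n. Z n i w) / n - (\<integral>x. x \<partial>Q))"
proof -
  interpret Q: prob_space Q by fact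
  note [measurable_cong] = Q(2)
  have fin: "finite (I n)" "card (I n) \<le> n" for n
    using finite_subset[OF I, of n] card_mono[OF _ I, of n] by auto
  let ?D = "\<lambda>K. \<integral>x. \<bar>x - (if \<bar>x\<bar> \<le> K then x else 0)\<bar> \<partial>Q"
  have "(\<lambda>k::nat. ?D (real k)) \<longlonglongrightarrow> (\<integral>x. 0 \<partial>Q)"
  proof (rule integral_dominated_convergence[where w = "\<lambda>x. \<bar>x\<bar>"])
    show "AE x in Q. (\<lambda>k. \<bar>x - (if \<bar>x\<bar> \<le> real k then x else 0)\<bar>) \<longlonglongrightarrow> 0"
    proof (rule AE_I2, rule tendsto_eventually)
      fix x :: real
      show "\<forall>\<^sub>F k in sequentially. \<bar>x - (if \<bar>x\<bar> \<le> real k then x else 0)\<bar> = 0"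
        using eventually_ge_at_top[of "nat \<lceil>\<bar>x\<bar>\<rceil>"] by eventually_elim (simp add: nat_ceiling_le_eq)
    qed
    show "(\<lambda>x. \<bar>x - (if \<bar>x\<bar> \<le> real k then x else 0)\<bar>) \<in> borel_measurable Q" for k
      by measurable
    show "integrable Q (\<lambda>x. \<bar>x\<bar>)"
      using int by (rule integrable_abs)
    show "AE x in Q. norm \<bar>x - (if \<bar>x\<bar> \<le> real k then x else 0)\<bar> \<le> \<bar>x\<bar>" for k
      by (rule AE_I2) simp
  qed simp
  then have D: "(\<lambda>k::nat. ?D (real k)) \<longlonglongrightarrow> 0" by simp
  let ?E = "\<lambda>n. \<integral>w. \<bar>(\<Sum>i\<in>I n. Z n i w) / n - (\<integral>x. x \<partial>Q)\<bar> \<partial>M n"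
  have L1: "?E \<longlonglongrightarrow> 0"
  proof (rule tendstoI)
    fix e :: real assume e: "e > 0"
    have "\<forall>\<^sub>F k in sequentially. ?D (real k) < e / 8"
      using D e by (intro order_tendstoD) auto
    then obtain k :: nat where k: "?D (real k) < e / 8"
      using eventually_happens'[OF sequentially_bot] by blast
    have "(\<lambda>n. 2 * real k / sqrt (real n) + (1 - real (card (I n)) / real n) * real k) \<longlonglongrightarrow> 0 + (1 - 1) * real k"
    proof (intro tendsto_add tendsto_mult tendsto_diff tendsto_const card)
      show "(\<lambda>n. 2 * real k / sqrt (real n)) \<longlonglongrightarrow> 0"
        by (intro real_tendsto_divide_at_top[OF tendsto_const] filterlim_compose[OF sqrt_at_top] filterlim_real_sequentially)
    qed
    then have "\<forall>\<^sub>F n in sequentially. 2 * real k / sqrt (real n) + (1 - real (card (I n)) / real n) * real k < e / 2"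
      using e by (intro order_tendstoD) auto
    with eventually_gt_at_top[of 0]
    show "\<forall>\<^sub>F n in sequentially. dist (?E n) 0 < e"
    proof eventually_elim
      case (elim n)
      have "?E n
          \<le> 2 * ?D (real k) + 2 * real k / sqrt n + (1 - card (I n) / n) * real k"
        by (rule truncated_mean_bound(2)[OF fin elim(1) Z distr Q int]) auto
      then have "?E n < e"
        using k elim(2) e by linarith
      moreover have "0 \<le> ?E n"
        by simp
      ultimately show ?case by (simp add: dist_real_def)
    qed
  qed
  show ?thesis
  proof (rule vanishes_L1)
    show "integrable (M n) (\<lambda>w. (\<Sum>i\<in>I n. Z n i w) / n - (\<integral>x. x \<partial>Q))" for n
    proof (cases "n = 0")
      case True
      then show ?thesis using I[of n] by simp
    next
      case False
      then show ?thesis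
        by (intro truncated_mean_bound(1)[OF fin _ Z distr Q int, of n 0]) auto
    qed
  qed (use L1 in simp)
qed

end

text \<open>The central limit theorem on the level of characteristic functions. Powers of numbers of
  modulus at most 1 differ by at most \<open>n\<close> times the difference of the bases, which
  cancels the factor \<open>1 / n\<close> of the second-order expansion; what remains is the
  expectation \<open>?m n\<close>, tending to 0 by dominated convergence.\<close>

lemma (in real_distribution) char_power_tendsto:
  assumes int: "integrable M (\<lambda>x. x)" and mean: "expectation (\<lambda>x. x) = 0"
    and int2: "integrable M (\<lambda>x. x\<^sup>2)" and var: "expectation (\<lambda>x. x\<^sup>2) = v"
  shows "(\<lambda>n. char M (1 / sqrt n) ^ n) \<longlonglongrightarrow> complex_of_real (exp (- v / 2))"
proof -
  have var': "variance (\<lambda>x. x) = v" by (simp add: mean var)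
  have v: "v \<ge> 0" unfolding var[symmetric] by simp
  let ?t = "\<lambda>n::nat. 1 / sqrt (real n)"
  let ?m = "\<lambda>n::nat. \<integral>x. min (6 * x\<^sup>2) (\<bar>?t n\<bar> * \<bar>x\<bar> ^ 3) \<partial>M"
  have bound: "\<forall>\<^sub>F n in sequentially. cmod (char M (?t n) ^ n - (1 + (- v / 2) / n) ^ n) \<le> (1 / 6) * ?m n"
    \<comment> \<open>From \<open>n \<ge> v\<close> the approximating base
      \<open>1 - v / (2 * n)\<close> has modulus at most 1; the summand 1 excludes
      \<open>n = 0\<close>.\<close>
    using eventually_ge_at_top[of "nat \<lceil>v\<rceil> + 1"]
  proof eventually_elim
    case (elim n)
    then have n: "real n \<ge> v" "n > 0" by linarith+
    have sq: "(?t n)\<^sup>2 = 1 / n" using n by (simp add: power_divide)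
    have "cmod (char M (?t n) - (1 - (?t n)\<^sup>2 * v / 2)) \<le> (?t n)\<^sup>2 / 6 * ?m n"
      by (rule char_approx3[OF int mean int2 var'])
    then have step: "cmod (char M (?t n) - (1 + (- v / 2) / n)) \<le> 1 / n / 6 * ?m n"
      by (simp add: sq mult.commute)
    have "cmod (char M (?t n) ^ n - (complex_of_real (1 + (- v / 2) / n)) ^ n)
        \<le> n * cmod (char M (?t n) - complex_of_real (1 + (- v / 2) / n))"
    proof (rule norm_power_diff)
      have "\<bar>1 + (- v / 2) / n\<bar> \<le> 1" using n v by (auto simp: abs_le_iff field_simps)
      then show "cmod (complex_of_real (1 + (- v / 2) / n)) \<le> 1" unfolding norm_of_real .
    qed (rule cmod_char_le_1)
    also have "\<dots> \<le> n * (1 / n / 6 * ?m n)"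
      using step by (intro mult_left_mono) auto
    also have "\<dots> = (1 / 6) * ?m n" using n by simp
    finally show ?case by simp
  qed
  have "(\<lambda>n. min (6 * x\<^sup>2) (\<bar>?t n\<bar> * \<bar>x\<bar> ^ 3)) \<longlonglongrightarrow> 0" for x :: real
  proof -
    have "(\<lambda>n. \<bar>?t n\<bar> * \<bar>x\<bar> ^ 3) \<longlonglongrightarrow> 0"
      by (intro tendsto_mult_left_zero tendsto_rabs_zero real_tendsto_divide_at_top[OF tendsto_const]
          filterlim_compose[OF sqrt_at_top] filterlim_real_sequentially)
    then have "(\<lambda>n. min (6 * x\<^sup>2) (\<bar>?t n\<bar> * \<bar>x\<bar> ^ 3)) \<longlonglongrightarrow> min (6 * x\<^sup>2) 0"
      by (intro tendsto_min tendsto_const)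
    then show ?thesis by simp
  qed
  then have "(\<lambda>n. ?m n) \<longlonglongrightarrow> (\<integral>x. 0 \<partial>M)"
    using int2 by (intro integral_dominated_convergence[where w = "\<lambda>x. 6 * x\<^sup>2"]) auto
  then have "(\<lambda>n. (1 / 6) * ?m n) \<longlonglongrightarrow> 0"
    by (simp only: integral_zero tendsto_mult_right_zero)
  then have "(\<lambda>n. char M (?t n) ^ n - (1 + (- v / 2) / n) ^ n) \<longlonglongrightarrow> 0"
    by (rule Lim_null_comparison[OF bound])
  moreover have "(\<lambda>n. complex_of_real ((1 + (- v / 2) / n) ^ n)) \<longlonglongrightarrow> complex_of_real (exp (- v / 2))"
    by (intro tendsto_of_real tendsto_exp_limit_sequentially)
  ultimately show ?thesis
    using Lim_transform[of "\<lambda>n. complex_of_real ((1 + (- v / 2) / n) ^ n)"] by simp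
qed

section \<open>The incidental parameter model\<close>

lemma pair_prob_space_integral_mult:
  fixes f :: "'a \<Rightarrow> real" and g :: "'b \<Rightarrow> real"
  assumes A: "prob_space A" and B: "prob_space B" and f: "integrable A f" and g: "integrable B g"
  shows "integrable (A \<Otimes>\<^sub>M B) (\<lambda>(x, y). f x * g y)"
    and "(\<integral>z. (case z of (x, y) \<Rightarrow> f x * g y) \<partial>(A \<Otimes>\<^sub>M B)) = (\<integral>x. f x \<partial>A) * (\<integral>y. g y \<partial>B)"
proof -
  interpret A: prob_space A by fact
  interpret B: prob_space B by fact
  interpret pair_sigma_finite A B ..
  note [measurable] = borel_measurable_integrable[OF f] borel_measurable_integrable[OF g]
  show int: "integrable (A \<Otimes>\<^sub>M B) (\<lambda>(x, y). f x * g y)"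
  proof (rule Fubini_integrable)
    show "integrable A (\<lambda>x. \<integral>y. norm (case (x, y) of (x, y) \<Rightarrow> f x * g y) \<partial>B)"
      using f by (simp add: abs_mult)
    show "AE x in A. integrable B (\<lambda>y. case (x, y) of (x, y) \<Rightarrow> f x * g y)"
      using g by simp
  qed measurable
  have "(\<integral>z. (case z of (x, y) \<Rightarrow> f x * g y) \<partial>(A \<Otimes>\<^sub>M B)) = (\<integral>x. (\<integral>y. f x * g y \<partial>B) \<partial>A)"
    using integral_fst'[OF int] by simp
  then show "(\<integral>z. (case z of (x, y) \<Rightarrow> f x * g y) \<partial>(A \<Otimes>\<^sub>M B)) = (\<integral>x. f x \<partial>A) * (\<integral>y. g y \<partial>B)"
    by simp
qed

locale incidental =
  fixes P :: "'b measure" and X0 :: "'b \<Rightarrow> real ^ 'd" and eps0 :: "'b \<Rightarrow> real" and sd :: real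
    and M :: "nat \<Rightarrow> 'a measure"
    and X :: "nat \<Rightarrow> nat \<Rightarrow> 'a \<Rightarrow> real ^ 'd" and eps Y :: "nat \<Rightarrow> nat \<Rightarrow> 'a \<Rightarrow> real"
    and mu :: "nat \<Rightarrow> nat \<Rightarrow> real" and beta :: "real ^ 'd"
    and s1 s2 :: "nat \<Rightarrow> nat" and kappa gamma lam :: "nat \<Rightarrow> real"
    and muhat :: "nat \<Rightarrow> 'a \<Rightarrow> nat \<Rightarrow> real" and betahat betatilde :: "nat \<Rightarrow> 'a \<Rightarrow> real ^ 'd"
  assumes model: "incidental_model P X0 eps0 sd M X eps Y mu beta"
    and A: "assumption_A M X eps kappa gamma"
    and parameters: "incidental_parameters mu s1 s2 kappa gamma"
    and B: "assumption_B mu s1 kappa gamma lam"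
    and muhat_measurable:
      "\<And>n i. i \<in> {1..n} \<Longrightarrow> (\<lambda>w. muhat n w i) \<in> borel_measurable (M n)"
    and minimizer: "\<And>n w. w \<in> space (M n) \<Longrightarrow>
      is_penalized_minimizer n (lam n) (\<lambda>i. X n i w) (\<lambda>i. Y n i w) (muhat n w) (betahat n w)"
    and betatilde: "\<And>n w. w \<in> space (M n) \<Longrightarrow>
      betatilde n w =
        least_squares (\<lambda>i. X n i w) (\<lambda>i. Y n i w) (zero_set n (muhat n w))"
begin

lemma prob_P: "prob_space P"
  and X0_rv [measurable]: "X0 \<in> borel_measurable P" and X0_int: "integrable P X0"
  and X0_mean: "(\<integral>w. X0 w \<partial>P) = 0" and X0_int2: "integrable P (\<lambda>w. (norm (X0 w))\<^sup>2)"
  and cov_pd: "positive_definite (covariance_matrix P X0)"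
  and eps0_rv [measurable]: "eps0 \<in> borel_measurable P" and eps0_int: "integrable P eps0"
  and eps0_mean: "(\<integral>w. eps0 w \<partial>P) = 0" and eps0_int2: "integrable P (\<lambda>w. (eps0 w)\<^sup>2)"
  and eps0_var: "prob_space.variance P eps0 = sd\<^sup>2" and sd_pos: "sd\<^sup>2 > 0"
  using model unfolding incidental_model_def by - (elim conjE, assumption)+

lemma prob_row: "prob_space (M n)"
  and X_indep: "prob_space.indep_vars (M n) (\<lambda>_. borel) (X n) {1..n}"
  and X_distr_all: "\<forall>i\<in>{1..n}. distr (M n) borel (X n i) = distr P borel X0"
  and eps_indep: "prob_space.indep_vars (M n) (\<lambda>_. borel) (eps n) {1..n}"
  and eps_distr_all: "\<forall>i\<in>{1..n}. distr (M n) borel (eps n i) = distr P borel eps0"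
  and X_eps_indep: "independent_elements (M n)
          (PiM {1..n} (\<lambda>_. borel)) (\<lambda>w. \<lambda>i\<in>{1..n}. X n i w)
          (PiM {1..n} (\<lambda>_. borel)) (\<lambda>w. \<lambda>i\<in>{1..n}. eps n i w)"
  and Y_eq_all: "\<forall>w\<in>space (M n). \<forall>i\<in>{1..n}. Y n i w = mu n i + X n i w \<bullet> beta + eps n i w"
  using model unfolding incidental_model_def by - (elim conjE, drule spec[of _ n], elim conjE, assumption)+

sublocale prob_array M
  by (rule prob_array.intro) (rule prob_row)

lemma X_distr: "i \<in> {1..n} \<Longrightarrow> distr (M n) borel (X n i) = distr P borel X0"
  and eps_distr: "i \<in> {1..n} \<Longrightarrow> distr (M n) borel (eps n i) = distr P borel eps0"
  and Y_eq: "w \<in> space (M n) \<Longrightarrow> i \<in> {1..n} \<Longrightarrow> Y n i w = mu n i + X n i w \<bullet> beta + eps n i w"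
  using X_distr_all eps_distr_all Y_eq_all by blast+

lemma X_rv: "i \<in> {1..n} \<Longrightarrow> X n i \<in> borel_measurable (M n)"
  and eps_rv: "i \<in> {1..n} \<Longrightarrow> eps n i \<in> borel_measurable (M n)"
  using X_indep[of n] eps_indep[of n] by (auto simp: indep_vars_def2)

lemma Y_rv: "i \<in> {1..n} \<Longrightarrow> Y n i \<in> borel_measurable (M n)"
proof -
  assume i: "i \<in> {1..n}"
  note [measurable] = X_rv[OF i] eps_rv[OF i]
  have "(\<lambda>w. mu n i + X n i w \<bullet> beta + eps n i w) \<in> borel_measurable (M n)"
    by measurable
  then show ?thesis
    by (subst measurable_cong[OF Y_eq[OF _ i]])
qed

definition X_eps_law :: "((real ^ 'd) \<times> real) measure" where
  "X_eps_law = distr P borel X0 \<Otimes>\<^sub>M distr P borel eps0"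

lemma X_eps_pair:
  shows "indep_vars n (\<lambda>_. borel \<Otimes>\<^sub>M borel) (\<lambda>i w. (X n i w, eps n i w)) {1..n}"
    and "i \<in> {1..n} \<Longrightarrow> distr (M n) (borel \<Otimes>\<^sub>M borel) (\<lambda>w. (X n i w, eps n i w)) = X_eps_law"
  using indep_vars_Pair[OF _ X_indep eps_indep X_eps_indep] distr_Pair[OF _ X_indep eps_indep X_eps_indep]
  by (simp_all add: X_eps_law_def X_distr eps_distr)

lemma X_transfer:
  fixes f :: "real ^ 'd \<Rightarrow> 'c::{banach, second_countable_topology}"
  assumes i: "i \<in> {1..n}" and f[measurable]: "f \<in> borel_measurable borel"
  shows "integrable (M n) (\<lambda>w. f (X n i w)) \<longleftrightarrow> integrable P (\<lambda>w. f (X0 w))"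
    and "(\<integral>w. f (X n i w) \<partial>M n) = (\<integral>w. f (X0 w) \<partial>P)"
proof -
  note [measurable] = X_rv[OF i]
  show "integrable (M n) (\<lambda>w. f (X n i w)) \<longleftrightarrow> integrable P (\<lambda>w. f (X0 w))"
    using integrable_distr_eq[of "X n i" "M n" borel f] integrable_distr_eq[of X0 P borel f] X_distr[OF i] by simp
  show "(\<integral>w. f (X n i w) \<partial>M n) = (\<integral>w. f (X0 w) \<partial>P)"
    using integral_distr[of "X n i" "M n" borel f] integral_distr[of X0 P borel f] X_distr[OF i] by simp
qed

lemma prob_laws: "prob_space (distr P borel X0)" "prob_space (distr P borel eps0)"
  using prob_P by (auto intro: prob_space.prob_space_distr)

lemma
  fixes f :: "real ^ 'd \<Rightarrow> real" and g :: "real \<Rightarrow> real"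
  assumes f: "integrable P (\<lambda>w. f (X0 w))" "f \<in> borel_measurable borel"
    and g: "integrable P (\<lambda>w. g (eps0 w))" "g \<in> borel_measurable borel"
  shows X_eps_law_integrable: "integrable X_eps_law (\<lambda>(x, e). f x * g e)"
    and X_eps_law_integral: "(\<integral>z. (case z of (x, e) \<Rightarrow> f x * g e) \<partial>X_eps_law) = (\<integral>w. f (X0 w) \<partial>P) * (\<integral>w. g (eps0 w) \<partial>P)"
    and X_eps_integrable: "i \<in> {1..n} \<Longrightarrow> integrable (M n) (\<lambda>w. f (X n i w) * g (eps n i w))"
    and X_eps_integral: "i \<in> {1..n} \<Longrightarrow> (\<integral>w. f (X n i w) * g (eps n i w) \<partial>M n) = (\<integral>w. f (X0 w) \<partial>P) * (\<integral>w. g (eps0 w) \<partial>P)"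
proof -
  note [measurable] = f(2) g(2)
  have fi: "integrable (distr P borel X0) f" and gi: "integrable (distr P borel eps0) g"
    using f g by (simp_all add: integrable_distr_eq)
  show int: "integrable X_eps_law (\<lambda>(x, e). f x * g e)"
    unfolding X_eps_law_def by (rule pair_prob_space_integral_mult(1)[OF prob_laws fi gi])
  show eq: "(\<integral>z. (case z of (x, e) \<Rightarrow> f x * g e) \<partial>X_eps_law) = (\<integral>w. f (X0 w) \<partial>P) * (\<integral>w. g (eps0 w) \<partial>P)"
    unfolding X_eps_law_def pair_prob_space_integral_mult(2)[OF prob_laws fi gi] by (simp add: integral_distr)
  assume i: "i \<in> {1..n}"
  note [measurable] = X_rv[OF i] eps_rv[OF i]
  show "integrable (M n) (\<lambda>w. f (X n i w) * g (eps n i w))"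
    using int unfolding X_eps_pair(2)[OF i, symmetric] by (subst (asm) integrable_distr_eq) auto
  show "(\<integral>w. f (X n i w) * g (eps n i w) \<partial>M n) = (\<integral>w. f (X0 w) \<partial>P) * (\<integral>w. g (eps0 w) \<partial>P)"
    unfolding eq[symmetric] X_eps_pair(2)[OF i, symmetric] by (subst integral_distr) auto
qed

section \<open>Second moments of weighted sums of the covariates\<close>

definition m2 :: real where "m2 = (\<integral>w. (norm (X0 w))\<^sup>2 \<partial>P)"

lemma m2_nonneg: "0 \<le> m2"
  by (simp add: m2_def)

lemma eps0_second_moment: "(\<integral>w. (eps0 w)\<^sup>2 \<partial>P) = sd\<^sup>2"
  using eps0_var by (simp add: eps0_mean)

text \<open>Applied with the weights \<open>mu n i\<close> for the signal and
  \<open>sgn (mu n i)\<close> for the sign vector.\<close>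

lemma
  fixes a :: "nat \<Rightarrow> real"
  assumes J: "J \<subseteq> {1..n}"
  shows weighted_X_sum_rv: "(\<lambda>w. \<Sum>i\<in>J. a i *\<^sub>R X n i w) \<in> borel_measurable (M n)"
    and weighted_X_sum_integrable: "integrable (M n) (\<lambda>w. (norm (\<Sum>i\<in>J. a i *\<^sub>R X n i w))\<^sup>2)"
    and weighted_X_sum_moment: "(\<integral>w. (norm (\<Sum>i\<in>J. a i *\<^sub>R X n i w))\<^sup>2 \<partial>M n) = (\<Sum>i\<in>J. (a i)\<^sup>2) * m2"
proof -
  have fin: "finite J" using J finite_subset by blast
  have iJ: "i \<in> {1..n}" if "i \<in> J" for i using that J by blast
  show "(\<lambda>w. \<Sum>i\<in>J. a i *\<^sub>R X n i w) \<in> borel_measurable (M n)"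
    by (intro borel_measurable_sum borel_measurable_scaleR borel_measurable_const X_rv iJ)
  have ind: "indep_vars n (\<lambda>_. borel) (\<lambda>i w. a i *\<^sub>R X n i w) J"
    using indep_vars_compose2[OF indep_vars_subset[OF X_indep J], of "\<lambda>i x. a i *\<^sub>R x" "\<lambda>_. borel"] by simp
  have int: "integrable (M n) (\<lambda>w. (norm (a i *\<^sub>R X n i w))\<^sup>2)" if i: "i \<in> J" for i
    using X_transfer(1)[OF iJ[OF i], of "\<lambda>x. (norm (a i *\<^sub>R x))\<^sup>2"] X0_int2 by (simp add: power_mult_distrib)
  have mean: "(\<integral>w. a i *\<^sub>R X n i w \<partial>M n) = 0" if i: "i \<in> J" for i
    using X_transfer(2)[OF iJ[OF i], of "\<lambda>x. a i *\<^sub>R x"] X0_mean by simp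
  have mom: "(\<integral>w. (norm (a i *\<^sub>R X n i w))\<^sup>2 \<partial>M n) = (a i)\<^sup>2 * m2" if i: "i \<in> J" for i
    using X_transfer(2)[OF iJ[OF i], of "\<lambda>x. (norm (a i *\<^sub>R x))\<^sup>2"] by (simp add: power_mult_distrib m2_def)
  show "integrable (M n) (\<lambda>w. (norm (\<Sum>i\<in>J. a i *\<^sub>R X n i w))\<^sup>2)"
    by (rule integrable_norm_sum_square[OF fin ind int mean])
  have "(\<integral>w. (norm (\<Sum>i\<in>J. a i *\<^sub>R X n i w))\<^sup>2 \<partial>M n) = (\<Sum>i\<in>J. \<integral>w. (norm (a i *\<^sub>R X n i w))\<^sup>2 \<partial>M n)"
    by (rule expectation_norm_sum_square[OF fin ind int mean])
  also have "\<dots> = (\<Sum>i\<in>J. (a i)\<^sup>2 * m2)"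
    by (rule sum.cong[OF refl mom])
  finally show "(\<integral>w. (norm (\<Sum>i\<in>J. a i *\<^sub>R X n i w))\<^sup>2 \<partial>M n) = (\<Sum>i\<in>J. (a i)\<^sup>2) * m2"
    by (simp add: sum_distrib_right)
qed

definition noise :: "nat \<Rightarrow> nat set \<Rightarrow> 'a \<Rightarrow> real ^ 'd" where
  "noise n J w = (\<Sum>i\<in>J. eps n i w *\<^sub>R X n i w)"

text \<open>Independence of covariates and errors factorizes the moments of each summand: the second
  moment into \<open>m2\<close> and \<open>sd\<^sup>2\<close>, the first into a product with the
  mean 0 of the error.\<close>

lemma
  assumes J: "J \<subseteq> {1..n}"
  shows noise_rv: "noise n J \<in> borel_measurable (M n)"
    and noise_integrable: "integrable (M n) (\<lambda>w. (norm (noise n J w))\<^sup>2)"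
    and noise_moment: "(\<integral>w. (norm (noise n J w))\<^sup>2 \<partial>M n) = real (card J) * (sd\<^sup>2 * m2)"
proof -
  have fin: "finite J" using J finite_subset by blast
  have iJ: "i \<in> {1..n}" if "i \<in> J" for i using that J by blast
  have rv: "(\<lambda>w. eps n i w *\<^sub>R X n i w) \<in> borel_measurable (M n)" if "i \<in> J" for i
    using X_rv[OF iJ[OF that]] eps_rv[OF iJ[OF that]] by measurable
  show "noise n J \<in> borel_measurable (M n)"
    unfolding noise_def[abs_def] by (intro borel_measurable_sum rv)
  have ind: "indep_vars n (\<lambda>_. borel) (\<lambda>i w. eps n i w *\<^sub>R X n i w) J"
    using indep_vars_compose2[OF indep_vars_subset[OF X_eps_pair(1) J], of "\<lambda>_ (x, e). e *\<^sub>R x" "\<lambda>_. borel"] by simp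
  have sq: "(norm (eps n i w *\<^sub>R X n i w))\<^sup>2 = (norm (X n i w))\<^sup>2 * (eps n i w)\<^sup>2" for i w
    by (simp add: power_mult_distrib)
  have int: "integrable (M n) (\<lambda>w. (norm (eps n i w *\<^sub>R X n i w))\<^sup>2)" if i: "i \<in> J" for i
    unfolding sq by (rule X_eps_integrable[OF X0_int2 _ eps0_int2 _ iJ[OF i]]) auto
  have mom: "(\<integral>w. (norm (eps n i w *\<^sub>R X n i w))\<^sup>2 \<partial>M n) = sd\<^sup>2 * m2" if i: "i \<in> J" for i
    unfolding sq using X_eps_integral[OF X0_int2 _ eps0_int2 _ iJ[OF i]]
    by (simp add: m2_def eps0_second_moment mult.commute)
  have mean: "(\<integral>w. eps n i w *\<^sub>R X n i w \<partial>M n) = 0" if i: "i \<in> J" for i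
  proof -
    have "integrable (M n) (\<lambda>w. norm (eps n i w *\<^sub>R X n i w))"
      by (rule square_integrable_imp_integrable[OF measurable_compose[OF rv[OF i] borel_measurable_norm] int[OF i]])
    then have Zint: "integrable (M n) (\<lambda>w. eps n i w *\<^sub>R X n i w)"
      by (rule iffD1[OF integrable_norm_iff[OF rv[OF i]]])
    \<comment> \<open>The product rule for expectations is available for real functions, so the
      vector mean is tested against every direction and finally against itself.\<close>
    have "(\<integral>w. eps n i w *\<^sub>R X n i w \<partial>M n) \<bullet> b = 0" for b
    proof -
      have "(\<integral>w. eps n i w *\<^sub>R X n i w \<partial>M n) \<bullet> b = (\<integral>w. (X n i w \<bullet> b) * eps n i w \<partial>M n)"
        using Zint by (subst integral_inner_left[symmetric]) (auto simp: mult.commute)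
      also have "\<dots> = (\<integral>w. X0 w \<bullet> b \<partial>P) * (\<integral>w. eps0 w \<partial>P)"
        by (rule X_eps_integral[OF _ _ eps0_int _ iJ[OF i]]) (use X0_int in auto)
      finally show ?thesis by (simp add: eps0_mean)
    qed
    from this[of "\<integral>w. eps n i w *\<^sub>R X n i w \<partial>M n"] show ?thesis by simp
  qed
  show "integrable (M n) (\<lambda>w. (norm (noise n J w))\<^sup>2)"
    unfolding noise_def by (rule integrable_norm_sum_square[OF fin ind int mean])
  have "(\<integral>w. (norm (noise n J w))\<^sup>2 \<partial>M n) = (\<Sum>i\<in>J. \<integral>w. (norm (eps n i w *\<^sub>R X n i w))\<^sup>2 \<partial>M n)"
    unfolding noise_def by (rule expectation_norm_sum_square[OF fin ind int mean])
  also have "\<dots> = (\<Sum>i\<in>J. sd\<^sup>2 * m2)"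
    by (rule sum.cong[OF refl mom])
  finally show "(\<integral>w. (norm (noise n J w))\<^sup>2 \<partial>M n) = real (card J) * (sd\<^sup>2 * m2)"
    by simp
qed

section \<open>Quantitative consequences of the assumptions on the parameters\<close>

lemma s_le: "s1 n + s2 n \<le> n"
  using parameters by (simp add: incidental_parameters_def)

lemma s_tendsto: "(\<lambda>n. real (s1 n + s2 n) / real n) \<longlonglongrightarrow> 0"
  using parameters unfolding incidental_parameters_def by (blast dest: smalloD_tendsto)

lemma s1_tendsto: "(\<lambda>n. real (s1 n) / real n) \<longlonglongrightarrow> 0"
  by (rule tendsto_sandwich[OF _ _ tendsto_const s_tendsto]) (auto intro!: divide_right_mono always_eventually)

lemma s2_tendsto: "(\<lambda>n. real (s2 n) / real n) \<longlonglongrightarrow> 0"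
  by (rule tendsto_sandwich[OF _ _ tendsto_const s_tendsto]) (auto intro!: divide_right_mono always_eventually)

lemma kappa_pos: "kappa n > 0" and gamma_pos: "gamma n > 0"
  and gamma_o: "gamma \<in> o(\<lambda>n. sqrt (real n))"
  and kappa_max: "(\<lambda>n. prob n {w \<in> space (M n). (MAX i\<in>{1..n}. norm (X n i w)) > kappa n}) \<longlonglongrightarrow> 0"
  and gamma_max: "(\<lambda>n. prob n {w \<in> space (M n). (MAX i\<in>{1..n}. \<bar>eps n i w\<bar>) > gamma n}) \<longlonglongrightarrow> 0"
  using A by (simp_all add: assumption_A_def)

lemma gamma_tendsto: "(\<lambda>n. gamma n / sqrt (real n)) \<longlonglongrightarrow> 0"
  using gamma_o by (rule smalloD_tendsto)

lemma mu_le_gamma: "i \<in> {s1 n + 1..n} \<Longrightarrow> \<bar>mu n i\<bar> \<le> gamma n"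
proof -
  assume i: "i \<in> {s1 n + 1..n}"
  show ?thesis
  proof (cases "i \<le> s1 n + s2 n")
    case True
    then show ?thesis
      using parameters i by (simp add: incidental_parameters_def)
  next
    case False
    then have "mu n i = 0"
      using parameters i by (simp add: incidental_parameters_def)
    then show ?thesis using gamma_pos[of n] by simp
  qed
qed

lemma mu_zero: "i \<in> {s1 n + s2 n + 1..n} \<Longrightarrow> mu n i = 0"
  using parameters by (simp add: incidental_parameters_def)

lemma lam_pos: "lam n > 0"
  using B by (simp add: assumption_B_def)

text \<open>Splits the comparison with the minimum into one with the square root and one with every
  large parameter; the second part is vacuous when \<open>s1 n = 0\<close>.\<close>

lemma lam_le: "c > 0 \<Longrightarrow> \<forall>\<^sub>F n in sequentially. lam n \<le> c * sqrt n \<and> (\<forall>i\<in>{1..s1 n}. lam n \<le> c * \<bar>mu n i\<bar>)"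
proof -
  assume c: "c > 0"
  let ?m = "\<lambda>n. Min (insert (sqrt (real n)) ((\<lambda>i. \<bar>mu n i\<bar>) ` {1..s1 n}))"
  have "lam \<in> o(?m)" using B by (simp add: assumption_B_def)
  from landau_o.smallD[OF this c] show ?thesis
  proof eventually_elim
    case (elim n)
    have m: "0 \<le> ?m n" by (subst Min_ge_iff) auto
    then have l: "lam n \<le> c * ?m n" using elim by simp
    have "c * ?m n \<le> c * x" if "x \<in> insert (sqrt (real n)) ((\<lambda>i. \<bar>mu n i\<bar>) ` {1..s1 n})" for x
      using that c by (intro mult_left_mono Min_le) auto
    then show ?case using l by (meson image_eqI insertI1 insertI2 order_trans)
  qed
qed

lemma lam_tendsto: "(\<lambda>n. lam n / sqrt (real n)) \<longlonglongrightarrow> 0"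
proof (rule tendstoI)
  fix e :: real assume e: "e > 0"
  have "\<forall>\<^sub>F n in sequentially. lam n \<le> e / 2 * sqrt n \<and> (\<forall>i\<in>{1..s1 n}. lam n \<le> e / 2 * \<bar>mu n i\<bar>)"
    using e by (intro lam_le) simp
  with eventually_gt_at_top[of 0]
  show "\<forall>\<^sub>F n in sequentially. dist (lam n / sqrt (real n)) 0 < e"
  proof eventually_elim
    case (elim n)
    have "lam n / sqrt n \<le> e / 2" using elim by (simp add: divide_le_eq)
    then have "lam n / sqrt n < e" using e by linarith
    then show ?case using lam_pos[of n] by (simp add: dist_real_def)
  qed
qed

text \<open>Each of \<open>lam n\<close>, \<open>gamma n\<close> and \<open>kappa n\<close> is
  eventually at most a quarter of every large parameter. For the second inequality
  \<open>2 * gamma n\<close> takes at most the share \<open>2 / alpha\<close> of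
  \<open>lam n\<close>, and \<open>kappa n\<close> at most half of what is left.\<close>

lemma eventually_separated:
  "\<forall>\<^sub>F n in sequentially. (\<forall>i\<in>{1..s1 n}. lam n + gamma n + kappa n < \<bar>mu n i\<bar>) \<and> 2 * gamma n + kappa n < lam n"
proof -
  obtain alpha where alpha: "alpha > 2" "\<And>n. alpha * gamma n \<le> lam n"
    using B by (auto simp: assumption_B_def)
  have "kappa \<in> o(lam)" using B by (simp add: assumption_B_def)
  moreover have "(1 - 2 / alpha) / 2 > 0" using alpha by simp
  ultimately have "\<forall>\<^sub>F n in sequentially. norm (kappa n) \<le> (1 - 2 / alpha) / 2 * norm (lam n)"
    by (rule landau_o.smallD)
  moreover have "\<forall>\<^sub>F n in sequentially. \<forall>i\<in>{1..s1 n}. max (kappa n) (gamma n) \<le> 1 / 4 * \<bar>mu n i\<bar>"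
  proof -
    have "\<forall>c>0. \<forall>\<^sub>F n in sequentially. \<forall>i\<in>{1..s1 n}. max (kappa n) (gamma n) \<le> c * \<bar>mu n i\<bar>"
      using parameters unfolding incidental_parameters_def by blast
    then show ?thesis by (rule allE[of _ "1 / 4"]) simp
  qed
  moreover have "\<forall>\<^sub>F n in sequentially. lam n \<le> 1 / 4 * sqrt n \<and> (\<forall>i\<in>{1..s1 n}. lam n \<le> 1 / 4 * \<bar>mu n i\<bar>)"
    by (rule lam_le) simp
  ultimately show ?thesis
  proof eventually_elim
    case (elim n)
    have l: "lam n > 0" by (rule lam_pos)
    have "lam n + gamma n + kappa n < \<bar>mu n i\<bar>" if i: "i \<in> {1..s1 n}" for i
    proof -
      have "kappa n \<le> 1 / 4 * \<bar>mu n i\<bar>" "gamma n \<le> 1 / 4 * \<bar>mu n i\<bar>" "lam n \<le> 1 / 4 * \<bar>mu n i\<bar>"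
        using bspec[OF elim(2) i] bspec[OF conjunct2[OF elim(3)] i] by simp_all
      then show ?thesis using l by linarith
    qed
    moreover have "2 * gamma n + kappa n < lam n"
    proof -
      have "gamma n \<le> lam n / alpha" using alpha(2)[of n] alpha(1) by (simp add: le_divide_eq mult.commute)
      moreover have "kappa n \<le> (1 - 2 / alpha) / 2 * lam n"
        using elim(1) kappa_pos[of n] l by simp
      moreover have "2 * (lam n / alpha) + (1 - 2 / alpha) / 2 * lam n < lam n"
      proof -
        have "2 * (lam n / alpha) + (1 - 2 / alpha) / 2 * lam n = lam n * (1 / 2 + 1 / alpha)"
          using alpha(1) by (simp add: field_simps)
        also have "\<dots> < lam n * 1"
          using alpha(1) l by (intro mult_strict_left_mono) (auto simp: field_simps)
        finally show ?thesis by simp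
      qed
      ultimately show ?thesis by linarith
    qed
    ultimately show ?case by blast
  qed
qed

end

text \<open>The entrywise sum is a crude bound for the operator norm, suited to a law of large
  numbers that is applied entry by entry.\<close>

lemma norm_matrix_vector_mult_le:
  fixes A :: "real ^ 'n ^ 'm"
  shows "norm (A *v x) \<le> (\<Sum>i\<in>UNIV. \<Sum>j\<in>UNIV. \<bar>A $ i $ j\<bar>) * norm x"
proof -
  have "norm (A *v x) \<le> (\<Sum>i\<in>UNIV. \<bar>(A *v x) $ i\<bar>)"
    by (rule norm_le_l1_cart)
  also have "\<dots> \<le> (\<Sum>i\<in>UNIV. (\<Sum>j\<in>UNIV. \<bar>A $ i $ j\<bar>) * norm x)"
  proof (rule sum_mono)
    fix i
    have "\<bar>(A *v x) $ i\<bar> \<le> (\<Sum>j\<in>UNIV. \<bar>A $ i $ j * x $ j\<bar>)"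
      unfolding matrix_vector_mult_def by simp
    also have "\<dots> \<le> (\<Sum>j\<in>UNIV. \<bar>A $ i $ j\<bar> * norm x)"
      unfolding abs_mult by (intro sum_mono mult_left_mono component_le_norm_cart) simp
    finally show "\<bar>(A *v x) $ i\<bar> \<le> (\<Sum>j\<in>UNIV. \<bar>A $ i $ j\<bar>) * norm x"
      by (simp add: sum_distrib_right)
  qed
  finally show ?thesis
    by (simp add: sum_distrib_right)
qed

text \<open>The constant is the minimum of the quadratic form on the compact unit sphere, extended
  by homogeneity.\<close>

lemma positive_definite_coercive:
  fixes S :: "real ^ 'n ^ 'n"
  assumes S: "positive_definite S"
  obtains c where "c > 0" "\<And>v. c * (norm v)\<^sup>2 \<le> v \<bullet> (S *v v)"
proof -
  have "continuous_on (sphere 0 1) ((*v) S)"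
    by (rule linear_continuous_on, rule linear_conv_bounded_linear[THEN iffD1], rule matrix_vector_mul_linear)
  then have "continuous_on (sphere 0 1) (\<lambda>v. v \<bullet> (S *v v))"
    by (intro continuous_on_inner continuous_on_id)
  moreover have "(sphere 0 1 :: (real ^ 'n) set) \<noteq> {}"
    by simp
  ultimately have "\<exists>u\<in>sphere 0 1. \<forall>v\<in>sphere 0 1. u \<bullet> (S *v u) \<le> v \<bullet> (S *v v)"
    by (intro continuous_attains_inf compact_sphere)
  then obtain u where u: "u \<in> sphere 0 1" "\<And>v. v \<in> sphere 0 1 \<Longrightarrow> u \<bullet> (S *v u) \<le> v \<bullet> (S *v v)"
    by blast
  show thesis
  proof (rule that)
    have "u \<noteq> 0" using u(1) by auto
    then show "u \<bullet> (S *v u) > 0" using S by (simp add: positive_definite_def)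
    show "u \<bullet> (S *v u) * (norm v)\<^sup>2 \<le> v \<bullet> (S *v v)" for v
    proof (cases "v = 0")
      case False
      then have "(1 / norm v) *\<^sub>R v \<in> sphere 0 1" by simp
      from u(2)[OF this] have "u \<bullet> (S *v u) \<le> (v \<bullet> (S *v v)) / (norm v)\<^sup>2"
        by (simp add: matrix_vector_mult_scaleR power2_eq_square)
      then show ?thesis using False by (simp add: pos_le_divide_eq)
    qed simp
  qed
qed

lemma borel_measurable_vec_component [measurable (raw)]:
  fixes f :: "'a \<Rightarrow> real ^ 'n"
  assumes "f \<in> borel_measurable M"
  shows "(\<lambda>x. f x $ i) \<in> borel_measurable M"
  by (rule measurable_compose[OF assms]) (intro borel_measurable_continuous_onI continuous_intros)

context prob_array
begin

lemma vanishes_scaled_L2: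
  fixes V :: "nat \<Rightarrow> 'a \<Rightarrow> 'b::{real_normed_vector, second_countable_topology}" and c :: "nat \<Rightarrow> real"
  assumes rv: "\<And>n. V n \<in> borel_measurable (M n)"
    and int: "\<And>n. integrable (M n) (\<lambda>w. (norm (V n w))\<^sup>2)"
    and le: "\<And>n. (c n)\<^sup>2 * (\<integral>w. (norm (V n w))\<^sup>2 \<partial>M n) \<le> b n" and b: "b \<longlonglongrightarrow> 0"
  shows "vanishes (\<lambda>n w. c n *\<^sub>R V n w)"
proof (rule vanishes_L2)
  show "(\<lambda>w. c n *\<^sub>R V n w) \<in> borel_measurable (M n)" for n
    using rv by simp
  show "integrable (M n) (\<lambda>w. (norm (c n *\<^sub>R V n w))\<^sup>2)" for n
    using int by (simp add: power_mult_distrib)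
  have "(\<integral>w. (norm (c n *\<^sub>R V n w))\<^sup>2 \<partial>M n) = (c n)\<^sup>2 * (\<integral>w. (norm (V n w))\<^sup>2 \<partial>M n)" for n
    by (simp add: power_mult_distrib)
  then show "(\<lambda>n. \<integral>w. (norm (c n *\<^sub>R V n w))\<^sup>2 \<partial>M n) \<longlonglongrightarrow> 0"
    by (intro tendsto_sandwich[OF _ _ tendsto_const b]) (auto simp: le intro!: always_eventually)
qed

lemma vanishes_const:
  fixes c :: "nat \<Rightarrow> real"
  assumes "c \<longlonglongrightarrow> 0"
  shows "vanishes (\<lambda>n _. c n)"
  by (rule vanishes_L1) (use tendsto_rabs_zero[OF assms] in \<open>auto simp: prob_space\<close>)

end

section \<open>The random sums that enter the normal equations\<close>

context incidental
begin

abbreviation Sigma_X :: "real ^ 'd ^ 'd" where "Sigma_X \<equiv> covariance_matrix P X0"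

text \<open>The range goes up to \<open>n\<close>, although the summands beyond
  \<open>s1 n + s2 n\<close> vanish, to match the rows that the second step retains.\<close>

definition signal :: "nat \<Rightarrow> 'a \<Rightarrow> real ^ 'd" where
  "signal n w = (\<Sum>i=s1 n+1..n. mu n i *\<^sub>R X n i w)"

definition signs :: "nat \<Rightarrow> 'a \<Rightarrow> real ^ 'd" where
  "signs n w = (\<Sum>i=1..s1 n. sgn (mu n i) *\<^sub>R X n i w)"

abbreviation gram :: "nat \<Rightarrow> 'a \<Rightarrow> real ^ 'd ^ 'd" where
  "gram n w \<equiv> gram_matrix (\<lambda>i. X n i w) {s1 n+1..n}"

definition gram_error :: "nat \<Rightarrow> 'a \<Rightarrow> real" where
  "gram_error n w = (\<Sum>a\<in>UNIV. \<Sum>b\<in>UNIV. \<bar>gram n w $ a $ b / n - Sigma_X $ a $ b\<bar>)"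

lemma s1_subset: "{1..s1 n} \<subseteq> {1..n}" and tail_subset: "{s1 n+1..n} \<subseteq> {1..n}"
  using s_le[of n] by auto

lemma signal_rv: "signal n \<in> borel_measurable (M n)"
  and signs_rv: "signs n \<in> borel_measurable (M n)"
  unfolding signal_def[abs_def] signs_def[abs_def]
  by (rule weighted_X_sum_rv[OF tail_subset] weighted_X_sum_rv[OF s1_subset])+

lemma sum_mu_square: "(\<Sum>i=s1 n+1..n. (mu n i)\<^sup>2) = (D_norm mu s1 s2 n)\<^sup>2"
proof -
  have "(\<Sum>i=s1 n+1..n. (mu n i)\<^sup>2) = (\<Sum>i=s1 n+1..s1 n+s2 n. (mu n i)\<^sup>2)"
    using s_le[of n] mu_zero[of _ n] by (intro sum.mono_neutral_right) auto
  then show ?thesis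
    by (simp add: D_norm_def L2_set_def sum_nonneg)
qed

lemma D_norm_le: "(D_norm mu s1 s2 n)\<^sup>2 \<le> real (s2 n) * (gamma n)\<^sup>2"
proof -
  have "(D_norm mu s1 s2 n)\<^sup>2 = (\<Sum>i=s1 n+1..s1 n+s2 n. (mu n i)\<^sup>2)"
    by (simp add: D_norm_def L2_set_def sum_nonneg)
  also have "\<dots> \<le> (\<Sum>i=s1 n+1..s1 n+s2 n. (gamma n)\<^sup>2)"
  proof (rule sum_mono)
    fix i assume "i \<in> {s1 n+1..s1 n+s2 n}"
    then have "\<bar>mu n i\<bar> \<le> gamma n"
      using s_le[of n] by (intro mu_le_gamma) auto
    then show "(mu n i)\<^sup>2 \<le> (gamma n)\<^sup>2"
      by (metis abs_ge_zero power2_abs power_mono)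
  qed
  finally show ?thesis by simp
qed

lemma signal_moment: "(\<integral>w. (norm (signal n w))\<^sup>2 \<partial>M n) = (D_norm mu s1 s2 n)\<^sup>2 * m2"
  unfolding signal_def weighted_X_sum_moment[OF tail_subset] sum_mu_square ..

lemma signal_integrable: "integrable (M n) (\<lambda>w. (norm (signal n w))\<^sup>2)"
  unfolding signal_def by (rule weighted_X_sum_integrable[OF tail_subset])

text \<open>The second moment is at most \<open>m2\<close> times the product of
  \<open>s2 n / n\<close> and the square of \<open>gamma n / sqrt n\<close>, both of which tend to
  0.\<close>

lemma signal_mean_vanishes: "vanishes (\<lambda>n w. (1 / n) *\<^sub>R signal n w)"
proof (rule vanishes_scaled_L2[OF signal_rv signal_integrable])
  fix n
  have "(1 / real n)\<^sup>2 * ((D_norm mu s1 s2 n)\<^sup>2 * m2) \<le> (1 / real n)\<^sup>2 * ((real (s2 n) * (gamma n)\<^sup>2) * m2)"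
    by (intro mult_left_mono mult_right_mono D_norm_le m2_nonneg) simp
  also have "\<dots> = real (s2 n) / real n * (gamma n / sqrt (real n))\<^sup>2 * m2"
    by (simp add: power_divide power2_eq_square)
  finally show "(1 / real n)\<^sup>2 * (\<integral>w. (norm (signal n w))\<^sup>2 \<partial>M n) \<le> real (s2 n) / real n * (gamma n / sqrt (real n))\<^sup>2 * m2"
    by (simp only: signal_moment)
next
  have "(\<lambda>n. real (s2 n) / real n * (gamma n / sqrt (real n))\<^sup>2 * m2) \<longlonglongrightarrow> 0 * 0\<^sup>2 * m2"
    by (intro tendsto_intros s2_tendsto gamma_tendsto)
  then show "(\<lambda>n. real (s2 n) / real n * (gamma n / sqrt (real n))\<^sup>2 * m2) \<longlonglongrightarrow> 0" by simp
qed

lemma noise_mean_vanishes: "vanishes (\<lambda>n w. (1 / n) *\<^sub>R noise n {s1 n+1..n} w)"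
proof (rule vanishes_scaled_L2[OF noise_rv[OF tail_subset] noise_integrable[OF tail_subset]])
  fix n
  have "(1 / real n)\<^sup>2 * (real (card {s1 n+1..n}) * (sd\<^sup>2 * m2)) \<le> (1 / real n)\<^sup>2 * (real n * (sd\<^sup>2 * m2))"
    by (intro mult_left_mono mult_right_mono) (auto simp: m2_nonneg)
  also have "\<dots> = 1 / real n * (sd\<^sup>2 * m2)"
    by (simp add: power2_eq_square)
  finally show "(1 / real n)\<^sup>2 * (\<integral>w. (norm (noise n {s1 n+1..n} w))\<^sup>2 \<partial>M n) \<le> 1 / real n * (sd\<^sup>2 * m2)"
    by (simp only: noise_moment[OF tail_subset])
next
  show "(\<lambda>n. 1 / real n * (sd\<^sup>2 * m2)) \<longlonglongrightarrow> 0"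
    by (intro tendsto_mult_left_zero lim_1_over_n)
qed

text \<open>At most \<open>s1 n\<close> weights are nonzero and all have modulus at most 1, so the
  second moment is at most \<open>m2\<close> times the product of \<open>s1 n / n\<close> and the
  square of \<open>lam n / sqrt n\<close>.\<close>

lemma signs_mean_vanishes: "vanishes (\<lambda>n w. (lam n / n) *\<^sub>R signs n w)"
proof (rule vanishes_scaled_L2[OF signs_rv])
  show "integrable (M n) (\<lambda>w. (norm (signs n w))\<^sup>2)" for n
    unfolding signs_def by (rule weighted_X_sum_integrable[OF s1_subset])
  fix n
  have "(\<Sum>i=1..s1 n. (sgn (mu n i))\<^sup>2) \<le> (\<Sum>i=1..s1 n. 1)"
    by (intro sum_mono) (simp add: sgn_if)
  then have "(lam n / real n)\<^sup>2 * ((\<Sum>i=1..s1 n. (sgn (mu n i))\<^sup>2) * m2) \<le> (lam n / real n)\<^sup>2 * (real (s1 n) * m2)"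
    by (intro mult_left_mono mult_right_mono) (auto simp: m2_nonneg)
  also have "\<dots> = real (s1 n) / real n * (lam n / sqrt (real n))\<^sup>2 * m2"
    by (simp add: power_divide power2_eq_square)
  finally show "(lam n / real n)\<^sup>2 * (\<integral>w. (norm (signs n w))\<^sup>2 \<partial>M n) \<le> real (s1 n) / real n * (lam n / sqrt (real n))\<^sup>2 * m2"
    unfolding signs_def weighted_X_sum_moment[OF s1_subset] .
next
  have "(\<lambda>n. real (s1 n) / real n * (lam n / sqrt (real n))\<^sup>2 * m2) \<longlonglongrightarrow> 0 * 0\<^sup>2 * m2"
    by (intro tendsto_intros s1_tendsto lam_tendsto)
  then show "(\<lambda>n. real (s1 n) / real n * (lam n / sqrt (real n))\<^sup>2 * m2) \<longlonglongrightarrow> 0" by simp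
qed

text \<open>Allows the noise of the retained rows to be replaced by that of all \<open>n\<close>
  rows, whose characteristic function is an exact \<open>n\<close>-th power.\<close>

lemma head_noise_vanishes: "vanishes (\<lambda>n w. (1 / sqrt n) *\<^sub>R noise n {1..s1 n} w)"
proof (rule vanishes_scaled_L2[OF noise_rv[OF s1_subset] noise_integrable[OF s1_subset]])
  show "(1 / sqrt (real n))\<^sup>2 * (\<integral>w. (norm (noise n {1..s1 n} w))\<^sup>2 \<partial>M n) \<le> real (s1 n) / real n * (sd\<^sup>2 * m2)" for n
    unfolding noise_moment[OF s1_subset] by (simp add: power_divide)
  show "(\<lambda>n. real (s1 n) / real n * (sd\<^sup>2 * m2)) \<longlonglongrightarrow> 0"
    by (intro tendsto_mult_left_zero s1_tendsto)
qed

lemma noise_bounded: "tight_seq (\<lambda>n w. (1 / sqrt n) *\<^sub>R noise n {1..n} w)"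
proof (rule tight_seq_L2)
  show "(\<lambda>w. (1 / sqrt n) *\<^sub>R noise n {1..n} w) \<in> borel_measurable (M n)" for n
    using noise_rv[of "{1..n}" n] by simp
  show "integrable (M n) (\<lambda>w. (norm ((1 / sqrt n) *\<^sub>R noise n {1..n} w))\<^sup>2)" for n
    using noise_integrable[of "{1..n}" n] by (simp add: power_divide)
  show "(\<integral>w. (norm ((1 / sqrt n) *\<^sub>R noise n {1..n} w))\<^sup>2 \<partial>M n) \<le> sd\<^sup>2 * m2" for n
    using noise_moment[of "{1..n}" n] m2_nonneg by (simp add: power_divide)
qed

definition bad_X :: "nat \<Rightarrow> 'a set" where
  "bad_X n = {w \<in> space (M n). (MAX i\<in>{1..n}. norm (X n i w)) > kappa n}"

definition bad_eps :: "nat \<Rightarrow> 'a set" where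
  "bad_eps n = {w \<in> space (M n). (MAX i\<in>{1..n}. \<bar>eps n i w\<bar>) > gamma n}"

lemma bad_sets: "bad_X n \<in> sets (M n)" "bad_eps n \<in> sets (M n)"
proof -
  have [measurable]: "(\<lambda>w. MAX i\<in>{1..n}. norm (X n i w)) \<in> borel_measurable (M n)"
    using measurable_compose[OF X_rv borel_measurable_norm] by (intro borel_measurable_Max) auto
  show "bad_X n \<in> sets (M n)" unfolding bad_X_def by measurable
  have [measurable]: "(\<lambda>w. MAX i\<in>{1..n}. \<bar>eps n i w\<bar>) \<in> borel_measurable (M n)"
    using eps_rv by (intro borel_measurable_Max borel_measurable_abs) auto
  show "bad_eps n \<in> sets (M n)" unfolding bad_eps_def by measurable
qed

lemma X_le_kappa:
  assumes "w \<in> space (M n) - bad_X n" "i \<in> {1..n}"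
  shows "norm (X n i w) \<le> kappa n"
proof -
  have "norm (X n i w) \<le> (MAX i\<in>{1..n}. norm (X n i w))"
    using assms(2) by (intro Max_ge) auto
  also have "\<dots> \<le> kappa n"
    using assms(1) by (simp add: bad_X_def not_less)
  finally show ?thesis .
qed

lemma eps_le_gamma:
  assumes "w \<in> space (M n) - bad_eps n" "i \<in> {1..n}"
  shows "\<bar>eps n i w\<bar> \<le> gamma n"
proof -
  have "\<bar>eps n i w\<bar> \<le> (MAX i\<in>{1..n}. \<bar>eps n i w\<bar>)"
    using assms(2) by (intro Max_ge) auto
  also have "\<dots> \<le> gamma n"
    using assms(1) by (simp add: bad_eps_def not_less)
  finally show ?thesis .
qed

lemma scaled_signal_vanishes_L2:
  assumes "(\<lambda>n. (D_norm mu s1 s2 n)\<^sup>2 / real n) \<in> o(\<lambda>_. 1)"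
  shows "vanishes (\<lambda>n w. (1 / sqrt n) *\<^sub>R signal n w)"
proof (rule vanishes_scaled_L2[OF signal_rv signal_integrable])
  show "(1 / sqrt (real n))\<^sup>2 * (\<integral>w. (norm (signal n w))\<^sup>2 \<partial>M n) \<le> (D_norm mu s1 s2 n)\<^sup>2 / real n * m2" for n
    unfolding signal_moment by (simp add: power_divide)
  have "(\<lambda>n. (D_norm mu s1 s2 n)\<^sup>2 / real n) \<longlonglongrightarrow> 0"
    using smalloD_tendsto[OF assms] by simp
  then show "(\<lambda>n. (D_norm mu s1 s2 n)\<^sup>2 / real n * m2) \<longlonglongrightarrow> 0"
    by (rule tendsto_mult_left_zero)
qed

text \<open>Off \<open>bad_X n\<close> each of the \<open>s2 n\<close> possibly nonzero summands has
  norm at most \<open>gamma n * kappa n\<close>, a bound that is free of moments.\<close>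

lemma scaled_signal_vanishes_max:
  assumes "(\<lambda>n. real (s2 n)) \<in> o(\<lambda>n. sqrt (real n) / (kappa n * gamma n))"
  shows "vanishes (\<lambda>n w. (1 / sqrt n) *\<^sub>R signal n w)"
proof (rule vanishes_dominated)
  let ?c = "\<lambda>n. real (s2 n) / (sqrt (real n) / (kappa n * gamma n))"
  show "vanishes (\<lambda>n _. ?c n)"
    by (rule vanishes_const) (rule smalloD_tendsto[OF assms])
  show "(\<lambda>w. (1 / sqrt n) *\<^sub>R signal n w) \<in> borel_measurable (M n)" for n
    using signal_rv by simp
  show "bad_X n \<in> sets (M n)" for n by (rule bad_sets)
  show "(\<lambda>n. prob n (bad_X n)) \<longlonglongrightarrow> 0" unfolding bad_X_def by (rule kappa_max)
  have "norm ((1 / sqrt n) *\<^sub>R signal n w) \<le> norm (?c n)" if w: "w \<in> space (M n) - bad_X n" for n w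
  proof -
    have "signal n w = (\<Sum>i=s1 n+1..s1 n+s2 n. mu n i *\<^sub>R X n i w)"
      unfolding signal_def using s_le[of n] mu_zero[of _ n] by (intro sum.mono_neutral_right) auto
    also have "norm \<dots> \<le> (\<Sum>i=s1 n+1..s1 n+s2 n. gamma n * kappa n)"
    proof (rule sum_norm_le)
      fix i assume i: "i \<in> {s1 n+1..s1 n+s2 n}"
      have "\<bar>mu n i\<bar> * norm (X n i w) \<le> gamma n * kappa n"
        using i s_le[of n] w gamma_pos[of n] by (intro mult_mono mu_le_gamma X_le_kappa) auto
      then show "norm (mu n i *\<^sub>R X n i w) \<le> gamma n * kappa n" by simp
    qed
    finally have "norm (signal n w) \<le> real (s2 n) * (kappa n * gamma n)"
      by (simp add: mult.commute)
    then have "norm ((1 / sqrt n) *\<^sub>R signal n w) \<le> real (s2 n) * (kappa n * gamma n) / sqrt n"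
      by (simp add: divide_right_mono)
    also have "\<dots> = ?c n" by simp
    also have "\<dots> \<le> norm (?c n)" unfolding real_norm_def by (rule abs_ge_self)
    finally show ?thesis .
  qed
  then show "\<forall>\<^sub>F n in sequentially. \<forall>w\<in>space (M n) - bad_X n. norm ((1 / sqrt n) *\<^sub>R signal n w) \<le> norm (?c n)"
    by simp
qed

lemma Sigma_X_component: "Sigma_X $ a $ b = (\<integral>w. X0 w $ a * X0 w $ b \<partial>P)"
proof -
  have "(\<integral>w. X0 w $ k \<partial>P) = 0" for k
  proof -
    have "(\<integral>w. X0 w $ k \<partial>P) = (\<integral>w. X0 w \<bullet> axis k 1 \<partial>P)" by (simp add: inner_axis)
    also have "\<dots> = (\<integral>w. X0 w \<partial>P) \<bullet> axis k 1" using X0_int by simp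
    finally show ?thesis by (simp add: X0_mean)
  qed
  then show ?thesis by (simp add: covariance_matrix_def)
qed

lemma X0_product_integrable: "integrable P (\<lambda>w. X0 w $ a * X0 w $ b)"
proof (rule Bochner_Integration.integrable_bound[OF X0_int2])
  show "AE w in P. norm (X0 w $ a * X0 w $ b) \<le> norm ((norm (X0 w))\<^sup>2)"
  proof (rule AE_I2)
    fix w
    have "\<bar>X0 w $ a\<bar> * \<bar>X0 w $ b\<bar> \<le> norm (X0 w) * norm (X0 w)"
      by (intro mult_mono component_le_norm_cart) auto
    then show "norm (X0 w $ a * X0 w $ b) \<le> norm ((norm (X0 w))\<^sup>2)"
      by (simp add: abs_mult power2_eq_square)
  qed
qed measurable

text \<open>The products of two components of \<open>X0\<close> are only known to have a first
  moment, hence the law of large numbers by truncation. It applies to the rows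
  \<open>i > s1 n\<close> since \<open>s1 n\<close> is o(n).\<close>

lemma gram_error_vanishes: "vanishes gram_error"
proof -
  have entry: "vanishes (\<lambda>n w. gram n w $ a $ b / n - Sigma_X $ a $ b)" for a b
  proof -
    define Q where "Q = distr P borel (\<lambda>w. X0 w $ a * X0 w $ b)"
    have int: "integrable Q (\<lambda>x. x)"
      unfolding Q_def by (subst integrable_distr_eq) (auto intro: X0_product_integrable)
    have mean: "(\<integral>x. x \<partial>Q) = Sigma_X $ a $ b"
      unfolding Q_def Sigma_X_component by (subst integral_distr) auto
    have "vanishes (\<lambda>n w. (\<Sum>i\<in>{s1 n+1..n}. X n i w $ a * X n i w $ b) / n - (\<integral>x. x \<partial>Q))"
    proof (rule weak_law_of_large_numbers[OF tail_subset])
      have "(\<lambda>n. 1 - real (s1 n) / real n) \<longlonglongrightarrow> 1 - 0"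
        by (intro tendsto_intros s1_tendsto)
      moreover have "\<forall>\<^sub>F n in sequentially. 1 - real (s1 n) / real n = real (card {s1 n+1..n}) / real n"
        using eventually_gt_at_top[of 0]
      proof eventually_elim
        case (elim n)
        have "s1 n \<le> n" using s_le[of n] by simp
        then show ?case using elim by (simp add: of_nat_diff diff_divide_distrib)
      qed
      ultimately show "(\<lambda>n. real (card {s1 n+1..n}) / real n) \<longlonglongrightarrow> 1"
        by (simp add: Lim_transform_eventually)
      show "indep_vars n (\<lambda>_. borel) (\<lambda>i w. X n i w $ a * X n i w $ b) {s1 n+1..n}" for n
        using indep_vars_compose2[OF indep_vars_subset[OF X_indep tail_subset], where Y = "\<lambda>_ x. x $ a * x $ b" and N = "\<lambda>_. borel"] by simp
      show "distr (M n) borel (\<lambda>w. X n i w $ a * X n i w $ b) = Q" if "i \<in> {s1 n+1..n}" for n i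
      proof -
        have i: "i \<in> {1..n}" using that by auto
        have "distr (M n) borel (\<lambda>w. X n i w $ a * X n i w $ b) = distr (distr (M n) borel (X n i)) borel (\<lambda>x. x $ a * x $ b)"
          using X_rv[OF i] by (simp add: distr_distr comp_def)
        also have "\<dots> = Q"
          unfolding X_distr[OF i] Q_def by (simp add: distr_distr comp_def)
        finally show ?thesis .
      qed
      show "prob_space Q" unfolding Q_def by (rule prob_space.prob_space_distr[OF prob_P]) measurable
      show "sets Q = sets borel" by (simp add: Q_def)
    qed (rule int)
    then show ?thesis by (simp add: mean gram_matrix_def)
  qed
  show ?thesis
    unfolding gram_error_def[abs_def]
    by (intro vanishes_sum finite)
      (use vanishes_norm[OF entry] in \<open>simp only: real_norm_def\<close>)
qed

text \<open>The zero set takes finitely many values, and for each fixed value least squares is a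
  measurable function of the sample, \<open>matrix_inv\<close> at singular matrices
  included.\<close>

lemma betatilde_rv: "betatilde n \<in> borel_measurable (M n)"
proof -
  have ls: "(\<lambda>w. least_squares (\<lambda>i. X n i w) (\<lambda>i. Y n i w) I) \<in> borel_measurable (M n)"
    if I: "I \<subseteq> {1..n}" for I
  proof -
    have rv: "X n i \<in> borel_measurable (M n)" "Y n i \<in> borel_measurable (M n)" if "i \<in> I" for i
      using X_rv[of i n] Y_rv[of i n] I that by auto
    have G: "(\<lambda>w. gram_matrix (\<lambda>i. X n i w) I) \<in> borel_measurable (M n)"
    proof (subst borel_measurable_euclidean_space, intro ballI)
      fix e :: "real ^ 'd ^ 'd" assume "e \<in> Basis"
      then obtain a b where e: "e = axis a (axis b 1)"
        by (auto simp: Basis_vec_def)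
      have "(\<lambda>w. \<Sum>i\<in>I. X n i w $ a * X n i w $ b) \<in> borel_measurable (M n)"
        using rv by (intro borel_measurable_sum borel_measurable_times borel_measurable_vec_component)
      then show "(\<lambda>w. gram_matrix (\<lambda>i. X n i w) I \<bullet> e) \<in> borel_measurable (M n)"
        by (simp add: e inner_axis gram_matrix_def)
    qed
    have inv: "(\<lambda>w. matrix_inv (gram_matrix (\<lambda>i. X n i w) I)) \<in> borel_measurable (M n)"
      by (rule measurable_compose[OF G borel_measurable_matrix_inv])
    have yx: "(\<lambda>w. \<Sum>i\<in>I. Y n i w *\<^sub>R X n i w) \<in> borel_measurable (M n)"
      using rv by (intro borel_measurable_sum borel_measurable_scaleR)
    have cont: "continuous_on UNIV (\<lambda>p :: (real ^ 'd ^ 'd) \<times> (real ^ 'd). fst p *v snd p)"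
      unfolding matrix_vector_mult_def by (intro continuous_intros)
    have "(\<lambda>w. (\<lambda>p. fst p *v snd p) (matrix_inv (gram_matrix (\<lambda>i. X n i w) I), \<Sum>i\<in>I. Y n i w *\<^sub>R X n i w)) \<in> borel_measurable (M n)"
      by (rule measurable_compose[OF borel_measurable_Pair[OF inv yx] borel_measurable_continuous_onI[OF cont]])
    then show ?thesis
      by (simp add: least_squares_def)
  qed
  have zs: "(\<lambda>w. zero_set n (muhat n w)) \<in> M n \<rightarrow>\<^sub>M count_space (Pow {1..n})"
  proof (subst measurable_count_space_eq2, simp, intro conjI ballI)
    show "(\<lambda>w. zero_set n (muhat n w)) \<in> space (M n) \<rightarrow> Pow {1..n}"
      by (auto simp: zero_set_def)
    fix I assume "I \<in> Pow {1..n}"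
    then have I: "I \<subseteq> {1..n}" by simp
    have "(\<lambda>w. zero_set n (muhat n w)) -` {I} \<inter> space (M n) = {w \<in> space (M n). \<forall>i\<in>{1..n}. (muhat n w i = 0) = (i \<in> I)}"
      using I unfolding zero_set_def by blast
    also have "\<dots> \<in> sets (M n)"
    proof (intro sets.sets_Collect_finite_All finite_atLeastAtMost)
      fix i assume i: "i \<in> {1..n}"
      have "{w \<in> space (M n). muhat n w i = 0} \<in> sets (M n)"
        using muhat_measurable[OF i] by measurable
      then show "{w \<in> space (M n). (muhat n w i = 0) = (i \<in> I)} \<in> sets (M n)"
        by (cases "i \<in> I") (auto simp: sets.sets_Collect_neg)
    qed
    finally show "(\<lambda>w. zero_set n (muhat n w)) -` {I} \<inter> space (M n) \<in> sets (M n)" .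
  qed
  have "(\<lambda>w. least_squares (\<lambda>i. X n i w) (\<lambda>i. Y n i w) (zero_set n (muhat n w))) \<in> borel_measurable (M n)"
    by (rule measurable_compose_countable'[OF ls[OF PowD] zs]) (simp_all add: countable_finite)
  then show ?thesis
    by (rule measurable_cong[THEN iffD1, rotated]) (simp add: betatilde)
qed

section \<open>The good event and consistency\<close>

lemma gram_error_le:
  "norm (((1 / n) *\<^sub>R gram n w - Sigma_X) *v v) \<le> gram_error n w * norm v"
  using norm_matrix_vector_mult_le[of "(1 / n) *\<^sub>R gram n w - Sigma_X" v] by (simp add: gram_error_def)

text \<open>What both limit results use about the first step: a lower bound \<open>c\<close> for the
  scaled Gram matrix, and the normal equations of the retained rows, split into signal and
  noise.\<close>

definition tail_fit :: "real \<Rightarrow> nat \<Rightarrow> 'a \<Rightarrow> bool" where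
  "tail_fit c n w \<longleftrightarrow>
    (\<forall>v. c * norm v \<le> norm (((1 / n) *\<^sub>R gram n w) *v v)) \<and>
    ((1 / n) *\<^sub>R gram n w) *v (betatilde n w - beta)
      = (1 / n) *\<^sub>R signal n w + (1 / n) *\<^sub>R noise n {s1 n+1..n} w"

text \<open>On the complement of the bad event the first step separates the large incidental parameters
  exactly, so that the least squares estimator uses precisely the observations \<open>i > s1 n\<close>.\<close>

lemma good_event:
  obtains c :: real and Bad where "c > 0" "\<And>n. Bad n \<in> sets (M n)" "(\<lambda>n. prob n (Bad n)) \<longlonglongrightarrow> 0"
    "\<forall>\<^sub>F n in sequentially. \<forall>w\<in>space (M n) - Bad n. tail_fit c n w"
proof -
  obtain c where c: "c > 0" "\<And>v. c * (norm v)\<^sup>2 \<le> v \<bullet> (Sigma_X *v v)"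
    using positive_definite_coercive[OF cov_pd] by blast
  define V where "V n w = ((1 / n) *\<^sub>R signal n w + (1 / n) *\<^sub>R noise n {s1 n+1..n} w) + (lam n / n) *\<^sub>R signs n w" for n w
  have V: "vanishes V"
    unfolding V_def[abs_def]
    by (intro vanishes_add signal_mean_vanishes noise_mean_vanishes signs_mean_vanishes)
  have [measurable]: "V n \<in> borel_measurable (M n)" "gram_error n \<in> borel_measurable (M n)" for n
    using V gram_error_vanishes by (simp_all add: vanishes_iff)
  \<comment> \<open>The thresholds come from the coercivity constant \<open>c\<close>: a Gram error
    of at most \<open>c / 2\<close> leaves curvature \<open>c / 2\<close>, and twice
    \<open>c / 8\<close> lies strictly below that.\<close>
  define bad_V where "bad_V n = {w \<in> space (M n). norm (V n w) > c / 8}" for n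
  define bad_G where "bad_G n = {w \<in> space (M n). norm (gram_error n w) > c / 2}" for n
  define Bad where "Bad n = (bad_X n \<union> bad_eps n) \<union> (bad_V n \<union> bad_G n)" for n
  have [measurable]: "bad_V n \<in> sets (M n)" "bad_G n \<in> sets (M n)" "bad_X n \<in> sets (M n)" "bad_eps n \<in> sets (M n)" for n
    unfolding bad_V_def bad_G_def by (measurable, rule bad_sets, rule bad_sets)
  show thesis
  proof (rule that[of "c / 2" Bad])
    show "c / 2 > 0" using c by simp
    show "Bad n \<in> sets (M n)" for n unfolding Bad_def by measurable
    have "(\<lambda>n. (prob n (bad_X n) + prob n (bad_eps n)) + (prob n (bad_V n) + prob n (bad_G n))) \<longlonglongrightarrow> (0 + 0) + (0 + 0)"
    proof (intro tendsto_add)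
      show "(\<lambda>n. prob n (bad_X n)) \<longlonglongrightarrow> 0" unfolding bad_X_def by (rule kappa_max)
      show "(\<lambda>n. prob n (bad_eps n)) \<longlonglongrightarrow> 0" unfolding bad_eps_def by (rule gamma_max)
      show "(\<lambda>n. prob n (bad_V n)) \<longlonglongrightarrow> 0"
      proof -
        have "c / 8 > 0" using c(1) by simp
        then show ?thesis using V unfolding bad_V_def vanishes_iff by blast
      qed
      show "(\<lambda>n. prob n (bad_G n)) \<longlonglongrightarrow> 0"
        using gram_error_vanishes half_gt_zero[OF c(1)] unfolding bad_G_def vanishes_iff by blast
    qed
    then have lim: "(\<lambda>n. (prob n (bad_X n) + prob n (bad_eps n)) + (prob n (bad_V n) + prob n (bad_G n))) \<longlonglongrightarrow> 0"
      by simp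
    have "prob n (Bad n) \<le> (prob n (bad_X n) + prob n (bad_eps n)) + (prob n (bad_V n) + prob n (bad_G n))" for n
      unfolding Bad_def by (intro order_trans[OF measure_Un_le] add_mono measure_Un_le) auto
    then show "(\<lambda>n. prob n (Bad n)) \<longlonglongrightarrow> 0"
      by (intro tendsto_sandwich[OF _ _ tendsto_const lim]) auto
    show "\<forall>\<^sub>F n in sequentially. \<forall>w\<in>space (M n) - Bad n. tail_fit (c / 2) n w"
      using eventually_separated eventually_gt_at_top[of 0]
    proof eventually_elim
      case (elim n)
      show ?case
      proof
        fix w assume w: "w \<in> space (M n) - Bad n"
        let ?G = "(1 / real n) *\<^sub>R gram n w"
        have err: "gram_error n w \<le> c / 2" and Vle: "norm (V n w) \<le> c / 8"
          using w by (auto simp: Bad_def bad_G_def bad_V_def)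
        have quad: "c / 2 * (norm v)\<^sup>2 \<le> v \<bullet> (?G *v v)" for v
        proof -
          have "\<bar>v \<bullet> ((?G - Sigma_X) *v v)\<bar> \<le> norm v * norm ((?G - Sigma_X) *v v)"
            by (rule Cauchy_Schwarz_ineq2)
          also have "\<dots> \<le> norm v * (gram_error n w * norm v)"
            by (intro mult_left_mono gram_error_le) simp
          also have "\<dots> \<le> norm v * (c / 2 * norm v)"
            using err by (intro mult_left_mono mult_right_mono) auto
          finally have "\<bar>v \<bullet> ((?G - Sigma_X) *v v)\<bar> \<le> c / 2 * (norm v)\<^sup>2"
            by (simp add: power2_eq_square mult_ac)
          moreover have "v \<bullet> (?G *v v) = v \<bullet> (Sigma_X *v v) + v \<bullet> ((?G - Sigma_X) *v v)"
            by (simp add: matrix_vector_mult_diff_rdistrib inner_diff_right)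
          ultimately show ?thesis
            using c(2)[of v] by linarith
        qed
        have G_eq: "?G *v v = (1 / n) *\<^sub>R (gram n w *v v)" for v
          by (simp add: scaleR_matrix_vector_assoc)
        have quad': "c / 2 * real n * (norm v)\<^sup>2 \<le> v \<bullet> (gram n w *v v)" for v
        proof -
          have "c / 2 * (norm v)\<^sup>2 \<le> (1 / n) * (v \<bullet> (gram n w *v v))"
            using quad[of v] unfolding G_eq inner_scaleR_right .
          then show ?thesis using elim(2) by (simp add: field_simps)
        qed
        have coercive: "c / 2 * norm v \<le> norm (?G *v v)" for v
        proof (cases "v = 0")
          case False
          have "norm v * (c / 2 * norm v) \<le> v \<bullet> (?G *v v)"
            using quad[of v] by (simp add: power2_eq_square mult_ac)
          also have "\<dots> \<le> norm v * norm (?G *v v)"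
            by (rule norm_cauchy_schwarz)
          finally show ?thesis using False by simp
        qed simp
        have zs: "zero_set n (muhat n w) = {s1 n+1..n}"
        proof (rule penalized_minimizer_zero_set[OF minimizer lam_pos])
          show "w \<in> space (M n)" using w by simp
          show "Y n i w = mu n i + X n i w \<bullet> beta + eps n i w" if "i \<in> {1..n}" for i
            using w that by (intro Y_eq) auto
          show "norm (X n i w) \<le> kappa n" if "i \<in> {1..n}" for i
            using w that by (intro X_le_kappa) (auto simp: Bad_def)
          show "\<bar>eps n i w\<bar> \<le> gamma n" if "i \<in> {1..n}" for i
            using w that by (intro eps_le_gamma) (auto simp: Bad_def)
          show "s1 n \<le> n" using s_le[of n] by simp
          show "lam n + gamma n + kappa n < \<bar>mu n i\<bar>" if "i \<in> {1..s1 n}" for i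
            using elim(1) that by blast
          show "\<bar>mu n i\<bar> \<le> gamma n" if "i \<in> {s1 n+1..n}" for i
            using that by (rule mu_le_gamma)
          show "2 * gamma n + kappa n < lam n"
            using elim(1) by blast
          fix v :: "real ^ 'd" assume v: "norm v = 1"
          let ?V = "(\<Sum>i=s1 n+1..n. (mu n i + eps n i w) *\<^sub>R X n i w) + lam n *\<^sub>R (\<Sum>i=1..s1 n. sgn (mu n i) *\<^sub>R X n i w)"
          have "?V
              = real n *\<^sub>R V n w"
            using elim(2) by (simp add: V_def signal_def noise_def signs_def scaleR_add_left sum.distrib scaleR_add_right)
          then have "2 * norm ?V
              = 2 * real n * norm (V n w)" by simp
          also have "\<dots> \<le> 2 * real n * (c / 8)"
            using Vle by (intro mult_left_mono) auto
          also have "\<dots> < c / 2 * real n * (norm v)\<^sup>2"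
            using elim(2) c(1) v by simp
          also have "\<dots> \<le> v \<bullet> (gram n w *v v)" by (rule quad')
          also have "\<dots> = (\<Sum>i=s1 n+1..n. (X n i w \<bullet> v)\<^sup>2)"
            by (rule inner_gram_matrix)
          finally show "2 * norm ?V
              < (\<Sum>i=s1 n+1..n. (X n i w \<bullet> v)\<^sup>2)" .
        qed
        have "gram n w *v (betatilde n w - beta) = (\<Sum>i=s1 n+1..n. (mu n i + eps n i w) *\<^sub>R X n i w)"
        proof -
          have "betatilde n w = least_squares (\<lambda>i. X n i w) (\<lambda>i. Y n i w) {s1 n+1..n}"
            using betatilde[of w n] w zs by simp
          moreover have "gram n w *v (least_squares (\<lambda>i. X n i w) (\<lambda>i. Y n i w) {s1 n+1..n} - beta)
              = (\<Sum>i=s1 n+1..n. (mu n i + eps n i w) *\<^sub>R X n i w)"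
          proof (rule gram_matrix_least_squares)
            fix v :: "real ^ 'd" assume "v \<noteq> 0"
            then have "0 < c / 2 * real n * (norm v)\<^sup>2" using c(1) elim(2) by simp
            then show "0 < v \<bullet> (gram n w *v v)" using quad'[of v] by linarith
          next
            fix i assume i: "i \<in> {s1 n+1..n}"
            have "Y n i w = mu n i + X n i w \<bullet> beta + eps n i w"
              using w i by (intro Y_eq) auto
            then show "Y n i w = X n i w \<bullet> beta + (mu n i + eps n i w)" by simp
          qed
          ultimately show ?thesis by simp
        qed
        then have "?G *v (betatilde n w - beta) = (1 / n) *\<^sub>R signal n w + (1 / n) *\<^sub>R noise n {s1 n+1..n} w"
          unfolding G_eq signal_def noise_def by (simp only: scaleR_add_left sum.distrib scaleR_add_right)
        then show "tail_fit (c / 2) n w"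
          using coercive unfolding tail_fit_def by blast
      qed
    qed
  qed
qed

text \<open>On the good event the estimation error is at most \<open>1 / c\<close> times the norm of
  the scaled signal plus noise, and both of these vanish in probability.\<close>

lemma betatilde_consistent: "converges_in_probability M betatilde beta"
proof -
  obtain c Bad where c: "c > 0" and Bad: "\<And>n. Bad n \<in> sets (M n)" "(\<lambda>n. prob n (Bad n)) \<longlonglongrightarrow> 0"
    and good: "\<forall>\<^sub>F n in sequentially. \<forall>w\<in>space (M n) - Bad n. tail_fit c n w"
    using good_event by blast
  note good = good[unfolded tail_fit_def]
  let ?U = "\<lambda>n w. (1 / real n) *\<^sub>R signal n w + (1 / real n) *\<^sub>R noise n {s1 n+1..n} w"
  have "vanishes (\<lambda>n w. betatilde n w - beta)"
  proof (rule vanishes_dominated[OF _ _ Bad])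
    show "(\<lambda>w. betatilde n w - beta) \<in> borel_measurable (M n)" for n
      using betatilde_rv by simp
    show "vanishes (\<lambda>n w. norm (?U n w) * (1 / c))"
      by (intro vanishes_cmult vanishes_norm vanishes_add
          signal_mean_vanishes noise_mean_vanishes)
    show "\<forall>\<^sub>F n in sequentially. \<forall>w\<in>space (M n) - Bad n. norm (betatilde n w - beta) \<le> norm (norm (?U n w) * (1 / c))"
      using good
    proof eventually_elim
      case (elim n)
      show ?case
      proof
        fix w assume "w \<in> space (M n) - Bad n"
        with elim have "c * norm (betatilde n w - beta) \<le> norm (?U n w)"
          by metis
        then show "norm (betatilde n w - beta) \<le> norm (norm (?U n w) * (1 / c))"
          using c by (simp add: field_simps)
      qed
    qed
  qed
  then show ?thesis
    using betatilde_rv by (simp add: converges_in_probability_def dist_norm)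
qed

section \<open>Asymptotic normality\<close>

lemma Sigma_X_inverse:
  shows "Sigma_X ** matrix_inv Sigma_X = mat 1" "matrix_inv Sigma_X ** Sigma_X = mat 1"
    and "transpose (matrix_inv Sigma_X) = matrix_inv Sigma_X"
    and "positive_definite (sd\<^sup>2 *\<^sub>R matrix_inv Sigma_X)"
proof -
  \<comment> \<open>\<open>D\<close> inverts the factor \<open>C\<close>, so the inverse of
    \<open>Sigma_X\<close> is \<open>transpose D ** D\<close>; symmetry and positivity of that
    product are immediate.\<close>
  obtain C D :: "real ^ 'd ^ 'd" where CD: "C ** D = mat 1" "D ** C = mat 1" "Sigma_X = C ** transpose C"
    using posdef_factorization[OF cov_pd] .
  have tr: "transpose D ** transpose C = mat 1" "transpose C ** transpose D = mat 1"
    using CD by (metis matrix_transpose_mul transpose_mat)+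
  have "Sigma_X ** (transpose D ** D) = C ** (transpose C ** transpose D) ** D"
    by (simp add: CD(3) matrix_mul_assoc)
  then have r: "Sigma_X ** (transpose D ** D) = mat 1"
    by (simp add: tr CD)
  then have l: "(transpose D ** D) ** Sigma_X = mat 1"
    by (simp add: matrix_left_right_inverse)
  have inv: "matrix_inv Sigma_X = transpose D ** D"
    using r l by (rule matrix_inv_unique)
  show "Sigma_X ** matrix_inv Sigma_X = mat 1" "matrix_inv Sigma_X ** Sigma_X = mat 1"
    using r l by (simp_all add: inv)
  show sym: "transpose (matrix_inv Sigma_X) = matrix_inv Sigma_X"
    by (simp add: inv matrix_transpose_mul)
  have "v \<bullet> ((sd\<^sup>2 *\<^sub>R matrix_inv Sigma_X) *v v) > 0" if "v \<noteq> 0" for v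
  proof -
    have "C *v (D *v v) = v" by (simp add: matrix_vector_mul_assoc CD)
    then have "D *v v \<noteq> 0" using that by auto
    moreover have "v \<bullet> (matrix_inv Sigma_X *v v) = (D *v v) \<bullet> (D *v v)"
      by (simp add: inv inner_transpose del: transpose_matrix_vector flip: matrix_vector_mul_assoc)
    ultimately show ?thesis
      using sd_pos by (simp flip: scaleR_matrix_vector_assoc)
  qed
  moreover have "transpose (sd\<^sup>2 *\<^sub>R matrix_inv Sigma_X) = sd\<^sup>2 *\<^sub>R matrix_inv Sigma_X"
    using sym by (simp add: transpose_def vec_eq_iff)
  ultimately show "positive_definite (sd\<^sup>2 *\<^sub>R matrix_inv Sigma_X)"
    by (simp add: positive_definite_def)
qed

lemma inner_Sigma_X: "u \<bullet> (Sigma_X *v u) = (\<integral>w. (u \<bullet> X0 w)\<^sup>2 \<partial>P)"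
proof -
  have "(u \<bullet> X0 w)\<^sup>2 = (\<Sum>a\<in>UNIV. \<Sum>b\<in>UNIV. (u $ a * u $ b) * (X0 w $ a * X0 w $ b))" for w
    by (simp add: inner_vec_def power2_eq_square sum_product algebra_simps)
  then have "(\<integral>w. (u \<bullet> X0 w)\<^sup>2 \<partial>P) = (\<Sum>a\<in>UNIV. \<Sum>b\<in>UNIV. (u $ a * u $ b) * Sigma_X $ a $ b)"
    by (simp add: Sigma_X_component X0_product_integrable)
  then show ?thesis
    by (simp add: inner_vec_def matrix_vector_mult_def sum_distrib_left algebra_simps)
qed

text \<open>In the direction \<open>u\<close> the noise is a sum of \<open>n\<close> i.i.d. real
  variables, the products of \<open>u \<bullet> X0\<close> and an independent error. Their common
  law \<open>Q\<close> is centred, with variance \<open>sd\<^sup>2\<close> times the quadratic form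
  of \<open>Sigma_X\<close> at \<open>u\<close>.\<close>

lemma noise_char_tendsto:
  fixes u :: "real ^ 'd"
  shows "(\<lambda>n. \<integral>w. iexp (u \<bullet> ((1 / sqrt n) *\<^sub>R noise n {1..n} w)) \<partial>M n)
    \<longlonglongrightarrow> complex_of_real (exp (- (sd\<^sup>2 * (u \<bullet> (Sigma_X *v u))) / 2))"
proof -
  define h where "h = (\<lambda>(x :: real ^ 'd, e :: real). (u \<bullet> x) * e)"
  have h_rv: "h \<in> borel_measurable (borel \<Otimes>\<^sub>M borel)"
    unfolding h_def by measurable
  have law_sets: "sets X_eps_law = sets (borel \<Otimes>\<^sub>M borel)"
    unfolding X_eps_law_def by (intro sets_pair_measure_cong) simp_all
  have h_rv': "h \<in> borel_measurable X_eps_law"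
    using h_rv by (simp add: measurable_cong_sets[OF law_sets refl])
  define Q where "Q = distr X_eps_law borel h"
  interpret law: pair_prob_space "distr P borel X0" "distr P borel eps0"
    by (intro pair_prob_space.intro pair_sigma_finite.intro prob_space_imp_sigma_finite prob_laws)
  have "prob_space X_eps_law"
    unfolding X_eps_law_def by (rule law.P.prob_space_axioms)
  then interpret Q: real_distribution Q
    unfolding Q_def using h_rv' by (rule prob_space.real_distribution_distr)
  have uX: "integrable P (\<lambda>w. u \<bullet> X0 w)" using X0_int by simp
  have uX2: "integrable P (\<lambda>w. (u \<bullet> X0 w)\<^sup>2)"
  proof (rule Bochner_Integration.integrable_bound)
    show "integrable P (\<lambda>w. (norm u)\<^sup>2 * (norm (X0 w))\<^sup>2)" using X0_int2 by simp
    show "AE w in P. norm ((u \<bullet> X0 w)\<^sup>2) \<le> norm ((norm u)\<^sup>2 * (norm (X0 w))\<^sup>2)"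
    proof (rule AE_I2)
      fix w
      have "\<bar>u \<bullet> X0 w\<bar> \<le> norm u * norm (X0 w)" by (rule Cauchy_Schwarz_ineq2)
      from power_mono[OF this, of 2] show "norm ((u \<bullet> X0 w)\<^sup>2) \<le> norm ((norm u)\<^sup>2 * (norm (X0 w))\<^sup>2)"
        by (simp add: power_mult_distrib)
    qed
  qed measurable
  have h2: "(\<lambda>z. (h z)\<^sup>2) = (\<lambda>(x, e). (u \<bullet> x)\<^sup>2 * e\<^sup>2)"
    by (auto simp: h_def power_mult_distrib)
  have meas: "(\<lambda>x :: real ^ 'd. u \<bullet> x) \<in> borel_measurable borel" "(\<lambda>x :: real ^ 'd. (u \<bullet> x)\<^sup>2) \<in> borel_measurable borel"
      "(\<lambda>e :: real. e) \<in> borel_measurable borel" "(\<lambda>e :: real. e\<^sup>2) \<in> borel_measurable borel"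
    by measurable
  have int1: "integrable Q (\<lambda>x. x)" and mean: "(\<integral>x. x \<partial>Q) = 0"
    unfolding Q_def
    using X_eps_law_integrable[OF uX meas(1) eps0_int meas(3)] X_eps_law_integral[OF uX meas(1) eps0_int meas(3)] h_rv'
    by (simp_all add: integrable_distr_eq integral_distr h_def eps0_mean)
  have int2: "integrable Q (\<lambda>x. x\<^sup>2)" and var: "(\<integral>x. x\<^sup>2 \<partial>Q) = sd\<^sup>2 * (u \<bullet> (Sigma_X *v u))"
    unfolding Q_def
    using X_eps_law_integrable[OF uX2 meas(2) eps0_int2 meas(4)] X_eps_law_integral[OF uX2 meas(2) eps0_int2 meas(4)] h_rv'
    by (simp_all add: integrable_distr_eq integral_distr h2 eps0_second_moment inner_Sigma_X)
  have "(\<integral>w. iexp (u \<bullet> ((1 / sqrt n) *\<^sub>R noise n {1..n} w)) \<partial>M n) = char Q (1 / sqrt n) ^ n" for n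
  proof -
    let ?Z = "\<lambda>i w. h (X n i w, eps n i w)"
    have ind: "indep_vars n (\<lambda>_. borel) ?Z {1..n}"
      using indep_vars_compose2[OF X_eps_pair(1), where Y = "\<lambda>_. h" and N = "\<lambda>_. borel"] h_rv by simp
    have Z_rv: "?Z i \<in> borel_measurable (M n)" if "i \<in> {1..n}" for i
      using ind that by (auto simp: indep_vars_def2)
    have distr: "distr (M n) borel (?Z i) = Q" if i: "i \<in> {1..n}" for i
    proof -
      note [measurable] = X_rv[OF i] eps_rv[OF i] h_rv
      have "distr (M n) borel (?Z i) = distr (distr (M n) (borel \<Otimes>\<^sub>M borel) (\<lambda>w. (X n i w, eps n i w))) borel h"
        by (subst distr_distr) (auto simp: comp_def)
      then show ?thesis by (simp only: X_eps_pair(2)[OF i] Q_def)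
    qed
    have "(\<integral>w. iexp (u \<bullet> ((1 / sqrt n) *\<^sub>R noise n {1..n} w)) \<partial>M n) = char (distr (M n) borel (\<lambda>w. \<Sum>i\<in>{1..n}. ?Z i w)) (1 / sqrt n)"
      unfolding char_def
    proof (subst integral_distr)
      show "(\<lambda>w. \<Sum>i\<in>{1..n}. ?Z i w) \<in> borel_measurable (M n)"
        using Z_rv by (rule borel_measurable_sum)
      have "u \<bullet> ((1 / sqrt n) *\<^sub>R noise n {1..n} w) = (1 / sqrt n) * (\<Sum>i\<in>{1..n}. ?Z i w)" for w
        by (simp add: noise_def h_def inner_sum_right mult.commute)
      then show "(\<integral>w. iexp (u \<bullet> ((1 / sqrt n) *\<^sub>R noise n {1..n} w)) \<partial>M n) = (\<integral>w. iexp (1 / sqrt n * (\<Sum>i\<in>{1..n}. ?Z i w)) \<partial>M n)"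
        by (simp only:)
    qed measurable
    also have "\<dots> = (\<Prod>i\<in>{1..n}. char (distr (M n) borel (?Z i)) (1 / sqrt n))"
      by (rule char_distr_sum[OF ind])
    also have "\<dots> = (\<Prod>i\<in>{1..n}. char Q (1 / sqrt n))"
      by (intro prod.cong refl) (simp only: distr)
    finally show ?thesis by simp
  qed
  then show ?thesis
    using Q.char_power_tendsto[OF int1 mean int2 var] by simp
qed

text \<open>The scaled error \<open>W\<close> is compared with the inverse of \<open>Sigma_X\<close>
  applied to the full noise \<open>S\<close>. The lower bound for the Gram matrix gives
  \<open>norm W \<le> norm U / c\<close> on the good event, so the remainder \<open>R\<close> is
  bounded by \<open>b\<close>: a vanishing Gram error times a tight factor, plus the vanishing term
  \<open>E\<close>. Perturbation by \<open>R\<close> changes neither the limit of the characteristic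
  functions nor tightness.\<close>

lemma betatilde_asymptotically_normal:
  assumes signal: "vanishes (\<lambda>n w. (1 / sqrt n) *\<^sub>R signal n w)"
  shows "converges_in_distribution M (\<lambda>n w. sqrt (real n) *\<^sub>R (betatilde n w - beta))
             (multivariate_normal 0 (sd\<^sup>2 *\<^sub>R matrix_inv Sigma_X))"
proof -
  obtain c Bad where c: "c > 0" and Bad: "\<And>n. Bad n \<in> sets (M n)" "(\<lambda>n. prob n (Bad n)) \<longlonglongrightarrow> 0"
    and good: "\<forall>\<^sub>F n in sequentially. \<forall>w\<in>space (M n) - Bad n. tail_fit c n w"
    using good_event by blast
  note good = good[unfolded tail_fit_def]
  let ?I = "matrix_inv Sigma_X"
  define W where "W n w = sqrt (real n) *\<^sub>R (betatilde n w - beta)" for n w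
  define S where "S n w = (1 / sqrt n) *\<^sub>R noise n {1..n} w" for n w
  \<comment> \<open>All of the scaled right-hand side of the normal equations except the full noise;
    the negative term removes the first \<open>s1 n\<close> rows, which the second step
    discards.\<close>
  define E where "E n w = (1 / sqrt n) *\<^sub>R signal n w + - ((1 / sqrt n) *\<^sub>R noise n {1..s1 n} w)" for n w
  define R where "R n w = W n w - ?I *v S n w" for n w
  have W_rv: "W n \<in> borel_measurable (M n)" for n
    unfolding W_def[abs_def] using betatilde_rv by simp
  have S_rv: "S n \<in> borel_measurable (M n)" for n
    unfolding S_def[abs_def] using noise_rv[of "{1..n}" n] by simp
  have I_rv: "(*v) ?I \<in> borel_measurable borel"
    by (rule measurable_linear) (rule matrix_vector_mul_linear)
  have IS_rv: "(\<lambda>w. ?I *v S n w) \<in> borel_measurable (M n)" for n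
    by (rule measurable_compose[OF S_rv I_rv])
  have R_rv: "R n \<in> borel_measurable (M n)" for n
    unfolding R_def[abs_def] by (intro borel_measurable_diff W_rv IS_rv)
  have "vanishes (\<lambda>n w. - ((1 / sqrt n) *\<^sub>R noise n {1..s1 n} w))"
    using head_noise_vanishes by (auto simp: vanishes_iff)
  with signal have E: "vanishes E"
    unfolding E_def[abs_def] by (rule vanishes_add)
  have S_bounded: "tight_seq S"
    unfolding S_def[abs_def] by (rule noise_bounded)
  define U where "U n w = S n w + E n w" for n w
  have U_bounded: "tight_seq U"
    unfolding U_def[abs_def] by (rule tight_seq_add[OF S_bounded E])
  have nU_bounded: "tight_seq (\<lambda>n w. norm (U n w))"
  proof -
    have "(\<lambda>w. norm (U n w)) \<in> borel_measurable (M n)" for n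
      using U_bounded unfolding tight_seq_def by (intro measurable_compose[OF _ borel_measurable_norm]) blast
    then show ?thesis
      using U_bounded by (simp add: tight_seq_def)
  qed
  obtain K where K: "K > 0" "\<And>x. norm (?I *v x) \<le> K * norm x"
    using linear_bounded_pos[OF matrix_vector_mul_linear[of ?I]] by blast
  define b where "b n w = (gram_error n w * norm (U n w)) * (K / c) + norm (E n w) * K" for n w
  have b: "vanishes b"
    unfolding b_def[abs_def]
    by (intro vanishes_add vanishes_cmult vanishes_mult_tight
        vanishes_norm gram_error_vanishes nU_bounded E)
  have R: "vanishes R"
  proof (rule vanishes_dominated[OF R_rv b Bad])
    show "\<forall>\<^sub>F n in sequentially. \<forall>w\<in>space (M n) - Bad n. norm (R n w) \<le> norm (b n w)"
      using good eventually_gt_at_top[of 0]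
    proof eventually_elim
      case (elim n)
      show ?case
      proof
        fix w assume w: "w \<in> space (M n) - Bad n"
        let ?G = "(1 / real n) *\<^sub>R gram n w"
        have split: "noise n {1..n} w = noise n {1..s1 n} w + noise n {s1 n+1..n} w"
        proof -
          have "{1..n} = {1..s1 n} \<union> {s1 n+1..n}" using s_le[of n] by auto
          then show ?thesis unfolding noise_def by (simp add: sum.union_disjoint)
        qed
        have U_eq: "U n w = (1 / sqrt n) *\<^sub>R signal n w + (1 / sqrt n) *\<^sub>R noise n {s1 n+1..n} w"
          unfolding U_def S_def E_def split by (simp add: scaleR_add_right)
        have "sqrt (real n) * (1 / real n) = 1 / sqrt (real n)"
          using elim(2) by (simp add: real_div_sqrt field_simps)
        moreover have "?G *v W n w = sqrt (real n) *\<^sub>R (?G *v (betatilde n w - beta))"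
          by (simp only: W_def matrix_vector_mult_scaleR)
        ultimately have GW: "?G *v W n w = U n w"
          using elim(1) w by (simp add: U_eq scaleR_add_right)
        have coercive: "c * norm (W n w) \<le> norm (U n w)"
          using elim(1) w GW by metis
        have ISW: "?I *v (Sigma_X *v W n w) = W n w"
          by (simp add: matrix_vector_mul_assoc Sigma_X_inverse)
        \<comment> \<open>The random Gram matrix is traded for \<open>Sigma_X\<close> at the price
          of an error term, so that only a fixed inverse has to be applied.\<close>
        have SW: "Sigma_X *v W n w = U n w - (?G - Sigma_X) *v W n w"
          unfolding GW[symmetric] by (simp add: matrix_vector_mult_diff_rdistrib)
        have "R n w = ?I *v (Sigma_X *v W n w - S n w)"
          unfolding R_def matrix_vector_mult_diff_distrib ISW ..
        also have "Sigma_X *v W n w - S n w = E n w - (?G - Sigma_X) *v W n w"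
          unfolding SW U_def by simp
        finally have "R n w = ?I *v (E n w - (?G - Sigma_X) *v W n w)" .
        then have "norm (R n w) \<le> K * norm (E n w - (?G - Sigma_X) *v W n w)"
          using K(2) by simp
        also have "\<dots> \<le> K * (norm (E n w) + gram_error n w * norm (W n w))"
          using K(1) gram_error_le[of n w "W n w"]
          by (intro mult_left_mono norm_triangle_le_diff add_left_mono) auto
        also have "\<dots> \<le> K * (norm (E n w) + gram_error n w * (norm (U n w) / c))"
        proof (intro mult_left_mono add_left_mono)
          show "norm (W n w) \<le> norm (U n w) / c" using coercive c by (simp add: field_simps)
          show "0 \<le> gram_error n w" by (simp add: gram_error_def sum_nonneg)
        qed (use K in simp)
        also have "\<dots> = b n w"
          by (simp add: b_def algebra_simps)
        finally show "norm (R n w) \<le> norm (b n w)" by simp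
      qed
    qed
  qed
  have W_eq: "W n w = ?I *v S n w + R n w" for n w
    by (simp add: R_def)
  have IS_bounded: "tight_seq (\<lambda>n w. ?I *v S n w)"
    unfolding tight_seq_def
  proof (intro conjI allI impI IS_rv)
    fix e :: real assume "e > 0"
    then obtain L where L: "\<forall>\<^sub>F n in sequentially. tail_prob S n L \<le> e"
      using S_bounded unfolding tight_seq_def by blast
    have "\<forall>\<^sub>F n in sequentially. prob n {w \<in> space (M n). norm (?I *v S n w) > K * L} \<le> e"
      using L
    proof eventually_elim
      case (elim n)
      have "norm (S n w) > L" if "norm (?I *v S n w) > K * L" for w
        using K(2)[of "S n w"] that K(1) by (smt (verit) mult_left_mono)
      then have "prob n {w \<in> space (M n). norm (?I *v S n w) > K * L} \<le> tail_prob S n L"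
        using S_rv[of n] by (intro finite_measure_mono) auto
      then show ?case using elim by linarith
    qed
    then show "\<exists>L. \<forall>\<^sub>F n in sequentially. prob n {w \<in> space (M n). norm (?I *v S n w) > L} \<le> e" ..
  qed
  have W_bounded: "tight_seq W"
    using tight_seq_add[OF IS_bounded R] by (simp add: W_eq[symmetric])
  show ?thesis
    unfolding W_def[symmetric]
  proof (rule converges_in_distribution_of_char[OF prob_M W_rv])
    show "prob_space (multivariate_normal 0 (sd\<^sup>2 *\<^sub>R ?I))"
      by (rule prob_space_multivariate_normal[OF Sigma_X_inverse(4)])
    show "sets (multivariate_normal 0 (sd\<^sup>2 *\<^sub>R ?I)) = sets borel"
      by (simp add: multivariate_normal_def)
    show "\<exists>K. \<forall>\<^sub>F n in sequentially. tail_prob W n K \<le> e" if "e > 0" for e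
      using W_bounded that unfolding tight_seq_def by blast
    fix t :: "real ^ 'd"
    let ?u = "?I *v t"
    \<comment> \<open>By symmetry the inverse moves onto \<open>t\<close>; at the resulting vector
      \<open>?u\<close> the quadratic form of \<open>Sigma_X\<close> is that of its inverse at
      \<open>t\<close>.\<close>
    have u: "t \<bullet> (?I *v x) = ?u \<bullet> x" for x
      using inner_transpose[of t ?I x] by (simp only: Sigma_X_inverse(3))
    have "?u \<bullet> (Sigma_X *v ?u) = t \<bullet> (?I *v t)"
      by (simp add: matrix_vector_mul_assoc Sigma_X_inverse inner_commute)
    then have lim: "(\<lambda>n. \<integral>w. iexp (t \<bullet> (?I *v S n w)) \<partial>M n) \<longlonglongrightarrow> complex_of_real (exp (- (sd\<^sup>2 * (t \<bullet> (?I *v t))) / 2))"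
      using noise_char_tendsto[of ?u] by (simp only: u S_def)
    have "(\<lambda>n. \<integral>w. iexp (t \<bullet> W n w) \<partial>M n) \<longlonglongrightarrow> complex_of_real (exp (- (sd\<^sup>2 * (t \<bullet> (?I *v t))) / 2))"
      using char_tendsto_perturbed[OF IS_rv R lim] by (simp only: W_eq)
    also have "complex_of_real (exp (- (sd\<^sup>2 * (t \<bullet> (?I *v t))) / 2)) = (\<integral>x. iexp (t \<bullet> x) \<partial>multivariate_normal 0 (sd\<^sup>2 *\<^sub>R ?I))"
      unfolding char_multivariate_normal[OF Sigma_X_inverse(4)] by (simp flip: scaleR_matrix_vector_assoc)
    finally show "(\<lambda>n. \<integral>w. iexp (t \<bullet> W n w) \<partial>M n) \<longlonglongrightarrow> (\<integral>x. iexp (t \<bullet> x) \<partial>multivariate_normal 0 (sd\<^sup>2 *\<^sub>R ?I))" .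
  qed
qed

end

theorem theorem3p5:
  fixes P :: "'b measure" and X0 :: "'b \<Rightarrow> real ^ 'd" and eps0 :: "'b \<Rightarrow> real" and sd :: real
    and M :: "nat \<Rightarrow> 'a measure"
    and X :: "nat \<Rightarrow> nat \<Rightarrow> 'a \<Rightarrow> real ^ 'd" and eps Y :: "nat \<Rightarrow> nat \<Rightarrow> 'a \<Rightarrow> real"
    and mu :: "nat \<Rightarrow> nat \<Rightarrow> real" and beta :: "real ^ 'd"
    and s1 s2 :: "nat \<Rightarrow> nat" and kappa gamma lam :: "nat \<Rightarrow> real"
    and muhat :: "nat \<Rightarrow> 'a \<Rightarrow> nat \<Rightarrow> real" and betahat betatilde :: "nat \<Rightarrow> 'a \<Rightarrow> real ^ 'd"
  assumes model: "incidental_model P X0 eps0 sd M X eps Y mu beta"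
    and A: "assumption_A M X eps kappa gamma"
    and parameters: "incidental_parameters mu s1 s2 kappa gamma"
    and B: "assumption_B mu s1 kappa gamma lam"
    and muhat_measurable:
      "\<And>n i. i \<in> {1..n} \<Longrightarrow> (\<lambda>\<omega>. muhat n \<omega> i) \<in> borel_measurable (M n)"
    and betahat_measurable: "\<And>n. betahat n \<in> borel_measurable (M n)"
    and minimizer: "\<And>n \<omega>. \<omega> \<in> space (M n) \<Longrightarrow>
      is_penalized_minimizer n (lam n) (\<lambda>i. X n i \<omega>) (\<lambda>i. Y n i \<omega>) (muhat n \<omega>) (betahat n \<omega>)"
    and betatilde: "\<And>n \<omega>. \<omega> \<in> space (M n) \<Longrightarrow>
      betatilde n \<omega> =
        least_squares (\<lambda>i. X n i \<omega>) (\<lambda>i. Y n i \<omega>) (zero_set n (muhat n \<omega>))"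
  shows "((\<lambda>n. real (s2 n)) \<in> o(\<lambda>n. real n / (kappa n * gamma n)) \<or> assumption_C P X0 mu s1 s2 \<longrightarrow>
           converges_in_probability M betatilde beta) \<and>
         ((\<lambda>n. real (s2 n)) \<in> o(\<lambda>n. sqrt (real n) / (kappa n * gamma n)) \<or>
             (assumption_C P X0 mu s1 s2 \<and>
              (\<lambda>n. (D_norm mu s1 s2 n)\<^sup>2 / real n) \<in> o(\<lambda>_. 1)) \<longrightarrow>
           converges_in_distribution M (\<lambda>n \<omega>. sqrt (real n) *\<^sub>R (betatilde n \<omega> - beta))
             (multivariate_normal 0 (sd\<^sup>2 *\<^sub>R matrix_inv (covariance_matrix P X0))))"
proof -
  interpret incidental P X0 eps0 sd M X eps Y mu beta s1 s2 kappa gamma lam muhat betahat betatilde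
    by (rule incidental.intro[OF model A parameters B muhat_measurable minimizer betatilde])
  \<comment> \<open>Both alternatives for the limit law act through the same property, the vanishing
    of the signal divided by the square root of \<open>n\<close>.\<close>
  show ?thesis
    using betatilde_consistent betatilde_asymptotically_normal scaled_signal_vanishes_max
      scaled_signal_vanishes_L2 by blast
qed

end
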